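(* Let $h$ be a boundary function and suppose that (Poly-$R_1$) and $\mathbf{HK}^h_B$ hold. Then for every $T>0$, the following estimates are valid for all $(t,x,y)\in(0,T]\times D\times D$ (with constants independent of $t,x,y$). (i) If $\psi(\rho(x,y))\le t$, then $$q(t,x,y)\simeq\frac{h(\phi^{-1}(1/t)^{-1},x,y)}{V(x,\psi^{-1}(t))}.$$ (ii) If $\psi(\rho(x,y))\ge t$, then $$q(t,x,y)\asymp\frac{C_0}{V(x,\rho(x,y))\Psi(\rho(x,y))}\bigg(t\,\mathcal{B}_h(t,x,y)+\frac{h(\phi^{-1}(1/t)^{-1},x,y)}{\phi^{-1}(1/t)}\bigg)$$ $$+\frac{h(\phi^{-1}(1/t)^{-1},x,y)}{V(x,\psi^{-1}(t))}\exp\Big(-\frac{c\,\rho(x,y)^2}{\psi^{-1}(t)^2}\Big)+h(\Phi(\rho(x,y)),x,y)\,\frac{t\,w(\Phi(\rho(x,y)))}{V(x,\rho(x,y))},$$ where $\mathcal{B}_h(t,x,y):=\int_{2\phi^{-1}(1/t)^{-1}}^{4\Phi(\rho(x,y))}h(s,x,y)\,w(s)\,ds$. Here $\asymp$ means that $q(t,x,y)$ is bounded below by $a_1$ times the right-hand side with $c=a_2$ and above by $a_3$ times the right-hand side with $c=a_4$, for some constants $a_1,a_2,a_3,a_4>0$.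
   Context: Notation: $a\wedge b=\min$, $a\vee b=\max$; $f\simeq g$ means $c_1g\le f\le c_2g$ on the specified range for some constants $c_1,c_2>0$. $\phi^{-1}(1/t)^{-1}=1/\phi^{-1}(1/t)$. Quotients $c/0$ with $c>0$ are $+\infty$. Subordinator: $S=(S_t)_{t\ge0}$ is a driftless subordinator (non-decreasing pure-jump Lévy process, $S_0=0$) with Laplace exponent $\phi(\lambda)=-\log\mathbb{E}e^{-\lambda S_1}=\int_0^\infty(1-e^{-\lambda s})\nu(ds)$ and $w(r):=\nu(r,\infty)$. Condition (Poly-$R_1$), $R_1\in(0,\infty]$: there are constants $c_1,c_2>0$, $\beta_2\ge\beta_1>0$ with $c_1(R/r)^{\beta_1}\le w(r)/w(R)\le c_2(R/r)^{\beta_2}$ for all $0<r\le R<R_1$. Space and process: $(E,\rho)$ is a locally compact separable metric space in which all bounded closed sets are compact, $m$ is a positive Radon measure on $E$ with full support, $B(x,r)$ is the open ball, $V(x,r)=m(B(x,r))$. There are $R_E\in(0,\infty]$ and $d_2\ge d_1>0$ such that for every $a\ge1$ there is $C_V\ge1$ with $C_V^{-1}(R/r)^{d_1}\le V(x,R)/V(x,r)\le C_V(R/r)^{d_2}$ for all $x\in E$, $0<r\le R<aR_E$. $D\subset E$ is a proper open subset. $Y^D$ is a Hunt process in $D$ independent of $S$ whose semigroup has a density (heat kernel) $p_D(t,x,y)$ with respect to $m$; $X_t=Y^D_{S_t}$ has heat kernel $q(t,x,y)=\int_0^\infty p_D(s,x,y)\mathbb{P}(S_t\in ds)$. Scale functions: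 $\Phi,\Psi:[0,\infty)\to[0,\infty)$ are strictly increasing, $\Psi\ge\Phi$, and for some constants $\alpha_1,\dots,\alpha_4,c_1,\dots,c_4>0$ and all $R\ge r>0$: $c_1(R/r)^{\alpha_1}\le\Phi(R)/\Phi(r)\le c_2(R/r)^{\alpha_2}$ and $c_3(R/r)^{\alpha_3}\le\Psi(R)/\Psi(r)\le c_4(R/r)^{\alpha_4}$. Set $\psi(r)=1/\phi(1/\Phi(r))$ for $r>0$, $\psi(0)=0$; thus $\psi^{-1}(t)=\Phi^{-1}(\phi^{-1}(1/t)^{-1})$. Boundary function: $h:(0,\infty)\times D\times D\to[0,1]$ such that (H1) $s\mapsto h(s,x,y)$ is non-increasing for all $x,y\in D$; (H2) there are $c_1>0$, $\gamma\ge0$ with $s^\gamma h(s,x,y)\le c_1t^\gamma h(t,x,y)$ for $0<s\le t<4\Phi(\mathrm{diam}(D))+1$, $x,y\in D$. Heat kernel condition: for $C_0\in\{0,1\}$ and $c>0$ put $$I_{c}(t,x,y)=\frac1{V(x,\Phi^{-1}(t))}\wedge\Big(\frac{C_0t}{V(x,\rho(x,y))\Psi(\rho(x,y))}+\frac1{V(x,\Phi^{-1}(t))}\exp\Big(-\frac{c\,\rho(x,y)^2}{\Phi^{-1}(t)^2}\Big)\Big)$$ (the first summand is absent if $C_0=0$). $\mathbf{HK}^h_B$: $D$ is bounded; (i) there are $C_0\in\{0,1\}$ and $c_1,c_2,c_3,c_4>0$ with $c_1h(t,x,y)I_{c_2}(t,x,y)\le p_D(t,x,y)\le c_3h(t,x,y)I_{c_4}(t,x,y)$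 for all $(t,x,y)\in(0,1]\times D\times D$; (ii) there is $\lambda_D>0$ with $p_D(t,x,y)\simeq e^{-\lambda_Dt}h(1,x,y)$ for $(t,x,y)\in[1,\infty)\times D\times D$. The constant $C_0$ in the claim is the one in this condition. Standing convention: $\Phi$ is normalized (by multiplication by a constant) so that $\Phi(\mathrm{diam}(D))<R_1/8$.
   Formalization: The formal theorem also assumes that (H2) holds for 0 < s ≤ t ≤ φ^{-1}(1/T)^{-1}; this is automatic if that time is below 4Φ(diam(D))+1. Without it the claim fails for large T, e.g. for an h that vanishes at times ≥ 4Φ(diam(D))+1. *)

theory Defs
  imports "HOL-Probability.Probability"
begin

section \<open>Metric measure spaces\<close>

text \<open>
  The metric space \<open>E\<close> is the whole type \<open>'a\<close>; separability is the class
  \<^class>\<open>second_countable_topology\<close>.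
\<close>

definition proper_space :: "'a::metric_space itself \<Rightarrow> bool" where
  "proper_space _ \<longleftrightarrow>
     locally compact (UNIV :: 'a set) \<and> (\<forall>K :: 'a set. bounded K \<longrightarrow> closed K \<longrightarrow> compact K)"

definition radon_measure :: "'a::metric_space measure \<Rightarrow> bool" where
  "radon_measure m \<longleftrightarrow>
     sets m = sets borel \<and>
     (\<forall>K. compact K \<longrightarrow> emeasure m K < \<infinity>) \<and>
     (\<forall>A\<in>sets borel. emeasure m A = (SUP K\<in>{K. compact K \<and> K \<subseteq> A}. emeasure m K))"

definition full_support :: "'a::metric_space measure \<Rightarrow> bool" where
  "full_support m \<longleftrightarrow> (\<forall>U. open U \<longrightarrow> U \<noteq> {} \<longrightarrow> 0 < emeasure m U)"

definition vol :: "'a::metric_space measure \<Rightarrow> 'a \<Rightarrow> real \<Rightarrow> real" where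
  "vol m x r = measure m (ball x r)"

definition volume_growth :: "'a::metric_space measure \<Rightarrow> bool" where
  "volume_growth m \<longleftrightarrow>
     (\<exists>(R_E::ereal) d1 d2. 0 < R_E \<and> 0 < d1 \<and> d1 \<le> d2 \<and>
       (\<forall>a\<ge>1. \<exists>C\<ge>1. \<forall>x r R. 0 < r \<longrightarrow> r \<le> R \<longrightarrow> ereal R < ereal a * R_E \<longrightarrow>
          inverse C * (R / r) powr d1 \<le> vol m x R / vol m x r \<and>
          vol m x R / vol m x r \<le> C * (R / r) powr d2))"


section \<open>Scale functions\<close>

definition power_scaling :: "(real \<Rightarrow> real) \<Rightarrow> bool" where
  "power_scaling f \<longleftrightarrow>
     (\<exists>a1>0. \<exists>a2>0. \<exists>c1>0. \<exists>c2>0. \<forall>r R. 0 < r \<longrightarrow> r \<le> R \<longrightarrow>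
        c1 * (R / r) powr a1 \<le> f R / f r \<and> f R / f r \<le> c2 * (R / r) powr a2)"

definition scale_functions :: "(real \<Rightarrow> real) \<Rightarrow> (real \<Rightarrow> real) \<Rightarrow> bool" where
  "scale_functions \<Phi> \<Psi> \<longleftrightarrow>
     (\<forall>r\<ge>0. 0 \<le> \<Phi> r \<and> \<Phi> r \<le> \<Psi> r) \<and>
     strict_mono_on {0..} \<Phi> \<and> strict_mono_on {0..} \<Psi> \<and>
     power_scaling \<Phi> \<and> power_scaling \<Psi>"

text \<open>
  Scale functions need not be continuous, hence need not be onto \<open>[0, \<infinity>)\<close>; the inverse is
  therefore the right-continuous one, which extends the inverse on the range of the function.
\<close>

definition rinv :: "(real \<Rightarrow> real) \<Rightarrow> real \<Rightarrow> real" where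
  "rinv f t = Inf {r. 0 \<le> r \<and> t < f r}"

lemma rinv_eq_inverse:
  assumes "strict_mono_on {0..} f" and "0 \<le> r"
  shows "rinv f (f r) = r"
proof -
  have "{s. 0 \<le> s \<and> f r < f s} = {r<..}"
    using assms by (auto simp: strict_mono_on_less)
  then show ?thesis
    by (simp add: rinv_def)
qed

definition psi :: "(real \<Rightarrow> real) \<Rightarrow> (real \<Rightarrow> real) \<Rightarrow> real \<Rightarrow> real" where
  "psi \<phi> \<Phi> r = (if r = 0 then 0 else 1 / \<phi> (1 / \<Phi> r))"


section \<open>Subordinators\<close>

text \<open>Only times \<open>t \<ge> 0\<close> are meaningful. A non-decreasing path has left limits automatically.\<close>

definition subordinator :: "'w measure \<Rightarrow> (real \<Rightarrow> 'w \<Rightarrow> real) \<Rightarrow> bool" where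
  "subordinator M S \<longleftrightarrow>
     prob_space M \<and>
     (\<forall>t\<ge>0. S t \<in> borel_measurable M) \<and>
     (AE \<omega> in M. S 0 \<omega> = 0) \<and>
     (\<forall>n (\<tau> :: nat \<Rightarrow> real). 0 \<le> \<tau> 0 \<longrightarrow> mono \<tau> \<longrightarrow>
        prob_space.indep_vars M (\<lambda>_. borel) (\<lambda>i \<omega>. S (\<tau> (Suc i)) \<omega> - S (\<tau> i) \<omega>) {..<n}) \<and>
     (\<forall>s\<ge>0. \<forall>t\<ge>0. distr M borel (\<lambda>\<omega>. S (s + t) \<omega> - S s \<omega>) = distr M borel (S t)) \<and>
     (AE \<omega> in M. mono_on {0..} (\<lambda>t. S t \<omega>) \<and>
        (\<forall>t\<ge>0. continuous (at_right t) (\<lambda>s. S s \<omega>)))"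

definition levy_measure :: "real measure \<Rightarrow> bool" where
  "levy_measure \<nu> \<longleftrightarrow>
     sets \<nu> = sets borel \<and> emeasure \<nu> {..0} = 0 \<and> (\<integral>\<^sup>+s. ennreal (min 1 s) \<partial>\<nu>) < \<infinity>"

text \<open>
  Being driftless and purely discontinuous is expressed by the absence of a linear term from the
  Levy--Khintchine formula for \<open>\<phi>\<close>.
\<close>

definition driftless_subordinator ::
    "'w measure \<Rightarrow> (real \<Rightarrow> 'w \<Rightarrow> real) \<Rightarrow> (real \<Rightarrow> real) \<Rightarrow> real measure \<Rightarrow> bool" where
  "driftless_subordinator M S \<phi> \<nu> \<longleftrightarrow>
     subordinator M S \<and> levy_measure \<nu> \<and>
     (\<forall>u\<ge>0. \<phi> u = - ln (LINT \<omega>|M. exp (- u * S 1 \<omega>)) \<and>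
            \<phi> u = (LINT s:{0<..}|\<nu>. 1 - exp (- u * s)))"

definition levy_tail :: "real measure \<Rightarrow> real \<Rightarrow> real" where
  "levy_tail \<nu> r = measure \<nu> {r<..}"

text \<open>
  The lower bound forces \<open>w R > 0\<close>, because \<open>x / 0 = 0\<close>.
\<close>

definition poly_tail :: "ereal \<Rightarrow> (real \<Rightarrow> real) \<Rightarrow> bool" where
  "poly_tail R1 w \<longleftrightarrow> 0 < R1 \<and>
     (\<exists>c1>0. \<exists>c2>0. \<exists>\<beta>1>0. \<exists>\<beta>2\<ge>\<beta>1. \<forall>r R. 0 < r \<longrightarrow> r \<le> R \<longrightarrow> ereal R < R1 \<longrightarrow>
        c1 * (R / r) powr \<beta>1 \<le> w r / w R \<and> w r / w R \<le> c2 * (R / r) powr \<beta>2)"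


section \<open>Hunt processes on an open set\<close>

text \<open>
  The one-point compactification of \<open>D\<close> has carrier \<open>insert None (Some ` D)\<close>, where \<open>None\<close> is
  the cemetery.
\<close>

abbreviation compactified :: "'a::topological_space set \<Rightarrow> 'a option topology" where
  "compactified D \<equiv> Alexandroff_compactification (top_of_set D)"

definition state_space :: "'a::topological_space set \<Rightarrow> 'a option measure" where
  "state_space D = sigma (topspace (compactified D)) {U. openin (compactified D) U}"

text \<open>
  Time runs through \<open>[0, \<infinity>]\<close>, the type \<^typ>\<open>ennreal\<close>, so that stopping times may be infinite;
  by convention the process sits in the cemetery at time \<open>\<infinity>\<close>. The simple Markov property is the
  strong one at constant times. An arbitrary initial law is a mixture of the \<open>P z\<close>, so
  it suffices to impose the strong Markov property and quasi-left-continuity under each \<open>P z\<close>.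
\<close>

definition strong_markov ::
    "'w measure \<Rightarrow> 'a::topological_space set \<Rightarrow> ('a option \<Rightarrow> 'w measure) \<Rightarrow>
     (ennreal \<Rightarrow> 'w \<Rightarrow> 'a option) \<Rightarrow> (ennreal \<Rightarrow> 'w measure) \<Rightarrow> bool" where
  "strong_markov A D P Y F \<longleftrightarrow>
     (\<forall>\<sigma>. stopping_time F \<sigma> \<longrightarrow>
       (\<forall>z\<in>space (state_space D). \<forall>s<\<infinity>. \<forall>B\<in>sets (state_space D).
        \<forall>\<Lambda>\<in>sets (filtration.pre_sigma (space A) F \<sigma>).
          emeasure (P z) {\<omega>\<in>\<Lambda>. Y (\<sigma> \<omega> + s) \<omega> \<in> B} =
          (\<integral>\<^sup>+\<omega>. emeasure (P (Y (\<sigma> \<omega>) \<omega>)) {\<omega>'\<in>space A. Y s \<omega>' \<in> B} * indicator \<Lambda> \<omega> \<partial>P z)))"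

definition quasi_left_continuous ::
    "'a::topological_space set \<Rightarrow> ('a option \<Rightarrow> 'w measure) \<Rightarrow>
     (ennreal \<Rightarrow> 'w \<Rightarrow> 'a option) \<Rightarrow> (ennreal \<Rightarrow> 'w measure) \<Rightarrow> bool" where
  "quasi_left_continuous D P Y F \<longleftrightarrow>
     (\<forall>\<sigma> :: nat \<Rightarrow> 'w \<Rightarrow> ennreal. (\<forall>n. stopping_time F (\<sigma> n)) \<longrightarrow> incseq \<sigma> \<longrightarrow>
       (\<forall>z\<in>space (state_space D). AE \<omega> in P z.
          (SUP n. \<sigma> n \<omega>) < \<infinity> \<longrightarrow>
          limitin (compactified D) (\<lambda>n. Y (\<sigma> n \<omega>) \<omega>) (Y (SUP n. \<sigma> n \<omega>) \<omega>) sequentially))"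

definition hunt_process ::
    "'w measure \<Rightarrow> 'a::topological_space set \<Rightarrow> ('a option \<Rightarrow> 'w measure) \<Rightarrow>
     (ennreal \<Rightarrow> 'w \<Rightarrow> 'a option) \<Rightarrow> bool" where
  "hunt_process A D P Y \<longleftrightarrow>
     (\<forall>z\<in>space (state_space D). prob_space (P z) \<and> sets (P z) = sets A) \<and>
     (\<forall>t. Y t \<in> A \<rightarrow>\<^sub>M state_space D) \<and>
     (\<forall>t. \<forall>B\<in>sets (state_space D).
        (\<lambda>z. emeasure (P z) {\<omega>\<in>space A. Y t \<omega> \<in> B}) \<in> borel_measurable (state_space D)) \<and>
     (\<forall>z\<in>space (state_space D). AE \<omega> in P z. Y 0 \<omega> = z) \<and>
     (\<forall>t. AE \<omega> in P None. Y t \<omega> = None) \<and>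
     (\<forall>\<omega>\<in>space A.
        Y \<infinity> \<omega> = None \<and>
        (\<forall>s t. s \<le> t \<longrightarrow> Y s \<omega> = None \<longrightarrow> Y t \<omega> = None) \<and>
        (\<forall>t<\<infinity>. limitin (compactified D) (\<lambda>s. Y s \<omega>) (Y t \<omega>) (at_right t)) \<and>
        (\<forall>t<\<infinity>. 0 < t \<longrightarrow> (\<exists>l. limitin (compactified D) (\<lambda>s. Y s \<omega>) l (at_left t)))) \<and>
     (\<forall>t<\<infinity>. \<exists>\<theta>\<in>space A \<rightarrow> space A. \<forall>s. \<forall>\<omega>\<in>space A. Y s (\<theta> \<omega>) = Y (s + t) \<omega>) \<and>
     (\<exists>F. filtration (space A) F \<and>
        (\<forall>t. sets (F t) \<subseteq> sets A) \<and>
        (\<forall>t. Y t \<in> F t \<rightarrow>\<^sub>M state_space D) \<and>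
        (\<forall>t<\<infinity>. sets (F t) = (\<Inter>s\<in>{t<..}. sets (F s))) \<and>
        strong_markov A D P Y F \<and>
        quasi_left_continuous D P Y F)"

definition independent_of ::
    "'a::topological_space set \<Rightarrow> ('a option \<Rightarrow> 'w measure) \<Rightarrow>
     (ennreal \<Rightarrow> 'w \<Rightarrow> 'a option) \<Rightarrow> (real \<Rightarrow> 'w \<Rightarrow> real) \<Rightarrow> bool" where
  "independent_of D P Y S \<longleftrightarrow>
     (\<forall>z\<in>space (state_space D).
        prob_space.indep_set (P z)
          (sets (vimage_algebra (space (P z)) (\<lambda>\<omega> t. Y t \<omega>) (PiM UNIV (\<lambda>_. state_space D))))
          (sets (vimage_algebra (space (P z)) (\<lambda>\<omega>. \<lambda>t\<in>{0..}. S t \<omega>)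
             (PiM {0..} (\<lambda>_. borel)))))"


section \<open>Heat kernels\<close>

definition transition_density ::
    "'a::metric_space measure \<Rightarrow> 'a set \<Rightarrow> 'w measure \<Rightarrow> ('a option \<Rightarrow> 'w measure) \<Rightarrow>
     (ennreal \<Rightarrow> 'w \<Rightarrow> 'a option) \<Rightarrow> (real \<Rightarrow> 'a \<Rightarrow> 'a \<Rightarrow> ennreal) \<Rightarrow> bool" where
  "transition_density m D A P Y p \<longleftrightarrow>
     (\<lambda>(t, x, y). p t x y) \<in> borel_measurable (restrict_space borel ({0<..} \<times> D \<times> D)) \<and>
     (\<forall>t>0. \<forall>x\<in>D. \<forall>B\<in>sets borel. B \<subseteq> D \<longrightarrow>
        emeasure (P (Some x)) {\<omega>\<in>space A. Y (ennreal t) \<omega> \<in> Some ` B} =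
        (\<integral>\<^sup>+y\<in>B. p t x y \<partial>m))"

text \<open>
  If \<open>p\<close> is the transition density of \<open>Y\<close> and \<open>S\<close> is independent of \<open>Y\<close>, this is the
  transition density of the subordinate process \<open>X\<^sub>t = Y\<^bsub>S\<^sub>t\<^esub>\<close>. The law of \<open>S t\<close> is the same
  under every \<open>P z\<close>.
\<close>

definition subordinate_kernel ::
    "('a option \<Rightarrow> 'w measure) \<Rightarrow> (real \<Rightarrow> 'w \<Rightarrow> real) \<Rightarrow> (real \<Rightarrow> 'a \<Rightarrow> 'a \<Rightarrow> ennreal) \<Rightarrow>
     real \<Rightarrow> 'a \<Rightarrow> 'a \<Rightarrow> ennreal" where
  "subordinate_kernel P S p t x y = (\<integral>\<^sup>+s. p s x y \<partial>distr (P (Some x)) borel (S t))"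


section \<open>Boundary functions and the heat kernel condition\<close>

text \<open>
  A boundary function satisfies this for times up to \<open>4 \<Phi>(diam D) + 1\<close> only, and then its values
  at larger times are not controlled from below (they may vanish). Estimates of the subordinate
  kernel for \<open>t \<le> T\<close> involve \<open>h\<close> at times up to \<open>1 / \<phi>\<^sup>-\<^sup>1(1 / T)\<close>, so for large \<open>T\<close> they are
  false unless the property persists up to that time.
\<close>

definition time_doubling ::
    "(real \<Rightarrow> 'a \<Rightarrow> 'a \<Rightarrow> real) \<Rightarrow> 'a set \<Rightarrow> real set \<Rightarrow> bool" where
  "time_doubling h D J \<longleftrightarrow>
     (\<exists>c>0. \<exists>\<gamma>\<ge>0. \<forall>s\<in>J. \<forall>t\<in>J. \<forall>x\<in>D. \<forall>y\<in>D. s \<le> t \<longrightarrow>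
        s powr \<gamma> * h s x y \<le> c * t powr \<gamma> * h t x y)"

lemma time_doubling_subset: "time_doubling h D J \<Longrightarrow> I \<subseteq> J \<Longrightarrow> time_doubling h D I"
  unfolding time_doubling_def by (meson subsetD)

text \<open>For unbounded \<open>D\<close> the diameter is infinite and there is no upper time limit.\<close>

definition boundary_function ::
    "(real \<Rightarrow> real) \<Rightarrow> 'a::metric_space set \<Rightarrow> (real \<Rightarrow> 'a \<Rightarrow> 'a \<Rightarrow> real) \<Rightarrow> bool" where
  "boundary_function \<Phi> D h \<longleftrightarrow>
     (\<forall>s>0. \<forall>x\<in>D. \<forall>y\<in>D. 0 \<le> h s x y \<and> h s x y \<le> 1) \<and>
     (\<forall>x\<in>D. \<forall>y\<in>D. antimono_on {0<..} (\<lambda>s. h s x y)) \<and>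
     time_doubling h D {t. 0 < t \<and> (bounded D \<longrightarrow> t < 4 * \<Phi> (diameter D) + 1)}"

text \<open>
  In \<^typ>\<open>ennreal\<close> one has \<open>t / 0 = \<infinity>\<close> for \<open>t > 0\<close> and \<open>0 / 0 = 0\<close>; thus on the diagonal the
  jump term is infinite if \<open>C0 = 1\<close>, and it is absent if \<open>C0 = 0\<close>.
\<close>

definition hk_profile ::
    "'a::metric_space measure \<Rightarrow> (real \<Rightarrow> real) \<Rightarrow> (real \<Rightarrow> real) \<Rightarrow> real \<Rightarrow> real \<Rightarrow>
     real \<Rightarrow> 'a \<Rightarrow> 'a \<Rightarrow> ennreal" where
  "hk_profile m \<Phi> \<Psi> C0 c t x y =
     min (1 / ennreal (vol m x (rinv \<Phi> t)))
         (ennreal (C0 * t) / ennreal (vol m x (dist x y) * \<Psi> (dist x y)) +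
          1 / ennreal (vol m x (rinv \<Phi> t)) *
            ennreal (exp (- c * (dist x y)\<^sup>2 / (rinv \<Phi> t)\<^sup>2)))"

definition HK_B ::
    "'a::metric_space measure \<Rightarrow> (real \<Rightarrow> real) \<Rightarrow> (real \<Rightarrow> real) \<Rightarrow> 'a set \<Rightarrow>
     (real \<Rightarrow> 'a \<Rightarrow> 'a \<Rightarrow> real) \<Rightarrow> real \<Rightarrow> (real \<Rightarrow> 'a \<Rightarrow> 'a \<Rightarrow> ennreal) \<Rightarrow> bool" where
  "HK_B m \<Phi> \<Psi> D h C0 p \<longleftrightarrow>
     bounded D \<and> C0 \<in> {0, 1} \<and>
     (\<exists>c1>0. \<exists>c2>0. \<exists>c3>0. \<exists>c4>0. \<forall>t\<in>{0<..1}. \<forall>x\<in>D. \<forall>y\<in>D.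
        ennreal (c1 * h t x y) * hk_profile m \<Phi> \<Psi> C0 c2 t x y \<le> p t x y \<and>
        p t x y \<le> ennreal (c3 * h t x y) * hk_profile m \<Phi> \<Psi> C0 c4 t x y) \<and>
     (\<exists>ev>0. \<exists>c1>0. \<exists>c2>0. \<forall>t\<ge>1. \<forall>x\<in>D. \<forall>y\<in>D.
        ennreal (c1 * exp (- ev * t) * h 1 x y) \<le> p t x y \<and>
        p t x y \<le> ennreal (c2 * exp (- ev * t) * h 1 x y))"

definition boundary_integral ::
    "(real \<Rightarrow> real) \<Rightarrow> (real \<Rightarrow> real) \<Rightarrow> (real \<Rightarrow> real) \<Rightarrow> (real \<Rightarrow> 'a::metric_space \<Rightarrow> 'a \<Rightarrow> real) \<Rightarrow>
     real \<Rightarrow> 'a \<Rightarrow> 'a \<Rightarrow> real" where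
  "boundary_integral \<phi> w \<Phi> h t x y =
     (LINT s:{2 / rinv \<phi> (1 / t) .. 4 * \<Phi> (dist x y)}|lborel. h s x y * w s)"

end

theory Submission
  imports Defs "HOL-Real_Asymp.Real_Asymp"
begin

text \<open>
  The subordinate kernel is the integral of \<open>u \<mapsto> p u x y\<close> against the law \<open>\<mu>\<close> of the subordinator at
  time \<open>t\<close>. Write \<open>s = 1 / \<phi>\<^sup>-\<^sup>1(1/t)\<close> for the size that the subordinator typically has at that time,
  \<open>\<rho>\<close> for the distance of \<open>x\<close> and \<open>y\<close>, and \<open>r = \<Phi>(\<rho>)\<close>. The two regimes of the statement are
  \<open>r \<le> s\<close> and \<open>r \<ge> s\<close>, because \<open>psi \<phi> \<Phi> \<rho> \<le> t\<close> means \<open>r \<le> s\<close>.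

  Five facts about \<open>\<mu>\<close> enter, collected in \<open>law_bounds\<close>: \<open>\<mu>\<close> does not charge \<open>0\<close>; a suitable
  negative moment of \<open>u / s\<close> is bounded; \<open>u\<close> is comparable with \<open>s\<close> with positive probability; and for \<open>v \<ge> K s\<close> both
  \<open>\<mu> {v<..}\<close> and \<open>\<mu> {\<delta> v..v}\<close> are comparable with \<open>t w(v)\<close>. The first three follow from the Laplace
  transform \<open>exp (- t \<phi>)\<close> and the lower scaling of \<open>\<phi>\<close> (\<open>exponent_scaling\<close>). The tail estimates are
  more delicate, since the upper exponent of \<open>w\<close> may exceed \<open>1\<close> and then \<open>t w(v)\<close> may be much smaller
  than \<open>t \<phi>(1/v)\<close>, which is all that the Laplace transform gives at \<open>1 / v\<close>. They come from one big
  jump: the path up to time \<open>t\<close> is cut into \<open>n\<close> independent increments, and for large \<open>n\<close> the expected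
  number of increments beyond \<open>a\<close> is close to \<open>t w(a)\<close> (\<open>small_time_tail\<close>). For the upper bound
  (\<open>prob_large_upper\<close>) the increments below \<open>v / 4\<close> are controlled by an exponential moment whose
  exponent is chosen according to the size of \<open>t w(v)\<close>; for the lower bound (\<open>prob_window_lower\<close>) one
  increment makes the jump while the others stay small.

  Given this, the estimates are a computation for a fixed pair of points. Times up to a multiple of
  \<open>s\<close> contribute the kernel at time \<open>s\<close>: the boundary function and the volume change at most by powers
  of \<open>s / u\<close>, which the negative moments absorb. This is already the whole story if \<open>r \<le> s\<close>. If
  \<open>r \<ge> s\<close>, the times \<open>u > K s\<close> contribute in two ways. The Gaussian part of the kernel decays faster
  than any power of \<open>u / r\<close> below \<open>r\<close>, so that only times of order at least \<open>r\<close> count, reached by a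
  single jump of the subordinator; this gives \<open>h(r) t w(r) / V(\<rho>)\<close> (\<open>truncated_moment\<close>). The jump part
  of the kernel is linear in \<open>u\<close>, and the integral of \<open>u h(u)\<close> against \<open>\<mu>\<close> equals \<open>s h(s)\<close> plus
  \<open>t \<integral> h w\<close> up to constants (\<open>first_moment_upper\<close>, \<open>first_moment_lower\<close>).
\<close>

section \<open>The Laplace exponent and the tail of the Levy measure\<close>

locale levy_exponent =
  fixes \<nu> :: "real measure" and \<phi> :: "real \<Rightarrow> real"
  assumes levy: "levy_measure \<nu>"
    and exponent_set_integral: "\<And>u. 0 \<le> u \<Longrightarrow> \<phi> u = (LINT s:{0<..}|\<nu>. 1 - exp (- u * s))"
begin

abbreviation w :: "real \<Rightarrow> real" where "w \<equiv> levy_tail \<nu>"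

lemma sets_levy [measurable_cong, simp]: "sets \<nu> = sets borel"
  using levy by (simp add: levy_measure_def)

lemma space_levy [simp]: "space \<nu> = UNIV"
  using sets_eq_imp_space_eq[OF sets_levy] by simp

lemma AE_jump_pos: "AE x in \<nu>. 0 < x"
proof -
  have "emeasure \<nu> {..0} = 0" using levy by (simp add: levy_measure_def)
  then have "AE x in \<nu>. x \<notin> {..0}"
    by (intro AE_not_in) (simp add: null_sets_def)
  then show ?thesis by eventually_elim auto
qed

lemma integrable_min_one: "integrable \<nu> (\<lambda>x. min 1 x)"
proof (rule integrableI_nonneg)
  show "AE x in \<nu>. 0 \<le> min 1 x" using AE_jump_pos by eventually_elim auto
  show "(\<integral>\<^sup>+ x. ennreal (min 1 x) \<partial>\<nu>) < \<infinity>" using levy by (simp add: levy_measure_def)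
qed simp

lemma one_minus_exp_le_min:
  assumes "0 \<le> u" "0 \<le> x" "u \<le> K" "1 \<le> K"
  shows "1 - exp (- u * x) \<le> K * min 1 (x::real)"
proof -
  have "1 - exp (- u * x) \<le> u * x" using exp_ge_add_one_self[of "- u * x"] by simp
  also have "\<dots> \<le> K * x" using assms by (intro mult_right_mono) auto
  finally have "1 - exp (- u * x) \<le> K * x" .
  moreover have "1 - exp (- u * x) \<le> K" using assms(4) by (smt (verit) exp_gt_zero)
  ultimately show ?thesis by (auto simp: min_def)
qed

lemma integrable_one_minus_exp:
  assumes "0 \<le> u" shows "integrable \<nu> (\<lambda>x. 1 - exp (- u * x))"
proof (rule Bochner_Integration.integrable_bound)
  show "integrable \<nu> (\<lambda>x. max 1 u * min 1 x)" using integrable_min_one by simp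
  show "AE x in \<nu>. norm (1 - exp (- u * x)) \<le> norm (max 1 u * min 1 x)"
    using AE_jump_pos
  proof eventually_elim
    case (elim x)
    have "1 - exp (- u * x) \<le> max 1 u * min 1 x"
      using elim assms by (intro one_minus_exp_le_min) auto
    moreover have "0 \<le> 1 - exp (- u * x)" using elim assms by auto
    ultimately show ?case by auto
  qed
qed simp

lemma exponent_eq: assumes "0 \<le> u" shows "\<phi> u = (\<integral>x. 1 - exp (- u * x) \<partial>\<nu>)"
proof -
  have "\<phi> u = (\<integral>x. indicator {0<..} x *\<^sub>R (1 - exp (- u * x)) \<partial>\<nu>)"
    using exponent_set_integral[OF assms] by (simp add: set_lebesgue_integral_def)
  also have "\<dots> = (\<integral>x. 1 - exp (- u * x) \<partial>\<nu>)"
  proof (rule integral_cong_AE)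
    show "AE x in \<nu>. indicator {0<..} x *\<^sub>R (1 - exp (- u * x)) = 1 - exp (- u * x)"
      using AE_jump_pos by eventually_elim simp
  qed auto
  finally show ?thesis .
qed

lemma exponent_zero [simp]: "\<phi> 0 = 0"
  by (simp add: exponent_eq)

lemma exponent_mono: assumes "0 \<le> u" "u \<le> v" shows "\<phi> u \<le> \<phi> v"
proof -
  have "AE x in \<nu>. 1 - exp (- u * x) \<le> 1 - exp (- v * x)"
    using AE_jump_pos by eventually_elim (use assms in auto)
  then have "(\<integral>x. 1 - exp (- u * x) \<partial>\<nu>) \<le> (\<integral>x. 1 - exp (- v * x) \<partial>\<nu>)"
    using assms by (intro integral_mono_AE integrable_one_minus_exp) auto
  then show ?thesis using assms by (simp add: exponent_eq)
qed

lemma exponent_nonneg: "0 \<le> u \<Longrightarrow> 0 \<le> \<phi> u"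
  using exponent_mono[of 0 u] by simp

lemma exponent_continuous: "continuous_on {0..} \<phi>"
  unfolding continuous_on_sequentially
proof (intro allI ballI impI, elim conjE)
  fix X u assume u: "u \<in> {0..}" and X: "\<forall>n. X n \<in> {0::real..}" "X \<longlonglongrightarrow> u"
  obtain K where K: "\<And>n. X n \<le> K"
    using convergent_imp_Bseq[OF convergentI[OF X(2)]] by (metis Bseq_def abs_le_D1 real_norm_def)
  let ?K = "max 1 K"
  have "(\<lambda>n. \<integral>x. 1 - exp (- X n * x) \<partial>\<nu>) \<longlonglongrightarrow> (\<integral>x. 1 - exp (- u * x) \<partial>\<nu>)"
  proof (rule integral_dominated_convergence)
    show "integrable \<nu> (\<lambda>x. ?K * min 1 x)" using integrable_min_one by simp
    show "AE x in \<nu>. (\<lambda>n. 1 - exp (- X n * x)) \<longlonglongrightarrow> 1 - exp (- u * x)"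
      by (intro AE_I2 tendsto_intros X)
    fix n show "AE x in \<nu>. norm (1 - exp (- X n * x)) \<le> ?K * min 1 x"
      using AE_jump_pos
    proof eventually_elim
      case (elim x)
      have "0 \<le> X n" using X(1) by auto
      then show ?case using elim one_minus_exp_le_min[of "X n" x ?K] K[of n] by auto
    qed
  qed auto
  then show "(\<phi> \<circ> X) \<longlonglongrightarrow> \<phi> u" using X(1) u by (simp add: o_def exponent_eq)
qed

text \<open>Each function \<open>u \<mapsto> 1 - exp (- u x)\<close> is concave and vanishes at \<open>0\<close>, hence so is \<open>\<phi>\<close>.\<close>

lemma exponent_mult_le: assumes "1 \<le> a" "0 \<le> u" shows "\<phi> (a * u) \<le> a * \<phi> u"
proof -
  have concave: "1 - exp (- (a * u) * x) \<le> a * (1 - exp (- u * x))" for x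
  proof -
    have "exp ((1 - 1 / a) * 0 + (1 / a) * (- (a * u) * x)) \<le> (1 - 1 / a) * exp 0 + (1 / a) * exp (- (a * u) * x)"
      using assms convex_onD[OF exp_convex, of "1 / a" 0 "- (a * u) * x"] by simp
    then have "a * exp (- u * x) \<le> a * ((1 - 1 / a) + (1 / a) * exp (- (a * u) * x))"
      using assms by (intro mult_left_mono) auto
    then show ?thesis using assms by (simp add: algebra_simps)
  qed
  have "(\<integral>x. 1 - exp (- (a * u) * x) \<partial>\<nu>) \<le> (\<integral>x. a * (1 - exp (- u * x)) \<partial>\<nu>)"
    using assms
    by (intro integral_mono concave integrable_mult_right integrable_one_minus_exp) auto
  then show ?thesis using assms by (simp only: exponent_eq integral_mult_right_zero mult_nonneg_nonneg)
qed

lemma tail_finite: assumes "0 < r" shows "emeasure \<nu> {r<..} < \<infinity>"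
proof -
  have "integrable \<nu> (\<lambda>x. min 1 x)" by (rule integrable_min_one)
  have "emeasure \<nu> {r<..} = (\<integral>\<^sup>+x. indicator {r<..} x \<partial>\<nu>)" by simp
  also have "\<dots> \<le> (\<integral>\<^sup>+x. ennreal (1 / min 1 r) * ennreal (min 1 x) \<partial>\<nu>)"
    using assms
    by (intro nn_integral_mono)
       (auto simp: indicator_def ennreal_mult[symmetric] min_def field_simps split: if_splits)
  also have "\<dots> = ennreal (1 / min 1 r) * (\<integral>\<^sup>+x. ennreal (min 1 x) \<partial>\<nu>)"
    by (simp add: nn_integral_cmult)
  also have "\<dots> < \<infinity>" using levy by (simp add: levy_measure_def ennreal_mult_less_top)
  finally show ?thesis .
qed

lemma emeasure_tail: "0 < r \<Longrightarrow> emeasure \<nu> {r<..} = ennreal (w r)"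
  using tail_finite[of r] by (simp add: levy_tail_def emeasure_eq_ennreal_measure)

lemma tail_nonneg: "0 \<le> w r" by (simp add: levy_tail_def)

lemma tail_antimono: assumes "0 < r" "r \<le> R" shows "w R \<le> w r"
proof -
  have "emeasure \<nu> {R<..} \<le> emeasure \<nu> {r<..}" using assms by (intro emeasure_mono) auto
  then show ?thesis using assms tail_nonneg by (simp add: emeasure_tail)
qed

lemma tail_le_exponent: assumes "0 < r" shows "w r \<le> 2 * \<phi> (1 / r)"
proof -
  have "w r = (\<integral>x. indicator {r<..} x \<partial>\<nu>)" by (simp add: levy_tail_def)
  also have "\<dots> \<le> (\<integral>x. 2 * (1 - exp (- (1 / r) * x)) \<partial>\<nu>)"
  proof (rule integral_mono_AE)
    show "integrable \<nu> (indicator {r<..} :: real \<Rightarrow> real)"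
      using tail_finite[OF assms] by (simp add: integrable_indicator_iff)
    show "integrable \<nu> (\<lambda>x. 2 * (1 - exp (- (1 / r) * x)))"
      using integrable_one_minus_exp[of "1 / r"] assms by (intro integrable_mult_right) simp
    have half: "exp (- 1) \<le> (1/2 :: real)" using exp_ge_add_one_self[of "1::real"] by (simp add: exp_minus field_simps)
    have "1 \<le> 2 * (1 - exp (- (1 / r) * x))" if "r < x" for x :: real
    proof -
      have "exp (- (1 / r) * x) \<le> exp (- 1)" using that assms by (simp add: field_simps)
      from order.trans[OF this half] show ?thesis by argo
    qed
    moreover have "0 \<le> 2 * (1 - exp (- (1 / r) * x))" if "0 < x" for x
      using assms that by simp
    ultimately have "indicator {r<..} x \<le> 2 * (1 - exp (- (1 / r) * x))" if "0 < x" for x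
      using that by (cases "r < x") (simp_all only: indicator_def of_bool_def greaterThan_iff if_True if_False)
    with AE_jump_pos show "AE x in \<nu>. indicator {r<..} x \<le> 2 * (1 - exp (- (1 / r) * x))"
      by (auto elim: eventually_mono)
  qed
  also have "\<dots> = 2 * \<phi> (1 / r)" using assms by (simp only: exponent_eq integral_mult_right_zero zero_le_divide_1_iff less_imp_le)
  finally show ?thesis .
qed

lemma sigma_finite_levy: "sigma_finite_measure \<nu>"
proof
  let ?A = "insert {..0} (range (\<lambda>n::nat. {1 / real (Suc n)<..}))"
  show "\<exists>A. countable A \<and> A \<subseteq> sets \<nu> \<and> \<Union> A = space \<nu> \<and> (\<forall>a\<in>A. emeasure \<nu> a \<noteq> \<infinity>)"
  proof (intro exI[of _ ?A] conjI)
    have "x \<in> \<Union> ?A" for x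
      using reals_Archimedean[of x] by (cases "x \<le> 0") (auto simp: field_simps)
    then show "\<Union> ?A = space \<nu>" by auto
    show "\<forall>a\<in>?A. emeasure \<nu> a \<noteq> \<infinity>"
      using levy tail_finite by (auto simp: levy_measure_def less_top[symmetric] simp del: of_nat_Suc)
  qed auto
qed

lemma tail_measurable [measurable]: "w \<in> borel_measurable borel"
proof -
  interpret sigma_finite_measure \<nu> by (rule sigma_finite_levy)
  have "(\<lambda>r. \<integral>\<^sup>+x. indicator {(r, x). r < x} (r, x) \<partial>\<nu>) \<in> borel_measurable borel"
    by measurable
  also have "(\<lambda>r. \<integral>\<^sup>+x. indicator {(r, x). r < x} (r, x) \<partial>\<nu>) = (\<lambda>r. emeasure \<nu> {r<..})"
  proof
    fix r
    have "(\<integral>\<^sup>+x. indicator {(r, x). r < x} (r, x) \<partial>\<nu>) = (\<integral>\<^sup>+x. indicator {r<..} x \<partial>\<nu>)"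
      by (intro nn_integral_cong) (auto simp: indicator_def)
    then show "(\<integral>\<^sup>+x. indicator {(r, x). r < x} (r, x) \<partial>\<nu>) = emeasure \<nu> {r<..}" by simp
  qed
  finally show ?thesis unfolding levy_tail_def measure_def by measurable
qed

text \<open>
  Integration by parts: \<open>1 - exp (- x / r)\<close> is the integral of \<open>exp (- v)\<close> over \<open>r v < x\<close>. It turns
  the scaling of the tail into a scaling of \<open>\<phi>\<close> even when \<open>\<phi>\<close> is not comparable with the tail.
\<close>

lemma exponent_eq_tail_integral:
  assumes r: "0 < r"
  shows "ennreal (\<phi> (1 / r)) = (\<integral>\<^sup>+v. ennreal (exp (- v) * w (r * v)) * indicator {0<..} v \<partial>lborel)"
proof -
  interpret sigma_finite_measure \<nu> by (rule sigma_finite_levy)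
  interpret pair_sigma_finite lborel \<nu> ..
  have inner: "(\<integral>\<^sup>+v. ennreal (exp (- v)) * indicator {0<..<x / r} v \<partial>lborel) = ennreal (1 - exp (- (1 / r) * x))"
    if "0 < x" for x
  proof -
    have "(\<integral>\<^sup>+v. ennreal (exp (- v)) * indicator {0..x / r} v \<partial>lborel) = ennreal (- exp (- (x / r)) - - exp (- 0))"
      using that r by (intro nn_integral_FTC_Icc) (auto intro!: derivative_eq_intros)
    also have "(\<integral>\<^sup>+v. ennreal (exp (- v)) * indicator {0..x / r} v \<partial>lborel) =
       (\<integral>\<^sup>+v. ennreal (exp (- v)) * indicator {0<..<x / r} v \<partial>lborel)"
    proof (intro nn_integral_cong_AE)
      show "AE v in lborel. ennreal (exp (- v)) * indicator {0..x / r} v = ennreal (exp (- v)) * indicator {0<..<x / r} v"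
        using AE_lborel_singleton[of 0] AE_lborel_singleton[of "x / r"]
        by eventually_elim (auto simp: indicator_def)
    qed
    finally show ?thesis by (simp add: mult.commute)
  qed
  have "ennreal (\<phi> (1 / r)) = (\<integral>\<^sup>+x. ennreal (1 - exp (- (1 / r) * x)) \<partial>\<nu>)"
    using r integrable_one_minus_exp[of "1/r"] AE_jump_pos
    by (subst exponent_eq, simp, intro nn_integral_eq_integral[symmetric]) auto
  also have "\<dots> = (\<integral>\<^sup>+x. (\<integral>\<^sup>+v. ennreal (exp (- v)) * indicator {0<..<x / r} v \<partial>lborel) \<partial>\<nu>)"
    by (intro nn_integral_cong_AE, rule AE_mp[OF AE_jump_pos]) (auto simp: inner)
  also have "\<dots> = (\<integral>\<^sup>+x. (\<integral>\<^sup>+v. ennreal (exp (- v)) * indicator {(v,x). 0 < v \<and> v < x / r} (v,x) \<partial>lborel) \<partial>\<nu>)"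
    by (intro nn_integral_cong) (auto simp: indicator_def)
  also have "\<dots> = (\<integral>\<^sup>+v. (\<integral>\<^sup>+x. ennreal (exp (- v)) * indicator {(v,x). 0 < v \<and> v < x / r} (v,x) \<partial>\<nu>) \<partial>lborel)"
    by (intro Fubini') measurable
  also have "\<dots> = (\<integral>\<^sup>+v. ennreal (exp (- v) * w (r * v)) * indicator {0<..} v \<partial>lborel)"
  proof (intro nn_integral_cong)
    fix v :: real
    have "(\<integral>\<^sup>+x. ennreal (exp (- v)) * indicator {(v,x). 0 < v \<and> v < x / r} (v,x) \<partial>\<nu>)
        = (\<integral>\<^sup>+x. (ennreal (exp (- v)) * indicator {0<..} v) * indicator {r * v<..} x \<partial>\<nu>)"
      using r by (intro nn_integral_cong) (auto simp: indicator_def field_simps)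
    also have "\<dots> = (ennreal (exp (- v)) * indicator {0<..} v) * emeasure \<nu> {r * v<..}"
      by (simp add: nn_integral_cmult)
    also have "\<dots> = ennreal (exp (- v) * w (r * v)) * indicator {0<..} v"
      using r by (cases "0 < v") (simp_all add: emeasure_tail ennreal_mult tail_nonneg)
    finally show "(\<integral>\<^sup>+x. ennreal (exp (- v)) * indicator {(v,x). 0 < v \<and> v < x / r} (v,x) \<partial>\<nu>) = \<dots>" .
  qed
  finally show ?thesis .
qed


text \<open>Strictness: equality would force the Levy measure to vanish.\<close>

lemma exponent_strict_mono:
  assumes "0 \<le> u" "u < v" "0 < r" "0 < w r" shows "\<phi> u < \<phi> v"
proof -
  have "\<phi> u \<noteq> \<phi> v"
  proof
    assume eq: "\<phi> u = \<phi> v"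
    let ?f = "\<lambda>x. exp (- u * x) - exp (- v * x)"
    have int: "integrable \<nu> (\<lambda>x. (1 - exp (- v * x)) - (1 - exp (- u * x)))"
      using assms by (intro Bochner_Integration.integrable_diff integrable_one_minus_exp) auto
    have "(\<integral>x. (1 - exp (- v * x)) - (1 - exp (- u * x)) \<partial>\<nu>) = \<phi> v - \<phi> u"
      using assms integrable_one_minus_exp
      by (subst Bochner_Integration.integral_diff) (auto simp: exponent_eq)
    then have zero: "(\<integral>x. ?f x \<partial>\<nu>) = 0" using eq by simp
    have int': "integrable \<nu> ?f" using int by simp
    have nonneg: "AE x in \<nu>. 0 \<le> ?f x"
      using AE_jump_pos by (rule eventually_mono) (use assms in auto)
    have "AE x in \<nu>. ?f x = 0"
      using integral_nonneg_eq_0_iff_AE[OF int' nonneg] zero by simp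
    with AE_jump_pos have "AE x in \<nu>. False"
    proof eventually_elim
      case (elim x)
      then show ?case using assms by simp
    qed
    then have "AE x in \<nu>. x \<notin> {r<..}" by (rule eventually_mono) simp
    then have "emeasure \<nu> {r<..} = 0" by (subst (asm) AE_iff_measurable[of "{r<..}"]) auto
    then show False using assms by (simp add: levy_tail_def measure_def)
  qed
  moreover have "\<phi> u \<le> \<phi> v" using assms by (intro exponent_mono) auto
  ultimately show ?thesis by simp
qed

end

section \<open>Polynomially scaling tails\<close>

text \<open>
  The upper exponent \<open>\<beta>2\<close> may exceed \<open>1\<close>. Then \<open>w(r)\<close> is at most a multiple of \<open>\<phi>(1/r)\<close>, but the two
  need not be comparable.
\<close>

locale poly_levy = levy_exponent +
  fixes Rm c1 c2 \<beta>1 \<beta>2 :: real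
  assumes Rm_pos: "0 < Rm" and c1_pos: "0 < c1" and c2_pos: "0 < c2"
    and \<beta>1_pos: "0 < \<beta>1" and \<beta>12: "\<beta>1 \<le> \<beta>2"
    and tail_scaling: "\<And>r R. 0 < r \<Longrightarrow> r \<le> R \<Longrightarrow> R \<le> Rm \<Longrightarrow>
      c1 * (R / r) powr \<beta>1 \<le> w r / w R \<and> w r / w R \<le> c2 * (R / r) powr \<beta>2"
begin

lemma tail_pos: assumes "0 < R" "R \<le> Rm" shows "0 < w R"
proof -
  have "0 < c1 * (R / R) powr \<beta>1" using c1_pos assms by simp
  also have "\<dots> \<le> w R / w R" using tail_scaling[of R R] assms by simp
  finally have "w R \<noteq> 0" by auto
  then show ?thesis using tail_nonneg[of R] by simp
qed

lemma tail_lower: "0 < r \<Longrightarrow> r \<le> R \<Longrightarrow> R \<le> Rm \<Longrightarrow> c1 * (R / r) powr \<beta>1 * w R \<le> w r"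
  and tail_upper: "0 < r \<Longrightarrow> r \<le> R \<Longrightarrow> R \<le> Rm \<Longrightarrow> w r \<le> c2 * (R / r) powr \<beta>2 * w R"
  using tail_scaling[of r R] tail_pos[of R] by (auto simp: field_simps)

lemma exponent_strict: "0 \<le> u \<Longrightarrow> u < v \<Longrightarrow> \<phi> u < \<phi> v"
  using exponent_strict_mono[of u v Rm] tail_pos[of Rm] Rm_pos by simp

lemma exponent_less_iff: "0 \<le> u \<Longrightarrow> 0 \<le> v \<Longrightarrow> \<phi> u < \<phi> v \<longleftrightarrow> u < v"
  using exponent_strict exponent_mono by (meson not_le)

lemma exponent_pos: "0 < u \<Longrightarrow> 0 < \<phi> u"
  using exponent_strict[of 0 u] by simp

lemma exponent_unbounded: "\<exists>u>0. K < \<phi> u"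
proof -
  have "filterlim (\<lambda>a. c1 * a powr \<beta>1 * w Rm / 2) at_top at_top"
    using c1_pos \<beta>1_pos tail_pos[of Rm] Rm_pos by real_asymp
  then have "eventually (\<lambda>a. K < c1 * a powr \<beta>1 * w Rm / 2) at_top"
    by (auto simp: filterlim_at_top_dense)
  with eventually_ge_at_top[of 1] obtain a where a: "1 \<le> a" "K < c1 * a powr \<beta>1 * w Rm / 2"
    by (metis (mono_tags, lifting) eventually_at_top_linorder eventually_conj order_refl)
  let ?r = "Rm / a"
  have "c1 * (Rm / ?r) powr \<beta>1 * w Rm \<le> w ?r"
    using a Rm_pos by (intro tail_lower) (auto simp: field_simps)
  also have "w ?r \<le> 2 * \<phi> (1 / ?r)" using a Rm_pos by (intro tail_le_exponent) auto
  finally show ?thesis using a Rm_pos by (intro exI[of _ "1 / ?r"]) auto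
qed

text \<open>The time scale: \<open>time_scale t\<close> is the typical size of the subordinator at time \<open>t\<close>.\<close>

definition time_scale :: "real \<Rightarrow> real" where "time_scale t = 1 / rinv \<phi> (1 / t)"

lemma exponent_rinv: assumes "0 < y" shows "0 < rinv \<phi> y" "\<phi> (rinv \<phi> y) = y"
proof -
  obtain b where b: "0 < b" "y < \<phi> b" using exponent_unbounded by blast
  have "\<exists>x\<ge>0. x \<le> b \<and> \<phi> x = y"
    using assms b by (intro IVT' continuous_on_subset[OF exponent_continuous]) auto
  then obtain x where x: "0 \<le> x" "\<phi> x = y" by auto
  have "strict_mono_on {0..} \<phi>" using exponent_strict by (auto simp: strict_mono_on_def)
  then have "rinv \<phi> y = x" using rinv_eq_inverse x by blast
  then show "\<phi> (rinv \<phi> y) = y" "0 < rinv \<phi> y" using x assms by (auto simp: order_le_less)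
qed

lemma time_scale_pos: "0 < t \<Longrightarrow> 0 < time_scale t"
  by (simp add: time_scale_def exponent_rinv)

lemma exponent_time_scale: "0 < t \<Longrightarrow> \<phi> (1 / time_scale t) = 1 / t"
  by (simp add: time_scale_def exponent_rinv)

lemma time_scale_mono: assumes "0 < t" "t \<le> T" shows "time_scale t \<le> time_scale T"
proof -
  have "\<phi> (1 / time_scale T) \<le> \<phi> (1 / time_scale t)"
    using assms by (simp add: exponent_time_scale frac_le)
  then have "1 / time_scale T \<le> 1 / time_scale t"
    using exponent_less_iff[of "1 / time_scale t" "1 / time_scale T"] assms time_scale_pos[of t] time_scale_pos[of T]
    by (smt (verit) divide_pos_pos)
  then show ?thesis using assms time_scale_pos[of t] time_scale_pos[of T] by (simp add: field_simps)
qed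

text \<open>
  In the integral representation of \<open>\<phi>\<close> the part over \<open>v \<le> 1\<close> dominates the rest, and there the
  lower scaling of the tail applies pointwise.
\<close>

lemma exponent_scaling_small:
  assumes "0 < r" "r \<le> R" "R \<le> Rm"
  shows "c1 / 2 * (R / r) powr \<beta>1 * \<phi> (1 / R) \<le> \<phi> (1 / r)"
proof -
  define I where "I a = (\<integral>\<^sup>+v. ennreal (exp (- v) * w (a * v)) * indicator {0<..1} v \<partial>lborel)" for a
  have pos: "0 < R" using assms by simp
  have "ennreal (\<phi> (1 / R)) = (\<integral>\<^sup>+v. ennreal (exp (- v) * w (R * v)) * indicator {0<..1} v
      + ennreal (exp (- v) * w (R * v)) * indicator {1<..} v \<partial>lborel)"
    unfolding exponent_eq_tail_integral[OF pos] by (intro nn_integral_cong) (auto simp: indicator_def)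
  also have "\<dots> = I R + (\<integral>\<^sup>+v. ennreal (exp (- v) * w (R * v)) * indicator {1<..} v \<partial>lborel)"
    unfolding I_def by (intro nn_integral_add) measurable
  also have "(\<integral>\<^sup>+v. ennreal (exp (- v) * w (R * v)) * indicator {1<..} v \<partial>lborel)
      \<le> (\<integral>\<^sup>+v. ennreal (w R * exp (- v)) * indicator {1..} v \<partial>lborel)"
    using pos by (intro nn_integral_mono) (auto simp: indicator_def mult.commute intro!: ennreal_leI mult_right_mono tail_antimono)
  also have "\<dots> = ennreal (0 - w R * (- exp (- 1)))"
    using tail_nonneg[of R]
    by (intro nn_integral_FTC_atLeast)
       (auto intro!: derivative_eq_intros, real_asymp)
  also have "\<dots> \<le> ennreal (w R * (- exp (- 1)) - w R * (- exp (- 0)))"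
  proof (rule ennreal_leI)
    have "exp (- 1) \<le> (1 / 2 :: real)"
      using exp_ge_add_one_self[of "1::real"] by (simp add: exp_minus field_simps)
    then have "w R * exp (- 1) \<le> w R * (1 / 2)" using tail_nonneg by (intro mult_left_mono) auto
    then show "0 - w R * (- exp (- 1)) \<le> w R * (- exp (- 1)) - w R * (- exp (- 0))" by simp
  qed
  also have "\<dots> = (\<integral>\<^sup>+v. ennreal (w R * exp (- v)) * indicator {0..1} v \<partial>lborel)"
    using tail_nonneg[of R]
    by (intro nn_integral_FTC_Icc[symmetric]) (auto intro!: derivative_eq_intros)
  also have "\<dots> \<le> I R"
    unfolding I_def
  proof (intro nn_integral_mono_AE)
    show "AE v in lborel. ennreal (w R * exp (- v)) * indicator {0..1} v
        \<le> ennreal (exp (- v) * w (R * v)) * indicator {0<..1} v"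
      using AE_lborel_singleton[of 0]
    proof eventually_elim
      case (elim v)
      have "w R \<le> w (R * v)" if "0 < v" "v \<le> 1"
        using pos that by (intro tail_antimono) auto
      then show ?case using elim by (auto simp: indicator_def mult.commute intro!: ennreal_leI mult_right_mono)
    qed
  qed
  finally have upper: "ennreal (\<phi> (1 / R)) \<le> 2 * I R" by (simp add: mult_2)
  let ?k = "c1 * (R / r) powr \<beta>1"
  have k: "0 \<le> ?k" using c1_pos by simp
  have "ennreal ?k * I R = (\<integral>\<^sup>+v. ennreal ?k * (ennreal (exp (- v) * w (R * v)) * indicator {0<..1} v) \<partial>lborel)"
    unfolding I_def by (intro nn_integral_cmult[symmetric]) measurable
  also have "\<dots> \<le> (\<integral>\<^sup>+v. ennreal (exp (- v) * w (r * v)) * indicator {0<..} v \<partial>lborel)"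
  proof (intro nn_integral_mono)
    fix v :: real
    show "ennreal ?k * (ennreal (exp (- v) * w (R * v)) * indicator {0<..1} v)
        \<le> ennreal (exp (- v) * w (r * v)) * indicator {0<..} v"
    proof (cases "0 < v \<and> v \<le> 1")
      case True
      then have "R * v \<le> R" using pos by simp
      then have "R * v \<le> Rm" using assms(3) by linarith
      then have "c1 * (R * v / (r * v)) powr \<beta>1 * w (R * v) \<le> w (r * v)"
        using True assms by (intro tail_lower) auto
      then have "?k * w (R * v) \<le> w (r * v)" using True by simp
      then have "exp (- v) * (?k * w (R * v)) \<le> exp (- v) * w (r * v)" by simp
      then show ?thesis using True k tail_nonneg
        by (auto simp: indicator_def ennreal_mult[symmetric] mult_ac intro!: ennreal_leI)
    qed (auto simp: indicator_def)
  qed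
  also have "\<dots> = ennreal (\<phi> (1 / r))" using assms by (simp add: exponent_eq_tail_integral)
  finally have lower: "ennreal ?k * I R \<le> ennreal (\<phi> (1 / r))" .
  have "ennreal (?k * \<phi> (1 / R)) \<le> ennreal ?k * (2 * I R)"
    using upper k exponent_nonneg[of "1 / R"] pos by (simp add: ennreal_mult mult_left_mono)
  also have "\<dots> \<le> 2 * ennreal (\<phi> (1 / r))"
    using mult_left_mono[OF lower, of 2] by (simp add: mult_ac)
  also have "\<dots> = ennreal (2 * \<phi> (1 / r))"
    using exponent_nonneg[of "1 / r"] assms by (simp add: ennreal_mult)
  finally have "?k * \<phi> (1 / R) \<le> 2 * \<phi> (1 / r)"
    using exponent_nonneg[of "1 / r"] assms by (simp add: ennreal_le_iff)
  then show ?thesis by simp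
qed

text \<open>Monotonicity of \<open>\<phi>\<close> carries the scaling over to any bounded range.\<close>

lemma exponent_scaling:
  obtains c where "0 < c"
    "\<And>r R. 0 < r \<Longrightarrow> r \<le> R \<Longrightarrow> R \<le> M \<Longrightarrow> c * (R / r) powr \<beta>1 * \<phi> (1 / R) \<le> \<phi> (1 / r)"
proof -
  define M' where "M' = max M Rm"
  have M': "0 < M'" "Rm \<le> M'" "M \<le> M'" using Rm_pos by (auto simp: M'_def)
  define k where "k = (Rm / M') powr \<beta>1"
  define c where "c = min (c1 / 2) 1 * k"
  have k: "0 < k" "k \<le> 1" using M' Rm_pos \<beta>1_pos by (auto simp: k_def intro!: powr_le1)
  show thesis
  proof
    show "0 < c" using k c1_pos by (simp add: c_def)
    fix r R assume rR: "0 < r" "r \<le> R" "R \<le> M"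
    have nn: "0 \<le> \<phi> (1 / R)" using rR by (intro exponent_nonneg) auto
    have c_le: "c \<le> c1 / 2" "c \<le> k"
      using k c1_pos mult_mono[of "min (c1 / 2) 1" "c1 / 2" k 1] mult_mono[of "min (c1 / 2) 1" 1 k k] by (auto simp: c_def)
    consider "R \<le> Rm" | "r \<le> Rm" "Rm < R" | "Rm < r" by linarith
    then show "c * (R / r) powr \<beta>1 * \<phi> (1 / R) \<le> \<phi> (1 / r)"
    proof cases
      case 1
      have "c * (R / r) powr \<beta>1 * \<phi> (1 / R) \<le> c1 / 2 * (R / r) powr \<beta>1 * \<phi> (1 / R)"
        using c_le nn by (intro mult_right_mono) auto
      then show ?thesis using exponent_scaling_small[OF rR(1,2) 1] by linarith
    next
      case 2
      have "k * (R / r) powr \<beta>1 = (Rm / M' * (R / r)) powr \<beta>1"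
        using M' Rm_pos rR by (simp add: k_def powr_mult[symmetric] del: times_divide_eq_right times_divide_eq_left)
      also have "\<dots> \<le> (Rm / r) powr \<beta>1"
        using M' Rm_pos rR \<beta>1_pos 2 by (intro powr_mono2) (auto simp: field_simps intro!: mult_left_mono)
      finally have "c1 / 2 * (k * (R / r) powr \<beta>1) * \<phi> (1 / R) \<le> c1 / 2 * (Rm / r) powr \<beta>1 * \<phi> (1 / Rm)"
        using c1_pos nn 2 rR Rm_pos k
        by (intro mult_mono exponent_mono) (auto simp: field_simps)
      also have "\<dots> \<le> \<phi> (1 / r)" using exponent_scaling_small[of r Rm] 2 rR by simp
      finally have "c1 / 2 * (k * (R / r) powr \<beta>1) * \<phi> (1 / R) \<le> \<phi> (1 / r)" .
      moreover have "c * (R / r) powr \<beta>1 * \<phi> (1 / R) \<le> c1 / 2 * (k * (R / r) powr \<beta>1) * \<phi> (1 / R)"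
      proof -
        have "c * ((R / r) powr \<beta>1 * \<phi> (1 / R)) \<le> (c1 / 2 * k) * ((R / r) powr \<beta>1 * \<phi> (1 / R))"
          using k c1_pos nn unfolding c_def by (intro mult_right_mono mult_nonneg_nonneg) auto
        then show ?thesis by (simp add: mult_ac)
      qed
      ultimately show ?thesis by linarith
    next
      case 3
      have "k * (R / r) powr \<beta>1 = (Rm / M' * (R / r)) powr \<beta>1"
        using M' Rm_pos rR by (simp add: k_def powr_mult[symmetric] del: times_divide_eq_right times_divide_eq_left)
      also have "\<dots> \<le> 1"
      proof -
        have "Rm * R \<le> r * M'" using 3 rR M' Rm_pos by (intro mult_mono) auto
        then show ?thesis using M' Rm_pos rR \<beta>1_pos 3
          by (intro powr_le1) (auto simp: field_simps)
      qed
      finally have "k * (R / r) powr \<beta>1 \<le> 1" .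
      moreover have "c * (R / r) powr \<beta>1 \<le> k * (R / r) powr \<beta>1" using c_le by (intro mult_right_mono) auto
      ultimately have "c * (R / r) powr \<beta>1 * \<phi> (1 / R) \<le> 1 * \<phi> (1 / R)"
        using nn by (intro mult_right_mono) auto
      also have "\<dots> \<le> \<phi> (1 / r)" using rR by (auto intro!: exponent_mono simp: field_simps)
      finally show ?thesis .
    qed
  qed
qed

end

section \<open>Increments of the subordinator\<close>

locale driftless = levy_exponent +
  fixes N :: "'w measure" and S :: "real \<Rightarrow> 'w \<Rightarrow> real"
  assumes driftless: "driftless_subordinator N S \<phi> \<nu>"
begin

sublocale prob_space N
  using driftless by (simp add: driftless_subordinator_def subordinator_def)

lemma value_measurable: "0 \<le> t \<Longrightarrow> S t \<in> borel_measurable N"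
  using driftless by (simp add: driftless_subordinator_def subordinator_def)

lemma AE_start: "AE \<omega> in N. S 0 \<omega> = 0"
  using driftless by (simp add: driftless_subordinator_def subordinator_def)

lemma AE_mono: "AE \<omega> in N. mono_on {0..} (\<lambda>t. S t \<omega>)"
proof -
  have "AE \<omega> in N. mono_on {0..} (\<lambda>t. S t \<omega>) \<and> (\<forall>t\<ge>0. continuous (at_right t) (\<lambda>s. S s \<omega>))"
    using driftless by (simp add: driftless_subordinator_def subordinator_def)
  then show ?thesis by (rule eventually_mono) simp
qed

lemma AE_nonneg: assumes "0 \<le> t" shows "AE \<omega> in N. 0 \<le> S t \<omega>"
  using AE_start AE_mono
proof eventually_elim
  case (elim \<omega>)
  then show ?case using mono_onD[OF elim(2), of 0 t] assms by simp
qed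

definition inc :: "real \<Rightarrow> nat \<Rightarrow> 'w \<Rightarrow> real" where
  "inc \<tau> i \<omega> = S (real (Suc i) * \<tau>) \<omega> - S (real i * \<tau>) \<omega>"

lemma inc_measurable: "0 \<le> \<tau> \<Longrightarrow> inc \<tau> i \<in> borel_measurable N"
  unfolding inc_def by (intro borel_measurable_diff value_measurable) auto

lemma indep_inc: assumes "0 \<le> \<tau>" shows "indep_vars (\<lambda>_. borel) (inc \<tau>) {..<n}"
proof -
  have "mono (\<lambda>i. real i * \<tau>)" using assms by (auto simp: mono_def mult_right_mono)
  moreover have "\<forall>n (\<tau> :: nat \<Rightarrow> real). 0 \<le> \<tau> 0 \<longrightarrow> mono \<tau> \<longrightarrow>
      indep_vars (\<lambda>_. borel) (\<lambda>i \<omega>. S (\<tau> (Suc i)) \<omega> - S (\<tau> i) \<omega>) {..<n}"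
    using driftless unfolding driftless_subordinator_def subordinator_def by (elim conjE)
  ultimately show ?thesis unfolding inc_def[abs_def]
    by (elim allE[where x = n] allE[where x = "\<lambda>i. real i * \<tau>"]) simp
qed

lemma distr_inc: assumes "0 \<le> \<tau>" shows "distr N borel (inc \<tau> i) = distr N borel (S \<tau>)"
proof -
  have "distr N borel (\<lambda>\<omega>. S (real i * \<tau> + \<tau>) \<omega> - S (real i * \<tau>) \<omega>) = distr N borel (S \<tau>)"
    using driftless assms unfolding driftless_subordinator_def subordinator_def by simp
  then show ?thesis unfolding inc_def[abs_def] by (simp add: algebra_simps)
qed

lemma integral_inc:
  fixes f :: "real \<Rightarrow> real"
  assumes "0 \<le> \<tau>" and [measurable]: "f \<in> borel_measurable borel"
  shows "(\<integral>\<omega>. f (inc \<tau> i \<omega>) \<partial>N) = (\<integral>\<omega>. f (S \<tau> \<omega>) \<partial>N)"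
proof -
  have "(\<integral>\<omega>. f (inc \<tau> i \<omega>) \<partial>N) = (\<integral>x. f x \<partial>distr N borel (inc \<tau> i))"
    using inc_measurable[OF assms(1)] by (intro integral_distr[symmetric]) auto
  also have "\<dots> = (\<integral>\<omega>. f (S \<tau> \<omega>) \<partial>N)"
    unfolding distr_inc[OF assms(1)] using value_measurable[OF assms(1)] by (intro integral_distr) auto
  finally show ?thesis .
qed

lemma prob_inc:
  assumes "0 \<le> \<tau>" and [measurable]: "B \<in> sets borel"
  shows "prob {\<omega>\<in>space N. inc \<tau> i \<omega> \<in> B} = prob {\<omega>\<in>space N. S \<tau> \<omega> \<in> B}"
proof -
  have "prob {\<omega>\<in>space N. inc \<tau> i \<omega> \<in> B} = measure (distr N borel (inc \<tau> i)) B"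
    using inc_measurable[OF assms(1)] by (subst measure_distr) (auto simp: vimage_def Int_def conj_commute)
  also have "\<dots> = prob {\<omega>\<in>space N. S \<tau> \<omega> \<in> B}"
    unfolding distr_inc[OF assms(1)] using value_measurable[OF assms(1)]
    by (subst measure_distr) (auto simp: vimage_def Int_def conj_commute)
  finally show ?thesis .
qed

lemma AE_sum_inc:
  assumes "0 \<le> \<tau>"
  shows "AE \<omega> in N. (\<Sum>i<n. inc \<tau> i \<omega>) = S (real n * \<tau>) \<omega> \<and> (\<forall>i. 0 \<le> inc \<tau> i \<omega>)"
  using AE_start AE_mono
proof eventually_elim
  case (elim \<omega>)
  have "(\<Sum>i<n. inc \<tau> i \<omega>) = S (real n * \<tau>) \<omega> - S (real 0 * \<tau>) \<omega>"
    unfolding inc_def using sum_lessThan_telescope[of "\<lambda>i. S (real i * \<tau>) \<omega>" n] by simp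
  moreover have "0 \<le> inc \<tau> i \<omega>" for i
    using mono_onD[OF elim(2), of "real i * \<tau>" "real (Suc i) * \<tau>"] assms
    by (auto simp: inc_def mult_right_mono)
  ultimately show ?case using elim by simp
qed

section \<open>Law of the subordinator\<close>

lemma integrable_exp_value: assumes "0 \<le> u" "0 \<le> t" shows "integrable N (\<lambda>\<omega>. exp (- u * S t \<omega>))"
proof (rule integrable_const_bound[of _ 1])
  show "AE \<omega> in N. norm (exp (- u * S t \<omega>)) \<le> 1"
    using AE_nonneg[OF assms(2)] by (rule eventually_mono) (use assms in auto)
  show "(\<lambda>\<omega>. exp (- u * S t \<omega>)) \<in> borel_measurable N"
    using value_measurable[OF assms(2)] by measurable
qed

lemma integrable_exp_inc: assumes "0 \<le> u" "0 \<le> t" shows "integrable N (\<lambda>\<omega>. exp (- u * inc t i \<omega>))"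
proof (rule integrable_const_bound[of _ 1])
  show "AE \<omega> in N. norm (exp (- u * inc t i \<omega>)) \<le> 1"
    using AE_sum_inc[OF assms(2), of 0] by (rule eventually_mono) (use assms in auto)
  show "(\<lambda>\<omega>. exp (- u * inc t i \<omega>)) \<in> borel_measurable N"
    using inc_measurable[OF assms(2)] by measurable
qed

text \<open>
  The logarithm of the Laplace transform is monotone in time and multiplied by \<open>n\<close> when time is
  multiplied by \<open>n\<close>. This makes it linear.
\<close>

lemma laplace:
  assumes u: "0 \<le> u" and t: "0 \<le> t"
  shows "(\<integral>\<omega>. exp (- u * S t \<omega>) \<partial>N) = exp (- t * \<phi> u)"
proof -
  define L where "L t = (\<integral>\<omega>. exp (- u * S t \<omega>) \<partial>N)" for t
  define a where "a t = - ln (L t)" for t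
  have L_pos: "0 < L t" if "0 \<le> t" for t
  proof -
    have "0 \<le> L t" unfolding L_def by (intro integral_nonneg_AE) auto
    moreover have "L t \<noteq> 0"
    proof
      assume "L t = 0"
      then have "AE \<omega> in N. exp (- u * S t \<omega>) = 0"
        unfolding L_def
        by (subst (asm) integral_nonneg_eq_0_iff_AE[OF integrable_exp_value[OF u that]]) auto
      then have "AE \<omega> in N. False" by (rule eventually_mono) simp
      then show False by simp
    qed
    ultimately show ?thesis by simp
  qed
  have mono: "a s \<le> a t" if "0 \<le> s" "s \<le> t" for s t
  proof -
    have "L t \<le> L s"
      unfolding L_def
    proof (rule integral_mono_AE)
      show "AE \<omega> in N. exp (- u * S t \<omega>) \<le> exp (- u * S s \<omega>)"
        using AE_mono
      proof eventually_elim
        case (elim \<omega>)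
        then have "S s \<omega> \<le> S t \<omega>" using that by (auto intro: mono_onD[where f="\<lambda>t. S t \<omega>"])
        then show ?case using u by (simp add: mult_left_mono)
      qed
    qed (use that u integrable_exp_value in auto)
    then show ?thesis using L_pos[of t] L_pos[of s] that by (simp add: a_def)
  qed
  have mult: "a (real n * \<tau>) = real n * a \<tau>" if "0 \<le> \<tau>" for n \<tau>
  proof -
    have "L (real n * \<tau>) = (\<integral>\<omega>. (\<Prod>i<n. exp (- u * inc \<tau> i \<omega>)) \<partial>N)"
      unfolding L_def
    proof (rule integral_cong_AE)
      show "AE \<omega> in N. exp (- u * S (real n * \<tau>) \<omega>) = (\<Prod>i<n. exp (- u * inc \<tau> i \<omega>))"
        using AE_sum_inc[OF that, of n]
        by (rule eventually_mono) (auto simp: exp_sum[symmetric] sum_distrib_left[symmetric] sum_negf)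
      have [measurable]: "S (real n * \<tau>) \<in> borel_measurable N" using that by (intro value_measurable) simp
      show "(\<lambda>\<omega>. exp (- u * S (real n * \<tau>) \<omega>)) \<in> borel_measurable N" by measurable
      show "(\<lambda>\<omega>. \<Prod>i<n. exp (- u * inc \<tau> i \<omega>)) \<in> borel_measurable N"
        using inc_measurable[OF that] by measurable
    qed
    also have "\<dots> = (\<Prod>i<n. \<integral>\<omega>. exp (- u * inc \<tau> i \<omega>) \<partial>N)"
    proof (rule indep_vars_lebesgue_integral)
      show "indep_vars (\<lambda>_. borel) (\<lambda>i \<omega>. exp (- u * inc \<tau> i \<omega>)) {..<n}"
        by (rule indep_vars_compose2[OF indep_inc[OF that]]) measurable
    qed (use integrable_exp_inc[OF u that] in auto)
    also have "\<dots> = L \<tau> ^ n"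
      using integral_inc[OF that, of "\<lambda>x. exp (- u * x)"] by (simp add: L_def)
    finally show ?thesis using L_pos[OF that] by (simp add: a_def ln_realpow)
  qed
  have "L 1 = exp (- \<phi> u)"
  proof -
    have "\<phi> u = - ln (L 1)"
      using driftless u unfolding driftless_subordinator_def L_def by simp
    then show ?thesis using L_pos[of 1] by simp
  qed
  then have a1: "a 1 = \<phi> u" by (simp add: a_def)
  have \<phi>u: "0 \<le> \<phi> u" using u by (rule exponent_nonneg)
  have "\<bar>a t - t * \<phi> u\<bar> * real n \<le> \<phi> u" for n
  proof -
    define k where "k = nat \<lfloor>real n * t\<rfloor>"
    have "real k = real_of_int \<lfloor>real n * t\<rfloor>" using t by (simp add: k_def)
    then have k: "real k \<le> real n * t" "real n * t \<le> real (Suc k)" by linarith+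
    have "real k * \<phi> u \<le> a (real n * t)"
      using mono[of "real k * 1" "real n * t"] mult[of 1 k] k a1 by simp
    moreover have "a (real n * t) \<le> real (Suc k) * \<phi> u"
      using mono[of "real n * t" "real (Suc k) * 1"] mult[of 1 "Suc k"] k a1 t by simp
    moreover have "a (real n * t) = real n * a t" using mult[OF t] .
    moreover have "real k * \<phi> u \<le> real n * t * \<phi> u" "real n * t * \<phi> u \<le> real (Suc k) * \<phi> u"
      using k \<phi>u by (auto intro!: mult_right_mono)
    ultimately have "\<bar>real n * a t - real n * t * \<phi> u\<bar> \<le> real (Suc k) * \<phi> u - real k * \<phi> u" by linarith
    also have "\<dots> = \<phi> u" by (simp add: algebra_simps)
    also have "real n * a t - real n * t * \<phi> u = (a t - t * \<phi> u) * real n" by (simp add: algebra_simps)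
    finally show ?thesis by (simp add: abs_mult)
  qed
  then have "a t - t * \<phi> u = 0"
    using reals_Archimedean3[of "\<bar>a t - t * \<phi> u\<bar>"] by (metis abs_le_zero_iff mult.commute not_le)
  then have "ln (L t) = - t * \<phi> u" by (simp add: a_def)
  then have "L t = exp (- t * \<phi> u)" using L_pos[OF t] by (metis exp_ln)
  then show ?thesis by (simp add: L_def)
qed

text \<open>
  Chernoff's bound with truncated increments: either some increment exceeds \<open>a\<close>, or the sum of the
  truncated increments exceeds \<open>v\<close>. Increments over short times play the part of jumps, so that
  no decomposition of the process into small and large jumps has to be constructed.
\<close>

lemma chernoff_truncated:
  assumes \<tau>: "0 \<le> \<tau>" and \<theta>: "0 \<le> \<theta>" and a: "0 \<le> a"
  shows "prob {\<omega>\<in>space N. v < S (real n * \<tau>) \<omega>} \<le> real n * prob {\<omega>\<in>space N. a < S \<tau> \<omega>}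
    + exp (- \<theta> * v) * (\<integral>\<omega>. (if S \<tau> \<omega> \<in> {0..a} then exp (\<theta> * S \<tau> \<omega>) else 1) \<partial>N) ^ n"
proof -
  define f where "f x = (if x \<in> {0..a} then exp (\<theta> * x) else 1)" for x
  have f_meas [measurable]: "f \<in> borel_measurable borel" unfolding f_def by measurable
  have f_bounds: "1 \<le> f x" "f x \<le> exp (\<theta> * a)" for x
    using \<theta> a by (auto simp: f_def mult_left_mono)
  note [measurable] = inc_measurable[OF \<tau>] value_measurable[OF \<tau>]
  have [measurable]: "S (real n * \<tau>) \<in> borel_measurable N" using \<tau> by (intro value_measurable) simp
  have int_f: "integrable N (\<lambda>\<omega>. f (inc \<tau> i \<omega>))" for i
    using f_bounds by (intro integrable_const_bound[of _ "exp (\<theta> * a)"]) (auto intro!: AE_I2 simp: abs_le_iff order_trans[OF _ f_bounds(1)] intro: order_trans[OF zero_le_one])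
  have indep: "indep_vars (\<lambda>_. borel) (\<lambda>i \<omega>. f (inc \<tau> i \<omega>)) {..<n}"
    by (rule indep_vars_compose2[OF indep_inc[OF \<tau>]]) measurable
  let ?B = "\<lambda>i. {\<omega>\<in>space N. inc \<tau> i \<omega> \<in> {a<..}}"
  let ?C = "{\<omega>\<in>space N. exp (\<theta> * v) \<le> (\<Prod>i<n. f (inc \<tau> i \<omega>))}"
  have "prob {\<omega>\<in>space N. v < S (real n * \<tau>) \<omega>} \<le> prob ((\<Union>i<n. ?B i) \<union> ?C)"
  proof (rule finite_measure_mono_AE)
    show "AE \<omega> in N. \<omega> \<in> {\<omega>\<in>space N. v < S (real n * \<tau>) \<omega>} \<longrightarrow> \<omega> \<in> (\<Union>i<n. ?B i) \<union> ?C"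
      using AE_sum_inc[OF \<tau>, of n]
    proof eventually_elim
      case (elim \<omega>)
      show ?case
      proof (intro impI, rule ccontr)
        assume v: "\<omega> \<in> {\<omega>\<in>space N. v < S (real n * \<tau>) \<omega>}" and c: "\<omega> \<notin> (\<Union>i<n. ?B i) \<union> ?C"
        then have "inc \<tau> i \<omega> \<le> a" if "i < n" for i using that by force
        then have "(\<Prod>i<n. f (inc \<tau> i \<omega>)) = (\<Prod>i<n. exp (\<theta> * inc \<tau> i \<omega>))"
          using elim by (intro prod.cong) (auto simp: f_def)
        also have "\<dots> = exp (\<theta> * S (real n * \<tau>) \<omega>)"
          using elim by (simp add: exp_sum[symmetric] sum_distrib_left[symmetric])
        finally have "exp (\<theta> * v) \<le> (\<Prod>i<n. f (inc \<tau> i \<omega>))"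
          using v \<theta> by (simp add: mult_left_mono)
        then show False using c v by simp
      qed
    qed
  qed measurable
  also have "\<dots> \<le> prob (\<Union>i<n. ?B i) + prob ?C" by (intro measure_Un_le) measurable
  also have "prob (\<Union>i<n. ?B i) \<le> (\<Sum>i<n. prob (?B i))" by (intro measure_UNION_le) auto
  also have "\<dots> = real n * prob {\<omega>\<in>space N. a < S \<tau> \<omega>}"
    by (subst prob_inc[OF \<tau>]) auto
  also have "prob ?C \<le> (\<integral>\<omega>. (\<Prod>i<n. f (inc \<tau> i \<omega>)) \<partial>N) / exp (\<theta> * v)"
    by (intro integral_Markov_inequality_measure[where A = "{}"] indep_vars_integrable[OF _ indep] int_f)
       (auto intro!: prod_nonneg AE_I2 order_trans[OF zero_le_one f_bounds(1)])
  also have "(\<integral>\<omega>. (\<Prod>i<n. f (inc \<tau> i \<omega>)) \<partial>N) = (\<Prod>i<n. \<integral>\<omega>. f (inc \<tau> i \<omega>) \<partial>N)"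
    by (intro indep_vars_lebesgue_integral indep int_f) auto
  also have "\<dots> = (\<integral>\<omega>. f (S \<tau> \<omega>) \<partial>N) ^ n"
    using integral_inc[OF \<tau> f_meas] by simp
  finally show ?thesis by (simp add: f_def exp_minus field_simps)
qed

text \<open>
  The events that the increment \<open>i\<close> alone exceeds \<open>b\<close> while the other increments sum up to at
  most \<open>b\<close> are disjoint for different \<open>i\<close>.
\<close>

lemma window_lower:
  assumes \<tau>: "0 \<le> \<tau>" and b: "0 \<le> b"
  shows "real n * prob {\<omega>\<in>space N. S \<tau> \<omega> \<in> {b<..c}} * prob {\<omega>\<in>space N. S (real n * \<tau>) \<omega> \<le> b}
    \<le> prob {\<omega>\<in>space N. S (real n * \<tau>) \<omega> \<in> {b<..b + c}}"
proof -
  note [measurable] = inc_measurable[OF \<tau>] value_measurable[OF \<tau>]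
  have [measurable]: "S (real n * \<tau>) \<in> borel_measurable N" using \<tau> by (intro value_measurable) simp
  define A where "A i = {\<omega>\<in>space N. inc \<tau> i \<omega> \<in> {b<..c} \<and> (\<Sum>j\<in>{..<n} - {i}. inc \<tau> j \<omega>) \<le> b}" for i
  define G where "G = {\<omega>\<in>space N. \<forall>i<n. 0 \<le> inc \<tau> i \<omega>}"
  have [measurable]: "A i \<in> sets N" for i unfolding A_def by measurable
  have [measurable]: "G \<in> sets N" unfolding G_def by measurable
  have AE_G: "AE \<omega> in N. \<omega> \<in> G"
    using AE_space AE_sum_inc[OF \<tau>, of n] by eventually_elim (simp add: G_def)
  have A_prob: "prob {\<omega>\<in>space N. S \<tau> \<omega> \<in> {b<..c}} * prob {\<omega>\<in>space N. S (real n * \<tau>) \<omega> \<le> b} \<le> prob (A i \<inter> G)"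
    if i: "i < n" for i
  proof -
    have "indep_var borel (inc \<tau> i) borel (\<lambda>\<omega>. \<Sum>j\<in>{..<n} - {i}. inc \<tau> j \<omega>)"
    proof (rule indep_vars_sum)
      have "insert i ({..<n} - {i}) = {..<n}" using i by auto
      then show "indep_vars (\<lambda>_. borel) (inc \<tau>) (insert i ({..<n} - {i}))"
        using indep_inc[OF \<tau>, of n] by simp
    qed auto
    then have "prob ((\<lambda>\<omega>. (inc \<tau> i \<omega>, \<Sum>j\<in>{..<n} - {i}. inc \<tau> j \<omega>)) -` ({b<..c} \<times> {..b}) \<inter> space N)
        = prob (inc \<tau> i -` {b<..c} \<inter> space N)
        * prob ((\<lambda>\<omega>. \<Sum>j\<in>{..<n} - {i}. inc \<tau> j \<omega>) -` {..b} \<inter> space N)"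
      by (rule indep_varD) auto
    also have "(\<lambda>\<omega>. (inc \<tau> i \<omega>, \<Sum>j\<in>{..<n} - {i}. inc \<tau> j \<omega>)) -` ({b<..c} \<times> {..b}) \<inter> space N = A i"
      by (auto simp: A_def)
    also have "inc \<tau> i -` {b<..c} \<inter> space N = {\<omega>\<in>space N. inc \<tau> i \<omega> \<in> {b<..c}}" by auto
    also have "(\<lambda>\<omega>. \<Sum>j\<in>{..<n} - {i}. inc \<tau> j \<omega>) -` {..b} \<inter> space N
        = {\<omega>\<in>space N. (\<Sum>j\<in>{..<n} - {i}. inc \<tau> j \<omega>) \<le> b}" by auto
    finally have "prob (A i) = prob {\<omega>\<in>space N. inc \<tau> i \<omega> \<in> {b<..c}}
        * prob {\<omega>\<in>space N. (\<Sum>j\<in>{..<n} - {i}. inc \<tau> j \<omega>) \<le> b}" .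
    moreover have "prob {\<omega>\<in>space N. inc \<tau> i \<omega> \<in> {b<..c}} = prob {\<omega>\<in>space N. S \<tau> \<omega> \<in> {b<..c}}"
      by (intro prob_inc[OF \<tau>]) auto
    moreover have "prob {\<omega>\<in>space N. S (real n * \<tau>) \<omega> \<le> b}
        \<le> prob {\<omega>\<in>space N. (\<Sum>j\<in>{..<n} - {i}. inc \<tau> j \<omega>) \<le> b}"
    proof (rule finite_measure_mono_AE)
      show "AE \<omega> in N. \<omega> \<in> {\<omega>\<in>space N. S (real n * \<tau>) \<omega> \<le> b} \<longrightarrow>
          \<omega> \<in> {\<omega>\<in>space N. (\<Sum>j\<in>{..<n} - {i}. inc \<tau> j \<omega>) \<le> b}"
        using AE_sum_inc[OF \<tau>, of n]
      proof eventually_elim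
        case (elim \<omega>)
        have "(\<Sum>j\<in>{..<n} - {i}. inc \<tau> j \<omega>) \<le> (\<Sum>j<n. inc \<tau> j \<omega>)"
          using elim by (intro sum_mono2) auto
        then show ?case using elim by auto
      qed
    qed measurable
    moreover have "prob (A i) = prob (A i \<inter> G)"
      using AE_G by (intro finite_measure_eq_AE) auto
    ultimately show ?thesis by (simp add: mult_left_mono)
  qed
  have disj: "disjoint_family_on (\<lambda>i. A i \<inter> G) {..<n}"
    unfolding disjoint_family_on_def
  proof (intro ballI impI, rule ccontr)
    fix i j assume ij: "i \<in> {..<n}" "j \<in> {..<n}" "i \<noteq> j" "A i \<inter> G \<inter> (A j \<inter> G) \<noteq> {}"
    then obtain \<omega> where \<omega>: "\<omega> \<in> A i" "\<omega> \<in> A j" "\<omega> \<in> G" by auto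
    have "inc \<tau> j \<omega> \<le> (\<Sum>j\<in>{..<n} - {i}. inc \<tau> j \<omega>)"
      using \<omega> ij by (intro member_le_sum) (auto simp: G_def)
    then show False using \<omega> by (auto simp: A_def)
  qed
  have "real n * prob {\<omega>\<in>space N. S \<tau> \<omega> \<in> {b<..c}} * prob {\<omega>\<in>space N. S (real n * \<tau>) \<omega> \<le> b}
      = (\<Sum>i<n. prob {\<omega>\<in>space N. S \<tau> \<omega> \<in> {b<..c}} * prob {\<omega>\<in>space N. S (real n * \<tau>) \<omega> \<le> b})"
    by simp
  also have "\<dots> \<le> (\<Sum>i<n. prob (A i \<inter> G))" using A_prob by (intro sum_mono) auto
  also have "\<dots> = prob (\<Union>i<n. A i \<inter> G)"
    using disj by (intro finite_measure_finite_Union[symmetric]) auto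
  also have "\<dots> \<le> prob {\<omega>\<in>space N. S (real n * \<tau>) \<omega> \<in> {b<..b + c}}"
  proof (rule finite_measure_mono_AE)
    show "AE \<omega> in N. \<omega> \<in> (\<Union>i<n. A i \<inter> G) \<longrightarrow> \<omega> \<in> {\<omega>\<in>space N. S (real n * \<tau>) \<omega> \<in> {b<..b + c}}"
      using AE_sum_inc[OF \<tau>, of n]
    proof eventually_elim
      case (elim \<omega>)
      show ?case
      proof
        assume "\<omega> \<in> (\<Union>i<n. A i \<inter> G)"
        then obtain i where i: "i < n" "\<omega> \<in> A i" by auto
        have "(\<Sum>j<n. inc \<tau> j \<omega>) = inc \<tau> i \<omega> + (\<Sum>j\<in>{..<n} - {i}. inc \<tau> j \<omega>)"
          using i by (intro sum.remove) auto
        moreover have "0 \<le> (\<Sum>j\<in>{..<n} - {i}. inc \<tau> j \<omega>)" using elim by (intro sum_nonneg) auto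
        ultimately show "\<omega> \<in> {\<omega>\<in>space N. S (real n * \<tau>) \<omega> \<in> {b<..b + c}}"
          using i elim by (auto simp: A_def)
      qed
    qed
  qed measurable
  finally show ?thesis .
qed

end

section \<open>Small increments approximate the Levy measure\<close>

text \<open>
  The weight \<open>1 - exp (- x)\<close> is integrable even for a Levy measure of infinite mass, so that uniform
  approximation on \<open>[0, 1]\<close> controls the integrals.
\<close>

lemma poly_approx_integral:
  fixes M :: "real measure"
  assumes [measurable_cong]: "sets M = sets borel"
    and nonneg: "AE x in M. 0 \<le> x"
    and int: "integrable M (\<lambda>x. 1 - exp (- x))"
    and [measurable]: "f \<in> borel_measurable borel" "p \<in> borel_measurable borel"
    and bnd: "\<And>y. 0 \<le> y \<Longrightarrow> y \<le> 1 \<Longrightarrow> \<bar>f y\<bar> \<le> B"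
    and close: "\<And>y. 0 \<le> y \<Longrightarrow> y \<le> 1 \<Longrightarrow> \<bar>f y - p y\<bar> \<le> \<epsilon>"
  shows "integrable M (\<lambda>x. (1 - exp (- x)) * f (exp (- x)))"
    and "\<bar>(\<integral>x. (1 - exp (- x)) * f (exp (- x)) \<partial>M) - (\<integral>x. (1 - exp (- x)) * p (exp (- x)) \<partial>M)\<bar>
      \<le> \<epsilon> * (\<integral>x. 1 - exp (- x) \<partial>M)"
proof -
  have int_bnd: "integrable M (\<lambda>x. (1 - exp (- x)) * g (exp (- x)))"
    if [measurable]: "g \<in> borel_measurable borel" and g: "\<And>y. 0 \<le> y \<Longrightarrow> y \<le> 1 \<Longrightarrow> \<bar>g y\<bar> \<le> K" for g :: "real \<Rightarrow> real" and K
  proof (rule Bochner_Integration.integrable_bound)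
    show "integrable M (\<lambda>x. K * (1 - exp (- x)))" using int by (rule integrable_mult_right)
    show "AE x in M. norm ((1 - exp (- x)) * g (exp (- x))) \<le> norm (K * (1 - exp (- x)))"
      using nonneg
    proof (rule eventually_mono)
      fix x :: real assume x: "0 \<le> x"
      then have "\<bar>g (exp (- x))\<bar> \<le> \<bar>K\<bar>" using g[of "exp (- x)"] by simp
      then show "norm ((1 - exp (- x)) * g (exp (- x))) \<le> norm (K * (1 - exp (- x)))"
        by (auto simp: abs_mult mult.commute intro: mult_right_mono)
    qed
  qed measurable
  show f: "integrable M (\<lambda>x. (1 - exp (- x)) * f (exp (- x)))" by (rule int_bnd) (use bnd in auto)
  have "\<bar>p y\<bar> \<le> B + \<epsilon>" if "0 \<le> y" "y \<le> 1" for y using bnd[OF that] close[OF that] by linarith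
  then have p: "integrable M (\<lambda>x. (1 - exp (- x)) * p (exp (- x)))" by (intro int_bnd) auto
  have "\<bar>(\<integral>x. (1 - exp (- x)) * f (exp (- x)) \<partial>M) - (\<integral>x. (1 - exp (- x)) * p (exp (- x)) \<partial>M)\<bar>
      = \<bar>\<integral>x. (1 - exp (- x)) * f (exp (- x)) - (1 - exp (- x)) * p (exp (- x)) \<partial>M\<bar>"
    using f p by simp
  also have "\<dots> \<le> (\<integral>x. \<bar>(1 - exp (- x)) * f (exp (- x)) - (1 - exp (- x)) * p (exp (- x))\<bar> \<partial>M)"
    by (rule integral_abs_bound)
  also have "\<dots> \<le> (\<integral>x. \<epsilon> * (1 - exp (- x)) \<partial>M)"
  proof (rule integral_mono_AE)
    show "integrable M (\<lambda>x. \<bar>(1 - exp (- x)) * f (exp (- x)) - (1 - exp (- x)) * p (exp (- x))\<bar>)"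
      using f p by (intro integrable_abs Bochner_Integration.integrable_diff)
    show "integrable M (\<lambda>x. \<epsilon> * (1 - exp (- x)))" using int by (rule integrable_mult_right)
    show "AE x in M. \<bar>(1 - exp (- x)) * f (exp (- x)) - (1 - exp (- x)) * p (exp (- x))\<bar> \<le> \<epsilon> * (1 - exp (- x))"
      using nonneg
    proof (rule eventually_mono)
      fix x :: real assume x: "0 \<le> x"
      have "\<bar>(1 - exp (- x)) * (f (exp (- x)) - p (exp (- x)))\<bar> \<le> (1 - exp (- x)) * \<epsilon>"
        using x close[of "exp (- x)"] by (simp add: abs_mult mult_left_mono)
      then show "\<bar>(1 - exp (- x)) * f (exp (- x)) - (1 - exp (- x)) * p (exp (- x))\<bar> \<le> \<epsilon> * (1 - exp (- x))"
        by (simp add: right_diff_distrib mult.commute)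
    qed
  qed
  also have "\<dots> = \<epsilon> * (\<integral>x. 1 - exp (- x) \<partial>M)" by (rule integral_mult_right_zero)
  finally show "\<bar>(\<integral>x. (1 - exp (- x)) * f (exp (- x)) \<partial>M) - (\<integral>x. (1 - exp (- x)) * p (exp (- x)) \<partial>M)\<bar>
      \<le> \<epsilon> * (\<integral>x. 1 - exp (- x) \<partial>M)" .
qed

context driftless
begin

text \<open>
  For a polynomial in \<open>exp (- x)\<close> with a factor \<open>1 - exp (- x)\<close> this is the Laplace transform;
  the Weierstrass theorem extends it to continuous functions.
\<close>

lemma small_time_limit:
  assumes t: "0 \<le> t" and f: "continuous_on UNIV f"
  shows "(\<lambda>n. real n * (\<integral>\<omega>. (1 - exp (- S (t / real n) \<omega>)) * f (exp (- S (t / real n) \<omega>)) \<partial>N))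
    \<longlonglongrightarrow> t * (\<integral>x. (1 - exp (- x)) * f (exp (- x)) \<partial>\<nu>)"
proof -
  define \<mu> where "\<mu> n = distr N borel (S (t / real n))" for n
  define J where "J M g = (\<integral>x. (1 - exp (- x)) * g (exp (- x)) \<partial>M)" for M :: "real measure" and g :: "real \<Rightarrow> real"
  have S_meas [measurable]: "S (t / real n) \<in> borel_measurable N" for n using t by (intro value_measurable) simp
  have \<mu>_sets: "sets (\<mu> n) = sets borel" for n by (simp add: \<mu>_def)
  have \<mu>_nonneg: "AE x in \<mu> n. 0 \<le> x" for n
    unfolding \<mu>_def by (subst AE_distr_iff) (use AE_nonneg[of "t / real n"] t in auto)
  have J_\<mu>: "J (\<mu> n) g = (\<integral>\<omega>. (1 - exp (- S (t / real n) \<omega>)) * g (exp (- S (t / real n) \<omega>)) \<partial>N)"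
    if [measurable]: "g \<in> borel_measurable borel" for g n
    unfolding J_def \<mu>_def by (subst integral_distr) auto
  have int_\<mu>: "integrable (\<mu> n) (\<lambda>x. 1 - exp (- x))" for n
    using integrable_exp_value[of 1 "t / real n"] t
    unfolding \<mu>_def by (subst integrable_distr_eq) auto
  have int_\<nu>: "integrable \<nu> (\<lambda>x. 1 - exp (- x))" using integrable_one_minus_exp[of 1] by simp
  have \<nu>_nonneg: "AE x in \<nu>. 0 \<le> x" using AE_jump_pos by (rule eventually_mono) simp
  have pow: "(\<lambda>n. real n * J (\<mu> n) (\<lambda>y. y ^ k)) \<longlonglongrightarrow> t * J \<nu> (\<lambda>y. y ^ k)" for k
  proof -
    have eq: "(1 - exp (- x)) * exp (- x) ^ k = exp (- real k * x) - exp (- real (Suc k) * x)" for x :: real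
      by (simp add: exp_of_nat_mult[symmetric] exp_add[symmetric] algebra_simps)
    have "J (\<mu> n) (\<lambda>y. y ^ k) = exp (- (t / real n) * \<phi> (real k)) - exp (- (t / real n) * \<phi> (real (Suc k)))" for n
    proof -
      have "J (\<mu> n) (\<lambda>y. y ^ k) = (\<integral>\<omega>. exp (- real k * S (t / real n) \<omega>) - exp (- real (Suc k) * S (t / real n) \<omega>) \<partial>N)"
        using J_\<mu>[of "\<lambda>y. y ^ k" n] by (simp add: eq)
      also have "\<dots> = (\<integral>\<omega>. exp (- real k * S (t / real n) \<omega>) \<partial>N) - (\<integral>\<omega>. exp (- real (Suc k) * S (t / real n) \<omega>) \<partial>N)"
        using t by (intro Bochner_Integration.integral_diff integrable_exp_value) auto
      also have "\<dots> = exp (- (t / real n) * \<phi> (real k)) - exp (- (t / real n) * \<phi> (real (Suc k)))"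
        using t by (simp only: laplace of_nat_0_le_iff divide_nonneg_nonneg)
      finally show ?thesis .
    qed
    moreover have "J \<nu> (\<lambda>y. y ^ k) = \<phi> (real (Suc k)) - \<phi> (real k)"
    proof -
      have "J \<nu> (\<lambda>y. y ^ k) = (\<integral>x. (1 - exp (- real (Suc k) * x)) - (1 - exp (- real k * x)) \<partial>\<nu>)"
        unfolding J_def eq by (intro Bochner_Integration.integral_cong) (auto simp: algebra_simps)
      also have "\<dots> = \<phi> (real (Suc k)) - \<phi> (real k)"
        unfolding exponent_eq[OF of_nat_0_le_iff]
        by (intro Bochner_Integration.integral_diff integrable_one_minus_exp) auto
      finally show ?thesis .
    qed
    moreover have "(\<lambda>n. real n * (exp (- (t / real n) * a) - exp (- (t / real n) * b))) \<longlonglongrightarrow> t * b - t * a" for a b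
      by real_asymp
    ultimately show ?thesis by (simp add: right_diff_distrib)
  qed
  have f_meas [measurable]: "f \<in> borel_measurable borel" using f by (rule borel_measurable_continuous_onI)
  have "bounded (f ` {0..1})"
    using f by (intro compact_imp_bounded compact_continuous_image continuous_on_subset[OF f]) auto
  then obtain B where "\<forall>y\<in>{0..1}. \<bar>f y\<bar> \<le> B" by (auto simp: bounded_iff)
  then have B: "\<And>y. 0 \<le> y \<Longrightarrow> y \<le> 1 \<Longrightarrow> \<bar>f y\<bar> \<le> B" by simp
  have "(\<lambda>n. real n * J (\<mu> n) f) \<longlonglongrightarrow> t * J \<nu> f"
  proof (rule LIMSEQ_I)
    fix e :: real assume e: "0 < e"
    define K where "K = t * \<phi> 1 + 1"
    have K: "0 < K" using t exponent_nonneg[of 1] by (simp add: K_def add_nonneg_pos)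
    obtain p where p: "real_polynomial_function p" "\<And>y. y \<in> {0..1} \<Longrightarrow> \<bar>f y - p y\<bar> < e / (3 * K)"
      using Stone_Weierstrass_real_polynomial_function[of "{0..1::real}" f "e / (3 * K)"] e K f
      by (auto intro: continuous_on_subset)
    obtain a m where pa: "p = (\<lambda>x. \<Sum>i\<le>m. a i * x ^ i)"
      using p(1) real_polynomial_function_iff_sum by blast
    have p_meas [measurable]: "p \<in> borel_measurable borel" unfolding pa by measurable
    have J_p: "J M p = (\<Sum>i\<le>m. a i * J M (\<lambda>y. y ^ i))"
      if "sets M = sets borel" "AE x in M. 0 \<le> x" "integrable M (\<lambda>x. 1 - exp (- x))" for M
    proof -
      have "integrable M (\<lambda>x. (1 - exp (- x)) * exp (- x) ^ i)" for i
        by (rule poly_approx_integral(1)[OF that, of "\<lambda>y. y ^ i" "\<lambda>y. y ^ i" 1 0]) (auto simp: power_le_one)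
      then have "(\<integral>x. (\<Sum>i\<le>m. a i * ((1 - exp (- x)) * exp (- x) ^ i)) \<partial>M) = (\<Sum>i\<le>m. a i * J M (\<lambda>y. y ^ i))"
        by (subst Bochner_Integration.integral_sum) (auto simp: J_def)
      then show ?thesis by (simp add: J_def pa sum_distrib_left mult_ac)
    qed
    have "(\<lambda>n. \<Sum>i\<le>m. a i * (real n * J (\<mu> n) (\<lambda>y. y ^ i))) \<longlonglongrightarrow> (\<Sum>i\<le>m. a i * (t * J \<nu> (\<lambda>y. y ^ i)))"
      by (intro tendsto_intros pow)
    moreover have "(\<Sum>i\<le>m. a i * (real n * J (\<mu> n) (\<lambda>y. y ^ i))) = real n * J (\<mu> n) p" for n
      by (subst J_p[OF \<mu>_sets \<mu>_nonneg int_\<mu>]) (simp add: sum_distrib_left mult_ac)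
    moreover have "(\<Sum>i\<le>m. a i * (t * J \<nu> (\<lambda>y. y ^ i))) = t * J \<nu> p"
      by (subst J_p[OF sets_levy \<nu>_nonneg int_\<nu>]) (simp add: sum_distrib_left mult_ac)
    ultimately have "(\<lambda>n. real n * J (\<mu> n) p) \<longlonglongrightarrow> t * J \<nu> p" by simp
    from LIMSEQ_D[OF this, of "e / 3"] e
    obtain n0 where n0: "\<forall>n\<ge>n0. \<bar>real n * J (\<mu> n) p - t * J \<nu> p\<bar> < e / 3"
      unfolding real_norm_def by (meson divide_pos_pos zero_less_numeral)
    have "\<bar>real n * J (\<mu> n) f - t * J \<nu> f\<bar> < e" if n: "n \<ge> max 1 n0" for n
    proof -
      have mass: "(\<integral>x. 1 - exp (- x) \<partial>\<mu> n) \<le> (t / real n) * \<phi> 1"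
      proof -
        have "(\<integral>x. 1 - exp (- x) \<partial>\<mu> n) = (\<integral>\<omega>. 1 - exp (- 1 * S (t / real n) \<omega>) \<partial>N)"
          unfolding \<mu>_def by (subst integral_distr) auto
        also have "\<dots> = (\<integral>\<omega>. 1 \<partial>N) - (\<integral>\<omega>. exp (- 1 * S (t / real n) \<omega>) \<partial>N)"
          using t by (intro Bochner_Integration.integral_diff integrable_exp_value) auto
        also have "\<dots> = 1 - exp (- (t / real n) * \<phi> 1)"
          using t laplace[of 1 "t / real n"] by (simp add: prob_space)
        also have "\<dots> \<le> (t / real n) * \<phi> 1"
          using exp_ge_add_one_self[of "- (t / real n) * \<phi> 1"] by linarith
        finally show ?thesis .
      qed
      have "\<bar>J (\<mu> n) f - J (\<mu> n) p\<bar> \<le> e / (3 * K) * (\<integral>x. 1 - exp (- x) \<partial>\<mu> n)"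
        unfolding J_def
        by (rule poly_approx_integral(2)[OF \<mu>_sets \<mu>_nonneg int_\<mu> f_meas p_meas B]) (use p(2) in \<open>auto intro: less_imp_le\<close>)
      also have "\<dots> \<le> e / (3 * K) * ((t / real n) * \<phi> 1)"
        using mass e K by (intro mult_left_mono) auto
      finally have "real n * \<bar>J (\<mu> n) f - J (\<mu> n) p\<bar> \<le> real n * (e / (3 * K) * ((t / real n) * \<phi> 1))"
        by (intro mult_left_mono) auto
      also have "\<dots> = e / (3 * K) * (t * \<phi> 1)" using n by simp
      also have "\<dots> \<le> e / (3 * K) * K" using e K by (intro mult_left_mono) (auto simp: K_def)
      finally have 1: "\<bar>real n * J (\<mu> n) f - real n * J (\<mu> n) p\<bar> \<le> e / 3"
        using K by (simp add: abs_mult right_diff_distrib[symmetric])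
      have "\<bar>J \<nu> f - J \<nu> p\<bar> \<le> e / (3 * K) * (\<integral>x. 1 - exp (- x) \<partial>\<nu>)"
        unfolding J_def
        by (rule poly_approx_integral(2)[OF sets_levy \<nu>_nonneg int_\<nu> f_meas p_meas B]) (use p(2) in \<open>auto intro: less_imp_le\<close>)
      then have "t * \<bar>J \<nu> f - J \<nu> p\<bar> \<le> t * (e / (3 * K) * \<phi> 1)"
        using t exponent_eq[of 1] by (intro mult_left_mono) auto
      also have "\<dots> = e / (3 * K) * (t * \<phi> 1)" by simp
      also have "\<dots> < e / (3 * K) * K" using e K by (intro mult_strict_left_mono) (auto simp: K_def)
      finally have 2: "\<bar>t * J \<nu> f - t * J \<nu> p\<bar> < e / 3"
        using K t by (simp add: abs_mult right_diff_distrib[symmetric])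
      show ?thesis using 1 2 n0[rule_format, of n] n by linarith
    qed
    then show "\<exists>no. \<forall>n\<ge>no. norm (real n * J (\<mu> n) f - t * J \<nu> f) < e"
      by (intro exI[of _ "max 1 n0"]) auto
  qed
  then show ?thesis by (subst (asm) J_\<mu>) (auto simp: J_def)
qed

text \<open>A continuous ramp between \<open>a\<close> and \<open>b\<close> lies between the indicators of the two tails.\<close>

lemma small_time_tail:
  assumes t: "0 \<le> t" and ab: "0 < a" "a < b" and e: "0 < e"
  shows "eventually (\<lambda>n. real n * prob {\<omega>\<in>space N. b < S (t / real n) \<omega>} \<le> t * w a + e) sequentially"
    and "eventually (\<lambda>n. t * w b - e \<le> real n * prob {\<omega>\<in>space N. a < S (t / real n) \<omega>}) sequentially"
proof -
  define g where "g y = min 1 (max 0 ((exp (- a) - y) / (exp (- a) - exp (- b))))" for y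
  define f where "f y = g y / max (1 - y) (1 - exp (- a))" for y
  have gap: "0 < exp (- a) - exp (- b)" "0 < 1 - exp (- a)" using ab by auto
  have cont: "continuous_on UNIV f"
    unfolding f_def g_def using gap by (intro continuous_intros) (auto simp: max_def)
  have fg: "(1 - exp (- x)) * f (exp (- x)) = g (exp (- x))" for x
  proof (cases "exp (- x) < exp (- a)")
    case True then show ?thesis using gap by (simp add: f_def max_def)
  next
    case False
    then have "g (exp (- x)) = 0" using gap by (simp add: g_def divide_nonpos_pos)
    then show ?thesis by (simp add: f_def)
  qed
  have g01: "0 \<le> g y" "g y \<le> 1" for y by (auto simp: g_def)
  have g_b: "g (exp (- x)) = 1" if "b < x" for x
    using that gap by (auto simp: g_def le_divide_eq)
  have g_a: "g (exp (- x)) = 0" if "x \<le> a" for x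
    using that gap by (simp add: g_def divide_nonpos_pos)
  have ind: "indicator {b<..} x \<le> g (exp (- x))" "g (exp (- x)) \<le> indicator {a<..} x" for x :: real
    using g01 g_b[of x] g_a[of x] by (auto simp: indicator_def)
  have [measurable]: "g \<in> borel_measurable borel" unfolding g_def by measurable
  let ?E = "\<lambda>n. \<integral>\<omega>. g (exp (- S (t / real n) \<omega>)) \<partial>N" and ?L = "\<integral>x. g (exp (- x)) \<partial>\<nu>"
  have lim: "(\<lambda>n. real n * ?E n) \<longlonglongrightarrow> t * ?L"
    using small_time_limit[OF t cont] by (simp add: fg)
  have S_meas [measurable]: "S (t / real n) \<in> borel_measurable N" for n using t by (intro value_measurable) simp
  have int_g: "integrable N (\<lambda>\<omega>. g (exp (- S (t / real n) \<omega>)))" for n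
    by (rule integrable_const_bound[of _ 1]) (use g01 in auto)
  have E_lower: "prob {\<omega>\<in>space N. b < S (t / real n) \<omega>} \<le> ?E n" for n
  proof -
    have "prob {\<omega>\<in>space N. b < S (t / real n) \<omega>} = (\<integral>\<omega>. indicator {\<omega>\<in>space N. b < S (t / real n) \<omega>} \<omega> \<partial>N)"
      by simp
    also have "\<dots> \<le> ?E n"
    proof (rule integral_mono)
      fix \<omega> show "indicator {\<omega>\<in>space N. b < S (t / real n) \<omega>} \<omega> \<le> g (exp (- S (t / real n) \<omega>))"
        using ind(1)[of "S (t / real n) \<omega>"] g01(1) by (auto simp: indicator_def split: if_splits)
    qed (use int_g in \<open>auto simp: integrable_indicator_iff less_top[symmetric]\<close>)
    finally show ?thesis .
  qed
  have E_upper: "?E n \<le> prob {\<omega>\<in>space N. a < S (t / real n) \<omega>}" for n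
  proof -
    have "?E n \<le> (\<integral>\<omega>. indicator {\<omega>\<in>space N. a < S (t / real n) \<omega>} \<omega> \<partial>N)"
    proof (rule integral_mono)
      fix \<omega> assume "\<omega> \<in> space N"
      then show "g (exp (- S (t / real n) \<omega>)) \<le> indicator {\<omega>\<in>space N. a < S (t / real n) \<omega>} \<omega>"
        using ind(2)[of "S (t / real n) \<omega>"] by (auto simp: indicator_def split: if_splits)
    qed (use int_g in \<open>auto simp: integrable_indicator_iff less_top[symmetric]\<close>)
    then show ?thesis by simp
  qed
  have int_ind: "integrable \<nu> (indicator {r<..} :: real \<Rightarrow> real)" if "0 < r" for r
    using tail_finite[OF that] by (simp add: integrable_indicator_iff)
  have int_\<nu>: "integrable \<nu> (\<lambda>x. g (exp (- x)))"
    by (rule Bochner_Integration.integrable_bound[OF int_ind[OF ab(1)]]) (use ind(2) g01(1) in auto)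
  have L_upper: "?L \<le> w a"
  proof -
    have "?L \<le> (\<integral>x. indicator {a<..} x \<partial>\<nu>)" using ind(2) by (intro integral_mono int_\<nu> int_ind ab) auto
    then show ?thesis by (simp add: levy_tail_def)
  qed
  have L_lower: "w b \<le> ?L"
  proof -
    have "(\<integral>x. indicator {b<..} x \<partial>\<nu>) \<le> ?L" using ind(1) ab by (intro integral_mono int_\<nu> int_ind) auto
    then show ?thesis by (simp add: levy_tail_def)
  qed
  have "eventually (\<lambda>n. real n * ?E n < t * ?L + e) sequentially"
    using lim e by (auto intro: order_tendstoD)
  then show "eventually (\<lambda>n. real n * prob {\<omega>\<in>space N. b < S (t / real n) \<omega>} \<le> t * w a + e) sequentially"
  proof (rule eventually_mono)
    fix n assume "real n * ?E n < t * ?L + e"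
    moreover have "real n * prob {\<omega>\<in>space N. b < S (t / real n) \<omega>} \<le> real n * ?E n"
      by (intro mult_left_mono E_lower) auto
    moreover have "t * ?L \<le> t * w a" using t L_upper by (rule mult_left_mono[rotated])
    ultimately show "real n * prob {\<omega>\<in>space N. b < S (t / real n) \<omega>} \<le> t * w a + e" by linarith
  qed
  have "eventually (\<lambda>n. t * ?L - e < real n * ?E n) sequentially"
    using lim e by (auto intro: order_tendstoD)
  then show "eventually (\<lambda>n. t * w b - e \<le> real n * prob {\<omega>\<in>space N. a < S (t / real n) \<omega>}) sequentially"
  proof (rule eventually_mono)
    fix n assume "t * ?L - e < real n * ?E n"
    moreover have "real n * ?E n \<le> real n * prob {\<omega>\<in>space N. a < S (t / real n) \<omega>}"
      by (intro mult_left_mono E_upper) auto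
    moreover have "t * w b \<le> t * ?L" using t L_lower by (rule mult_left_mono[rotated])
    ultimately show "t * w b - e \<le> real n * prob {\<omega>\<in>space N. a < S (t / real n) \<omega>}" by linarith
  qed
qed


text \<open>
  The expectation of \<open>exp (- 2 S\<^sub>t / b)\<close> is at least \<open>exp (- 1)\<close>, while the event \<open>S\<^sub>t > b\<close> contributes at
  most \<open>exp (- 2)\<close> to it.
\<close>

lemma prob_small_lower:
  assumes "0 \<le> t" "0 < b" "t * \<phi> (2 / b) \<le> 1"
  shows "exp (- 1) - exp (- 2) \<le> prob {\<omega>\<in>space N. S t \<omega> \<le> b}"
proof -
  have [measurable]: "S t \<in> borel_measurable N" using assms by (intro value_measurable) simp
  have "exp (- 1) \<le> exp (- t * \<phi> (2 / b))" using assms by simp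
  also have "\<dots> = (\<integral>\<omega>. exp (- (2 / b) * S t \<omega>) \<partial>N)" using assms by (intro laplace[symmetric]) auto
  also have "\<dots> \<le> (\<integral>\<omega>. indicator {\<omega>\<in>space N. S t \<omega> \<le> b} \<omega> + exp (- 2) \<partial>N)"
  proof (rule integral_mono_AE)
    show "integrable N (\<lambda>\<omega>. exp (- (2 / b) * S t \<omega>))" using assms by (intro integrable_exp_value) auto
    show "AE \<omega> in N. exp (- (2 / b) * S t \<omega>) \<le> indicator {\<omega>\<in>space N. S t \<omega> \<le> b} \<omega> + exp (- 2)"
      using AE_nonneg[OF assms(1)] AE_space
    proof eventually_elim
      case (elim \<omega>)
      show ?case
      proof (cases "S t \<omega> \<le> b")
        case True
        have "exp (- (2 / b) * S t \<omega>) \<le> 1" using elim assms by simp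
        moreover have "0 \<le> exp (- 2 :: real)" by simp
        ultimately show ?thesis using True elim by (simp add: add_increasing2)
      next
        case False
        then show ?thesis using assms by (auto simp: field_simps)
      qed
    qed
  qed (auto simp: integrable_indicator_iff less_top[symmetric])
  also have "\<dots> = prob {\<omega>\<in>space N. S t \<omega> \<le> b} + exp (- 2)"
    by (subst Bochner_Integration.integral_add) (auto simp: integrable_indicator_iff less_top[symmetric] prob_space)
  finally show ?thesis by simp
qed

lemma prob_small_upper:
  assumes "0 \<le> t" "0 < b"
  shows "prob {\<omega>\<in>space N. S t \<omega> \<le> b} \<le> exp (1 - t * \<phi> (1 / b))"
proof -
  have [measurable]: "S t \<in> borel_measurable N" using assms by (intro value_measurable) simp
  have "prob {\<omega>\<in>space N. S t \<omega> \<le> b} \<le> prob {\<omega>\<in>space N. exp (- 1) \<le> exp (- (1 / b) * S t \<omega>)}"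
    using assms by (intro finite_measure_mono) (auto simp: field_simps)
  also have "\<dots> \<le> (\<integral>\<omega>. exp (- (1 / b) * S t \<omega>) \<partial>N) / exp (- 1)"
    using assms by (intro integral_Markov_inequality_measure[where A = "{}"] integrable_exp_value) auto
  also have "\<dots> = exp (1 - t * \<phi> (1 / b))"
    using assms laplace[of "1 / b" t] by (simp add: exp_diff exp_minus field_simps)
  finally show ?thesis .
qed

end

section \<open>Tail estimates for the subordinator\<close>

lemma exp_minus_one_le:
  fixes z :: real
  assumes "0 \<le> z" "z \<le> 1"
  shows "exp z \<le> 1 + exp 1 * (1 - exp (- z))"
proof -
  have "exp z - 1 = exp z * (1 - exp (- z))" by (simp add: algebra_simps exp_minus_inverse)
  also have "\<dots> \<le> exp 1 * (1 - exp (- z))" using assms by (intro mult_right_mono) auto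
  finally show ?thesis by simp
qed

lemma bounded_powr_times_exp:
  fixes c b :: real
  assumes "0 < c"
  obtains K where "0 < K" "\<And>x. 1 \<le> x \<Longrightarrow> x powr b * exp (- c * x) \<le> K"
proof -
  have "((\<lambda>x. x powr b * exp (- c * x)) \<longlongrightarrow> 0) at_top" using assms by real_asymp
  then have "eventually (\<lambda>x. x powr b * exp (- c * x) < 1) at_top" by (rule order_tendstoD) simp
  then obtain X where X: "\<And>x. X \<le> x \<Longrightarrow> x powr b * exp (- c * x) < 1" by (auto simp: eventually_at_top_linorder)
  have "continuous_on {1..max 1 X} (\<lambda>x. x powr b * exp (- c * x))" by (intro continuous_intros) auto
  then have "bounded ((\<lambda>x. x powr b * exp (- c * x)) ` {1..max 1 X})"
    by (intro compact_imp_bounded compact_continuous_image) auto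
  then obtain K where K: "\<And>x. x \<in> {1..max 1 X} \<Longrightarrow> x powr b * exp (- c * x) \<le> K"
    unfolding bounded_iff by fastforce
  show thesis
  proof (rule that[of "max 1 K"])
    fix x :: real assume "1 \<le> x"
    then show "x powr b * exp (- c * x) \<le> max 1 K"
      using X[of x] K[of x] by (cases "x \<le> X") (auto simp: le_max_iff_disj)
  qed simp
qed

context poly_levy
begin

text \<open>
  Above the time scale the tail of the subordinator is that of its Levy measure, although \<open>w\<close>
  may be much smaller than \<open>\<phi>\<close>. With \<open>L = ln (1 / (t w(v)))\<close>, increments beyond \<open>v / 4\<close> have
  the right probability, and Chernoff's bound with exponent \<open>\<theta> = 2 L / v\<close> controls the rest:
  increments below \<open>1 / \<theta>\<close> contribute at most \<open>e t \<phi>(\<theta>) \<le> e (1 + L / 3) \<le> 3 + L\<close>, and those between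
  \<open>1 / \<theta>\<close> and \<open>v / 4\<close> contribute \<open>exp (L / 2) t w(v)\<close> up to a power of \<open>L\<close>.
\<close>

lemma prob_large_upper:
  obtains C where "0 < C" "\<And>(N :: 'w measure) S t v. driftless_subordinator N S \<phi> \<nu> \<Longrightarrow> 0 < t \<Longrightarrow> 0 < v \<Longrightarrow> v \<le> Rm \<Longrightarrow>
    t * \<phi> (6 / v) \<le> 1 \<Longrightarrow> measure N {\<omega>\<in>space N. v < S t \<omega>} \<le> C * (t * w v)"
proof -
  obtain K where K: "0 < K" "\<And>x. 1 \<le> x \<Longrightarrow> x powr \<beta>2 * exp (- (1 / 2) * x) \<le> K"
    using bounded_powr_times_exp[of "1 / 2" \<beta>2] by auto
  define C3 where "C3 = c2 * 4 powr \<beta>2 * K + 1"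
  define C where "C = exp 1 + c2 * 8 powr \<beta>2 + 1 + exp (3 + C3)"
  have C_pos: "0 < C" using c2_pos by (auto simp: C_def intro!: add_pos_pos)
  show thesis
  proof
    show "0 < C" by (rule C_pos)
    fix N :: "'w measure" and S t v
    assume N: "driftless_subordinator N S \<phi> \<nu>" and t: "0 < t" and v: "0 < v" "v \<le> Rm" and t\<phi>: "t * \<phi> (6 / v) \<le> 1"
    interpret driftless \<nu> \<phi> N S by unfold_locales (rule N)
    have wv: "0 < t * w v" using tail_pos[OF v] t by simp
    show "prob {\<omega>\<in>space N. v < S t \<omega>} \<le> C * (t * w v)"
    proof (cases "exp (- 1) \<le> t * w v")
      case True
      have "prob {\<omega>\<in>space N. v < S t \<omega>} \<le> exp 1 * exp (- 1)" by (simp add: exp_minus_inverse)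
      also have "\<dots> \<le> exp 1 * (t * w v)" using True by (intro mult_left_mono) auto
      also have "\<dots> \<le> C * (t * w v)" using wv c2_pos by (intro mult_right_mono) (auto simp: C_def)
      finally show ?thesis .
    next
      case False
      define L where "L = - ln (t * w v)"
      have L: "1 \<le> L" "exp (- L) = t * w v"
        using False wv ln_less_cancel_iff[of "t * w v" "exp (- 1)"] by (auto simp: L_def)
      define \<theta> where "\<theta> = 2 * L / v"
      have \<theta>: "0 < \<theta>" "\<theta> * v = 2 * L" using L v by (auto simp: \<theta>_def)
      define a where "a = v / 4"
      have a: "0 < a" "\<theta> * a = L / 2" using v \<theta> by (auto simp: a_def)
      \<comment> \<open>The limiting bounds hold up to an error; any positive error will do, and \<open>t w(v)\<close> is the right order.\<close>
      have "eventually (\<lambda>n. real n * prob {\<omega>\<in>space N. a < S (t / real n) \<omega>} \<le> t * w (a / 2) + t * w v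
          \<and> real n * prob {\<omega>\<in>space N. 1 / \<theta> < S (t / real n) \<omega>} \<le> t * w (1 / (2 * \<theta>)) + t * w v \<and> 1 \<le> n) sequentially"
        using t a \<theta> wv by (intro eventually_conj small_time_tail(1) eventually_ge_at_top) (auto simp: field_simps)
      then obtain n where n: "1 \<le> n"
          "real n * prob {\<omega>\<in>space N. a < S (t / real n) \<omega>} \<le> t * w (a / 2) + t * w v"
          "real n * prob {\<omega>\<in>space N. 1 / \<theta> < S (t / real n) \<omega>} \<le> t * w (1 / (2 * \<theta>)) + t * w v"
        by (auto simp: eventually_at_top_linorder)
      define \<tau> where "\<tau> = t / real n"
      have \<tau>: "0 \<le> \<tau>" "real n * \<tau> = t" using n t by (auto simp: \<tau>_def)
      have [measurable]: "S \<tau> \<in> borel_measurable N" using \<tau> by (intro value_measurable)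
      let ?F = "\<lambda>x. if x \<in> {0..a} then exp (\<theta> * x) else 1"
      let ?P = "prob {\<omega>\<in>space N. 1 / \<theta> < S \<tau> \<omega>}"
      have "(\<integral>\<omega>. ?F (S \<tau> \<omega>) \<partial>N)
          \<le> (\<integral>\<omega>. 1 + exp 1 * (1 - exp (- \<theta> * S \<tau> \<omega>)) + exp (\<theta> * a) * indicator {\<omega>\<in>space N. 1 / \<theta> < S \<tau> \<omega>} \<omega> \<partial>N)"
      proof (rule integral_mono_AE)
        show "integrable N (\<lambda>\<omega>. ?F (S \<tau> \<omega>))"
          using \<theta> by (intro integrable_const_bound[of _ "exp (\<theta> * a)"]) (auto simp: mult_left_mono a(1) less_imp_le)
        show "integrable N (\<lambda>\<omega>. 1 + exp 1 * (1 - exp (- \<theta> * S \<tau> \<omega>)) + exp (\<theta> * a) * indicator {\<omega>\<in>space N. 1 / \<theta> < S \<tau> \<omega>} \<omega>)"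
          using \<theta> \<tau> by (intro Bochner_Integration.integrable_add integrable_mult_right Bochner_Integration.integrable_diff integrable_exp_value)
            (auto simp: integrable_indicator_iff less_top[symmetric])
        show "AE \<omega> in N. ?F (S \<tau> \<omega>) \<le> 1 + exp 1 * (1 - exp (- \<theta> * S \<tau> \<omega>)) + exp (\<theta> * a) * indicator {\<omega>\<in>space N. 1 / \<theta> < S \<tau> \<omega>} \<omega>"
          using AE_nonneg[OF \<tau>(1)] AE_space
        proof eventually_elim
          case (elim \<omega>)
          let ?x = "S \<tau> \<omega>"
          have pos: "0 \<le> exp 1 * (1 - exp (- \<theta> * ?x))" using elim \<theta> by (intro mult_nonneg_nonneg) auto
          consider "?x \<le> a" "?x \<le> 1 / \<theta>" | "?x \<le> a" "1 / \<theta> < ?x" | "a < ?x" by linarith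
          then show ?case
          proof cases
            case 1
            then have "\<theta> * ?x \<le> 1" using \<theta> by (simp add: field_simps)
            then show ?thesis using 1 elim \<theta> exp_minus_one_le[of "\<theta> * ?x"] by simp
          next
            case 2
            have "exp (\<theta> * ?x) \<le> exp (\<theta> * a)" using 2 \<theta> by (simp add: mult_left_mono)
            then show ?thesis using 2 elim pos by (simp del: exp_le_cancel_iff)
          next
            case 3
            then show ?thesis using elim pos by simp
          qed
        qed
      qed
      also have "\<dots> = 1 + exp 1 * (1 - exp (- \<tau> * \<phi> \<theta>)) + exp (\<theta> * a) * ?P"
      proof -
        have i: "integrable N (\<lambda>\<omega>. exp (- \<theta> * S \<tau> \<omega>))" using \<theta> \<tau> by (intro integrable_exp_value) auto
        have j: "integrable N (\<lambda>\<omega>. indicator {\<omega>\<in>space N. 1 / \<theta> < S \<tau> \<omega>} \<omega> :: real)"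
          by (auto simp: integrable_indicator_iff less_top[symmetric])
        have "(\<integral>\<omega>. 1 + exp 1 * (1 - exp (- \<theta> * S \<tau> \<omega>)) + exp (\<theta> * a) * indicator {\<omega>\<in>space N. 1 / \<theta> < S \<tau> \<omega>} \<omega> \<partial>N)
          = 1 + exp 1 * (1 - (\<integral>\<omega>. exp (- \<theta> * S \<tau> \<omega>) \<partial>N)) + exp (\<theta> * a) * ?P"
          using i j by (simp add: prob_space)
        then show ?thesis using \<theta> \<tau> laplace[of \<theta> \<tau>] by simp
      qed
      also have "\<dots> \<le> 1 + (exp 1 * (\<tau> * \<phi> \<theta>) + exp (\<theta> * a) * ?P)"
      proof -
        have "exp 1 * (1 - exp (- \<tau> * \<phi> \<theta>)) \<le> exp 1 * (\<tau> * \<phi> \<theta>)"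
          using exp_ge_add_one_self[of "- \<tau> * \<phi> \<theta>"] by (intro mult_left_mono) auto
        then show ?thesis by simp
      qed
      also have "\<dots> \<le> exp (exp 1 * (\<tau> * \<phi> \<theta>) + exp (\<theta> * a) * ?P)" by (rule exp_ge_add_one_self)
      finally have F: "(\<integral>\<omega>. ?F (S \<tau> \<omega>) \<partial>N) \<le> exp (exp 1 * (\<tau> * \<phi> \<theta>) + exp (\<theta> * a) * ?P)" .
      have F0: "0 \<le> (\<integral>\<omega>. ?F (S \<tau> \<omega>) \<partial>N)" by (intro integral_nonneg_AE) auto
      have w_mid: "w (1 / (2 * \<theta>)) \<le> c2 * (4 * L) powr \<beta>2 * w v"
      proof -
        have "1 / (2 * \<theta>) = v / (4 * L)" by (simp add: \<theta>_def)
        moreover have "v / (4 * L) \<le> v" using v L by (simp add: field_simps)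
        ultimately show ?thesis using tail_upper[of "v / (4 * L)" v] v L by simp
      qed
      have "real n * (exp (\<theta> * a) * ?P) = exp (L / 2) * (real n * ?P)" using a by simp
      also have "\<dots> \<le> exp (L / 2) * (t * w (1 / (2 * \<theta>)) + t * w v)"
        using n by (intro mult_left_mono) (auto simp: \<tau>_def)
      also have "\<dots> \<le> exp (L / 2) * (t * (c2 * (4 * L) powr \<beta>2 * w v) + t * w v)"
        using w_mid t by (intro mult_left_mono add_mono) auto
      also have "\<dots> = exp (L / 2) * exp (- L) * (c2 * (4 * L) powr \<beta>2 + 1)"
        unfolding L(2) by (simp add: algebra_simps)
      also have "exp (L / 2) * exp (- L) = exp (- (1 / 2) * L)" by (simp add: exp_add[symmetric])
      also have "exp (- (1 / 2) * L) * (c2 * (4 * L) powr \<beta>2 + 1)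
          = c2 * 4 powr \<beta>2 * (L powr \<beta>2 * exp (- (1 / 2) * L)) + exp (- (1 / 2) * L)"
        using L by (simp add: powr_mult algebra_simps)
      also have "\<dots> \<le> C3"
        unfolding C3_def using K(2)[of L] L c2_pos by (intro add_mono mult_left_mono) auto
      finally have mid: "real n * (exp (\<theta> * a) * ?P) \<le> C3" .
      have t\<phi>\<theta>: "t * \<phi> \<theta> \<le> 1 + L / 3"
      proof (cases "\<theta> \<le> 6 / v")
        case True
        then have "t * \<phi> \<theta> \<le> t * \<phi> (6 / v)" using \<theta> t by (intro mult_left_mono exponent_mono) auto
        then show ?thesis using t\<phi> L by simp
      next
        case False
        then have "1 \<le> L / 3" using v by (auto simp: \<theta>_def field_simps)
        then have "\<phi> (L / 3 * (6 / v)) \<le> L / 3 * \<phi> (6 / v)" using v by (intro exponent_mult_le) auto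
        then have "t * \<phi> \<theta> \<le> t * (L / 3 * \<phi> (6 / v))" using t by (intro mult_left_mono) (auto simp: \<theta>_def)
        also have "\<dots> = L / 3 * (t * \<phi> (6 / v))" by simp
        also have "\<dots> \<le> L / 3 * 1" using t\<phi> L by (intro mult_left_mono) auto
        finally show ?thesis by simp
      qed
      have small: "real n * (exp 1 * (\<tau> * \<phi> \<theta>)) \<le> 3 + L"
      proof -
        have "real n * (exp 1 * (\<tau> * \<phi> \<theta>)) = exp 1 * (t * \<phi> \<theta>)" using \<tau>(2) by (simp add: mult_ac flip: \<tau>(2))
        also have "\<dots> \<le> 3 * (1 + L / 3)"
          using t\<phi>\<theta> exp_le t exponent_nonneg[of \<theta>] \<theta> by (intro mult_mono) auto
        finally show ?thesis by simp
      qed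
      have "prob {\<omega>\<in>space N. v < S t \<omega>} \<le> real n * prob {\<omega>\<in>space N. a < S \<tau> \<omega>}
          + exp (- \<theta> * v) * (\<integral>\<omega>. ?F (S \<tau> \<omega>) \<partial>N) ^ n"
        using chernoff_truncated[of \<tau> \<theta> a v n] \<tau> \<theta> a by simp
      also have "real n * prob {\<omega>\<in>space N. a < S \<tau> \<omega>} \<le> t * w (v / 8) + t * w v"
        using n by (simp add: \<tau>_def a_def)
      also have "w (v / 8) \<le> c2 * 8 powr \<beta>2 * w v" using tail_upper[of "v / 8" v] v by simp
      also have "exp (- \<theta> * v) * (\<integral>\<omega>. ?F (S \<tau> \<omega>) \<partial>N) ^ n \<le> exp (3 + C3) * (t * w v)"
      proof -
        have "(\<integral>\<omega>. ?F (S \<tau> \<omega>) \<partial>N) ^ n \<le> exp (exp 1 * (\<tau> * \<phi> \<theta>) + exp (\<theta> * a) * ?P) ^ n"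
          using F F0 by (rule power_mono)
        also have "\<dots> = exp (real n * (exp 1 * (\<tau> * \<phi> \<theta>)) + real n * (exp (\<theta> * a) * ?P))"
          by (simp add: exp_of_nat_mult[symmetric] distrib_left)
        also have "\<dots> \<le> exp (3 + L + C3)" using small mid by simp
        finally have "exp (- \<theta> * v) * (\<integral>\<omega>. ?F (S \<tau> \<omega>) \<partial>N) ^ n \<le> exp (- \<theta> * v) * exp (3 + L + C3)"
          by (intro mult_left_mono) auto
        also have "\<dots> = exp (3 + C3) * exp (- L)" using \<theta>(2) by (simp add: exp_add[symmetric])
        finally show ?thesis by (simp add: L(2))
      qed
      finally have "prob {\<omega>\<in>space N. v < S t \<omega>}
          \<le> t * (c2 * 8 powr \<beta>2 * w v) + t * w v + exp (3 + C3) * (t * w v)" using t by (simp add: mult_left_mono)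
      also have "\<dots> = (c2 * 8 powr \<beta>2 + 1 + exp (3 + C3)) * (t * w v)" by (simp add: algebra_simps)
      also have "\<dots> \<le> C * (t * w v)" using wv by (intro mult_right_mono) (auto simp: C_def)
      finally show ?thesis .
    qed
  qed
qed

text \<open>
  One increment between \<open>\<delta> v\<close> and \<open>v / 2\<close> brings the path into \<open>[\<delta> v, v]\<close> if the others sum up to at most
  \<open>\<delta> v\<close>, which has positive probability above the time scale. The expected number of such increments
  is about \<open>t (w(\<delta> v) - w(v / 2))\<close>; the lower exponent of the tail lets the first term dominate for small
  \<open>\<delta>\<close>.
\<close>

lemma prob_window_lower:
  obtains \<delta> c where "0 < \<delta>" "\<delta> \<le> 1 / 8" "0 < c"
    "\<And>(N :: 'w measure) S t v. driftless_subordinator N S \<phi> \<nu> \<Longrightarrow> 0 < t \<Longrightarrow> 0 < v \<Longrightarrow> v \<le> Rm \<Longrightarrow>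
    t * \<phi> (2 / (\<delta> * v)) \<le> 1 \<Longrightarrow> c * (t * w v) \<le> measure N {\<omega>\<in>space N. \<delta> * v < S t \<omega> \<and> S t \<omega> \<le> v}"
proof -
  define A where "A = max 1 ((4 / c1) powr (1 / \<beta>1))"
  have A: "1 \<le> A" "4 \<le> c1 * A powr \<beta>1"
  proof -
    have "4 / c1 = ((4 / c1) powr (1 / \<beta>1)) powr \<beta>1" using c1_pos \<beta>1_pos by (simp add: powr_powr)
    also have "\<dots> \<le> A powr \<beta>1" using \<beta>1_pos by (intro powr_mono2) (auto simp: A_def)
    finally show "4 \<le> c1 * A powr \<beta>1" using c1_pos by (simp add: field_simps)
  qed (simp add: A_def)
  \<comment> \<open>The radii \<open>2 \<delta> v\<close> and \<open>v / 4\<close> differ by the factor \<open>A\<close>, so the tail drops by a factor of at least \<open>4\<close>.\<close>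
  define \<delta> where "\<delta> = 1 / (8 * A)"
  have \<delta>: "0 < \<delta>" "\<delta> \<le> 1 / 8" using A by (auto simp: \<delta>_def field_simps)
  define c :: real where "c = exp (- 1) - exp (- 2)"
  have c: "0 < c" by (simp add: c_def)
  show thesis
  proof
    fix N :: "'w measure" and S t v
    assume N: "driftless_subordinator N S \<phi> \<nu>" and t: "0 < t" and v: "0 < v" "v \<le> Rm" and t\<phi>: "t * \<phi> (2 / (\<delta> * v)) \<le> 1"
    interpret driftless \<nu> \<phi> N S by unfold_locales (rule N)
    define X where "X = t * w (v / 4)"
    have X: "0 < X" using tail_pos[of "v / 4"] v t by (simp add: X_def)
    have "4 * w (v / 4) \<le> c1 * A powr \<beta>1 * w (v / 4)" using A tail_nonneg by (intro mult_right_mono)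
    also have "A = (v / 4) / (2 * (\<delta> * v))" using v A by (simp add: \<delta>_def field_simps)
    also have "c1 * ((v / 4) / (2 * (\<delta> * v))) powr \<beta>1 * w (v / 4) \<le> w (2 * (\<delta> * v))"
      using v \<delta> by (intro tail_lower) (auto simp: field_simps)
    finally have w4: "4 * X \<le> t * w (2 * (\<delta> * v))" using t by (simp add: X_def)
    have "eventually (\<lambda>n. real n * prob {\<omega>\<in>space N. v / 2 < S (t / real n) \<omega>} \<le> t * w (v / 4) + X
        \<and> t * w (2 * (\<delta> * v)) - X \<le> real n * prob {\<omega>\<in>space N. \<delta> * v < S (t / real n) \<omega>} \<and> 1 \<le> n) sequentially"
      using t v \<delta> X by (intro eventually_conj small_time_tail eventually_ge_at_top) auto
    then obtain n where n: "1 \<le> n" "real n * prob {\<omega>\<in>space N. v / 2 < S (t / real n) \<omega>} \<le> t * w (v / 4) + X"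
        "t * w (2 * (\<delta> * v)) - X \<le> real n * prob {\<omega>\<in>space N. \<delta> * v < S (t / real n) \<omega>}"
      by (auto simp: eventually_at_top_linorder)
    define \<tau> where "\<tau> = t / real n"
    have \<tau>: "0 \<le> \<tau>" "real n * \<tau> = t" using n t by (auto simp: \<tau>_def)
    have [measurable]: "S \<tau> \<in> borel_measurable N" "S t \<in> borel_measurable N" using \<tau> t by (auto intro!: value_measurable)
    have "prob {\<omega>\<in>space N. \<delta> * v < S \<tau> \<omega>}
        \<le> prob ({\<omega>\<in>space N. S \<tau> \<omega> \<in> {\<delta> * v<..v / 2}} \<union> {\<omega>\<in>space N. v / 2 < S \<tau> \<omega>})"
      by (intro finite_measure_mono) auto
    also have "\<dots> \<le> prob {\<omega>\<in>space N. S \<tau> \<omega> \<in> {\<delta> * v<..v / 2}} + prob {\<omega>\<in>space N. v / 2 < S \<tau> \<omega>}"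
      by (intro measure_Un_le) measurable
    finally have "real n * prob {\<omega>\<in>space N. \<delta> * v < S \<tau> \<omega>}
        \<le> real n * (prob {\<omega>\<in>space N. S \<tau> \<omega> \<in> {\<delta> * v<..v / 2}} + prob {\<omega>\<in>space N. v / 2 < S \<tau> \<omega>})"
      by (rule mult_left_mono) simp
    then have many: "X \<le> real n * prob {\<omega>\<in>space N. S \<tau> \<omega> \<in> {\<delta> * v<..v / 2}}"
      using n w4 X unfolding \<tau>_def X_def distrib_left by linarith
    have stay: "c \<le> prob {\<omega>\<in>space N. S t \<omega> \<le> \<delta> * v}"
      unfolding c_def using t v \<delta> t\<phi> by (intro prob_small_lower) auto
    have "c * (t * w v) \<le> c * X"
      using c t v tail_antimono[of "v / 4" v] by (auto simp: X_def intro!: mult_left_mono)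
    also have "\<dots> = X * c" by simp
    also have "\<dots> \<le> real n * prob {\<omega>\<in>space N. S \<tau> \<omega> \<in> {\<delta> * v<..v / 2}} * prob {\<omega>\<in>space N. S t \<omega> \<le> \<delta> * v}"
      using many stay X c by (intro mult_mono) auto
    also have "\<dots> \<le> prob {\<omega>\<in>space N. S t \<omega> \<in> {\<delta> * v<..\<delta> * v + v / 2}}"
      using window_lower[of \<tau> "\<delta> * v" n "v / 2"] \<tau> v \<delta> by simp
    also have "\<dots> \<le> prob {\<omega>\<in>space N. \<delta> * v < S t \<omega> \<and> S t \<omega> \<le> v}"
    proof (rule finite_measure_mono)
      have "\<delta> * v \<le> 1 / 8 * v" using v \<delta>(2) by (intro mult_right_mono) auto
      then have "\<delta> * v + v / 2 \<le> v" using v by linarith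
      then show "{\<omega>\<in>space N. S t \<omega> \<in> {\<delta> * v<..\<delta> * v + v / 2}} \<subseteq> {\<omega>\<in>space N. \<delta> * v < S t \<omega> \<and> S t \<omega> \<le> v}"
        by auto
    qed measurable
    finally show "c * (t * w v) \<le> prob {\<omega>\<in>space N. \<delta> * v < S t \<omega> \<and> S t \<omega> \<le> v}" .
  qed (use \<delta> c in auto)
qed

end

section \<open>Bounds for the law of the subordinator\<close>

lemma antimono_measurable:
  fixes g :: "real \<Rightarrow> real"
  assumes "antimono g" shows "g \<in> borel_measurable borel"
proof -
  have "mono (\<lambda>u. - g u)" using assms by (auto simp: mono_def antimono_def)
  then have "(\<lambda>u. - g u) \<in> borel_measurable borel" by (rule borel_measurable_mono)
  then show ?thesis by (subst (asm) borel_measurable_uminus_eq)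
qed

lemma dyadic_level:
  fixes u :: real
  assumes "0 < u" "u \<le> 1"
  obtains j where "u \<le> (1 / 2) ^ j" "(1 / 2) ^ Suc j < u"
proof -
  define j where "j = (LEAST j. (1 / 2 :: real) ^ Suc j < u)"
  obtain n where "(1 / 2 :: real) ^ n < u" using real_arch_pow_inv[OF assms(1), of "1 / 2"] by auto
  then have "(1 / 2 :: real) ^ Suc n < u" using assms(1) by simp
  then have 1: "(1 / 2 :: real) ^ Suc j < u" unfolding j_def by (rule LeastI)
  have "u \<le> (1 / 2) ^ j"
  proof (cases j)
    case 0 then show ?thesis using assms by simp
  next
    case (Suc i)
    then have "\<not> (1 / 2 :: real) ^ Suc i < u" unfolding j_def by (intro not_less_Least) simp
    then show ?thesis using Suc by simp
  qed
  with 1 show thesis by (rule that[rotated])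
qed

lemma summable_dyadic_exp:
  fixes k c b :: real
  assumes "0 < c" "0 < b"
  shows "summable (\<lambda>j::nat. 2 powr (k * real (Suc j)) * exp (- c * 2 powr (b * real j)))"
proof -
  obtain K where K: "\<And>x. 1 \<le> x \<Longrightarrow> x powr ((k + 1) / b) * exp (- c * x) \<le> K"
    using bounded_powr_times_exp[OF assms(1)] by metis
  have le: "2 powr (k * real (Suc j)) * exp (- c * 2 powr (b * real j)) \<le> 2 powr k * K * (1 / 2) ^ j" for j :: nat
  proof -
    define x where "x = 2 powr (b * real j)"
    have x: "1 \<le> x" using assms by (auto simp: x_def intro!: ge_one_powr_ge_zero)
    have "x powr ((k + 1) / b) = 2 powr ((k + 1) * real j)"
      using assms by (simp add: x_def powr_powr mult.commute)
    moreover have "(1 / 2) ^ j = 2 powr (- real j)"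
      by (simp add: powr_minus powr_realpow power_one_over inverse_eq_divide)
    moreover have "2 powr k * (2 powr ((k + 1) * real j) * 2 powr (- real j)) = 2 powr (k * real (Suc j))"
      unfolding powr_add[symmetric] by (simp add: algebra_simps)
    ultimately have "2 powr (k * real (Suc j)) = 2 powr k * (x powr ((k + 1) / b) * (1 / 2) ^ j)"
      by simp
    then have "2 powr (k * real (Suc j)) * exp (- c * x) = 2 powr k * (1 / 2) ^ j * (x powr ((k + 1) / b) * exp (- c * x))"
      by (simp add: mult_ac)
    also have "\<dots> \<le> 2 powr k * (1 / 2) ^ j * K" using K[OF x] by (intro mult_left_mono) auto
    finally show ?thesis by (simp add: x_def mult_ac)
  qed
  have "summable (\<lambda>j::nat. 2 powr k * K * (1 / 2) ^ j)" by (intro summable_mult summable_geometric) simp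
  then show ?thesis by (rule summable_comparison_test'[where N = 0]) (use le in simp)
qed

context poly_levy
begin

text \<open>
  Negative moments are finite by the Laplace transform: dyadically, \<open>u powr - k\<close> is dominated by
  a sum of exponentials \<open>2 powr (k j) exp (- (2 ^ j) u)\<close>.
\<close>

lemma negative_moment:
  fixes k T :: real
  assumes k: "0 \<le> k" and T: "0 < T"
  obtains C where "0 < C" "\<And>(N :: 'w measure) S t. driftless_subordinator N S \<phi> \<nu> \<Longrightarrow> 0 < t \<Longrightarrow> t \<le> T \<Longrightarrow>
    (\<integral>\<^sup>+\<omega>. ennreal (max 1 ((time_scale t / S t \<omega>) powr k)) \<partial>N) \<le> ennreal C"
proof -
  obtain c where c: "0 < c" "\<And>r R. 0 < r \<Longrightarrow> r \<le> R \<Longrightarrow> R \<le> time_scale T \<Longrightarrow>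
      c * (R / r) powr \<beta>1 * \<phi> (1 / R) \<le> \<phi> (1 / r)"
    using exponent_scaling[of "time_scale T"] by auto
  define b where "b j = exp 1 * 2 powr (k * real (Suc j))" for j :: nat
  define d where "d j = exp (- c * 2 powr (\<beta>1 * real j))" for j :: nat
  have bd: "summable (\<lambda>j. b j * d j)"
    using summable_mult[OF summable_dyadic_exp[OF c(1) \<beta>1_pos, of k], of "exp 1"]
    by (simp add: b_def d_def mult.assoc)
  have bd0: "0 \<le> b j * d j" for j by (simp add: b_def d_def)
  define C where "C = 1 + (\<Sum>j. b j * d j)"
  have C: "0 < C" using suminf_nonneg[OF bd bd0] by (simp add: C_def)
  show thesis
  proof
    show "0 < C" by (rule C)
    fix N :: "'w measure" and S t
    assume N: "driftless_subordinator N S \<phi> \<nu>" and t: "0 < t" "t \<le> T"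
    interpret driftless \<nu> \<phi> N S by unfold_locales (rule N)
    let ?s = "time_scale t"
    have s: "0 < ?s" "?s \<le> time_scale T" using t T by (auto intro: time_scale_pos time_scale_mono)
    have [measurable]: "S t \<in> borel_measurable N" using t by (intro value_measurable) simp
    let ?e = "\<lambda>j \<omega>. exp (- (2 ^ j / ?s) * S t \<omega>)"
    have "AE \<omega> in N. ennreal (max 1 ((?s / S t \<omega>) powr k)) \<le> 1 + (\<Sum>j. ennreal (b j) * ennreal (?e j \<omega>))"
      using AE_nonneg[OF less_imp_le[OF t(1)]]
    proof eventually_elim
      case (elim \<omega>)
      have S0: "0 \<le> S t \<omega>" using elim by simp
      show ?case
      proof (cases "0 < S t \<omega> \<and> S t \<omega> \<le> ?s")
        case True
        define u where "u = S t \<omega> / ?s"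
        have u: "0 < u" "u \<le> 1" using True s by (auto simp: u_def)
        obtain j where j: "u \<le> (1 / 2) ^ j" "(1 / 2) ^ Suc j < u" using dyadic_level[OF u] .
        have "(?s / S t \<omega>) powr k = (1 / u) powr k" by (simp add: u_def)
        also have "\<dots> \<le> (2 ^ Suc j) powr k"
        proof (rule powr_mono2)
          have "1 / u \<le> 1 / (1 / 2) ^ Suc j" using j u by (intro divide_left_mono) auto
          then show "1 / u \<le> 2 ^ Suc j" by (simp add: power_one_over)
        qed (use k u in auto)
        also have "\<dots> = 2 powr (k * real (Suc j))"
          using powr_realpow[of 2 "Suc j", symmetric]
          by (simp only: powr_powr mult.commute zero_less_numeral simp_thms)
        finally have 1: "(?s / S t \<omega>) powr k \<le> 2 powr (k * real (Suc j))" .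
        have "2 ^ j * u \<le> 1" using j(1) by (simp add: power_one_over field_simps)
        then have "1 \<le> exp 1 * ?e j \<omega>" by (simp add: u_def exp_add[symmetric])
        then have "2 powr (k * real (Suc j)) * 1 \<le> 2 powr (k * real (Suc j)) * (exp 1 * ?e j \<omega>)"
          by (intro mult_left_mono) auto
        then have "2 powr (k * real (Suc j)) \<le> b j * ?e j \<omega>" by (simp add: b_def mult_ac)
        moreover have "1 \<le> 2 powr (k * real (Suc j))" using k by (intro ge_one_powr_ge_zero) auto
        ultimately have "max 1 ((?s / S t \<omega>) powr k) \<le> b j * ?e j \<omega>" using 1 by linarith
        then have "ennreal (max 1 ((?s / S t \<omega>) powr k)) \<le> ennreal (b j) * ennreal (?e j \<omega>)"
          by (simp add: b_def ennreal_mult[symmetric] ennreal_leI del: of_nat_Suc)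
        also have "\<dots> \<le> (\<Sum>j. ennreal (b j) * ennreal (?e j \<omega>))"
          using sum_le_suminf[of "\<lambda>j. ennreal (b j) * ennreal (?e j \<omega>)" "{j}"] by auto
        finally show ?thesis by (simp add: add_increasing)
      next
        case False
        then have "(?s / S t \<omega>) powr k \<le> 1"
          using S0 s k by (cases "S t \<omega> = 0") (auto intro!: powr_le1)
        then show ?thesis by (simp add: max_def)
      qed
    qed
    then have "(\<integral>\<^sup>+\<omega>. ennreal (max 1 ((?s / S t \<omega>) powr k)) \<partial>N)
        \<le> (\<integral>\<^sup>+\<omega>. 1 + (\<Sum>j. ennreal (b j) * ennreal (?e j \<omega>)) \<partial>N)"
      by (rule nn_integral_mono_AE)
    also have "\<dots> = 1 + (\<Sum>j. ennreal (b j) * (\<integral>\<^sup>+\<omega>. ennreal (?e j \<omega>) \<partial>N))"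
      by (simp add: nn_integral_add nn_integral_suminf nn_integral_cmult emeasure_space_1)
    also have "\<dots> \<le> 1 + (\<Sum>j. ennreal (b j * d j))"
    proof (intro add_left_mono suminf_le)
      fix j
      have "(\<integral>\<^sup>+\<omega>. ennreal (?e j \<omega>) \<partial>N) = ennreal (\<integral>\<omega>. ?e j \<omega> \<partial>N)"
        using s t by (intro nn_integral_eq_integral integrable_exp_value) auto
      also have "(\<integral>\<omega>. ?e j \<omega> \<partial>N) = exp (- t * \<phi> (2 ^ j / ?s))"
        using s t by (intro laplace) auto
      also have "\<dots> \<le> d j"
      proof -
        have "c * (?s / (?s / 2 ^ j)) powr \<beta>1 * \<phi> (1 / ?s) \<le> \<phi> (1 / (?s / 2 ^ j))"
          using s by (intro c(2)) (auto simp: field_simps)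
        then have "c * (2 ^ j) powr \<beta>1 * (1 / t) \<le> \<phi> (2 ^ j / ?s)"
          using s exponent_time_scale[OF t(1)] by simp
        then have "t * (c * (2 ^ j) powr \<beta>1 * (1 / t)) \<le> t * \<phi> (2 ^ j / ?s)"
          using t by (intro mult_left_mono) auto
        moreover have "(2 ^ j) powr \<beta>1 = 2 powr (\<beta>1 * real j)"
          using powr_realpow[of 2 j, symmetric]
          by (simp only: powr_powr mult.commute zero_less_numeral simp_thms)
        ultimately show ?thesis using t by (simp add: d_def)
      qed
      finally have "(\<integral>\<^sup>+\<omega>. ennreal (?e j \<omega>) \<partial>N) \<le> ennreal (d j)" by (simp add: ennreal_leI)
      then show "ennreal (b j) * (\<integral>\<^sup>+\<omega>. ennreal (?e j \<omega>) \<partial>N) \<le> ennreal (b j * d j)"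
        by (simp add: ennreal_mult b_def d_def mult_left_mono)
    qed auto
    also have "(\<Sum>j. ennreal (b j * d j)) = ennreal (\<Sum>j. b j * d j)"
      by (intro suminf_ennreal2 bd bd0)
    also have "1 + \<dots> = ennreal C" using suminf_nonneg[OF bd bd0] by (simp add: C_def)
    finally show "(\<integral>\<^sup>+\<omega>. ennreal (max 1 ((?s / S t \<omega>) powr k)) \<partial>N) \<le> ennreal C" .
  qed
qed

text \<open>
  The values up to twice the time scale have probability bounded below, and those below \<open>\<epsilon>\<close> times the
  time scale have probability at most \<open>exp (1 - t \<phi>(1 / (\<epsilon> s)))\<close>, which the lower scaling of \<open>\<phi>\<close> makes
  small.
\<close>

lemma prob_near_scale:
  fixes T :: real
  assumes T: "0 < T"
  obtains \<epsilon> c where "0 < \<epsilon>" "\<epsilon> \<le> 1" "0 < c" "\<And>(N :: 'w measure) S t. driftless_subordinator N S \<phi> \<nu> \<Longrightarrow> 0 < t \<Longrightarrow> t \<le> T \<Longrightarrow>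
    c \<le> measure N {\<omega>\<in>space N. \<epsilon> * time_scale t < S t \<omega> \<and> S t \<omega> \<le> 2 * time_scale t}"
proof -
  obtain k where k: "0 < k" "\<And>r R. 0 < r \<Longrightarrow> r \<le> R \<Longrightarrow> R \<le> time_scale T \<Longrightarrow>
      k * (R / r) powr \<beta>1 * \<phi> (1 / R) \<le> \<phi> (1 / r)"
    using exponent_scaling[of "time_scale T"] by auto
  define c :: real where "c = (exp (- 1) - exp (- 2)) / 2"
  have c: "0 < c" by (simp add: c_def)
  define B where "B = max 1 (1 - ln c)"
  define A where "A = max 1 ((B / k) powr (1 / \<beta>1))"
  have A: "1 \<le> A" "B \<le> k * A powr \<beta>1"
  proof -
    have "B / k = ((B / k) powr (1 / \<beta>1)) powr \<beta>1" using k \<beta>1_pos by (simp add: powr_powr B_def)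
    also have "\<dots> \<le> A powr \<beta>1" using \<beta>1_pos by (intro powr_mono2) (auto simp: A_def)
    finally show "B \<le> k * A powr \<beta>1" using k by (simp add: field_simps)
  qed (simp add: A_def)
  show thesis
  proof
    show "0 < 1 / A" "1 / A \<le> 1" "0 < c" using A c by auto
    fix N :: "'w measure" and S t
    assume N: "driftless_subordinator N S \<phi> \<nu>" and t: "0 < t" "t \<le> T"
    interpret driftless \<nu> \<phi> N S by unfold_locales (rule N)
    let ?s = "time_scale t"
    have s: "0 < ?s" "?s \<le> time_scale T" using t T by (auto intro: time_scale_pos time_scale_mono)
    have [measurable]: "S t \<in> borel_measurable N" using t by (intro value_measurable) simp
    have "k * (?s / (?s / A)) powr \<beta>1 * \<phi> (1 / ?s) \<le> \<phi> (1 / (?s / A))"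
      using s A by (intro k(2)) (auto simp: field_simps)
    then have "t * (k * A powr \<beta>1 * (1 / t)) \<le> t * \<phi> (A / ?s)"
      using s A t exponent_time_scale[OF t(1)] by (intro mult_left_mono) auto
    then have "1 - ln c \<le> t * \<phi> (A / ?s)" using A t by (simp add: B_def)
    moreover have "prob {\<omega>\<in>space N. S t \<omega> \<le> ?s / A} \<le> exp (1 - t * \<phi> (1 / (?s / A)))"
      using s A t by (intro prob_small_upper) auto
    ultimately have "prob {\<omega>\<in>space N. S t \<omega> \<le> ?s / A} \<le> exp (ln c)"
      by (auto intro: order_trans)
    then have small: "prob {\<omega>\<in>space N. S t \<omega> \<le> ?s / A} \<le> c" using c by simp
    have "2 * c \<le> prob {\<omega>\<in>space N. S t \<omega> \<le> 2 * ?s}"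
      unfolding c_def using prob_small_lower[of t "2 * ?s"] s t exponent_time_scale[OF t(1)] by simp
    also have "\<dots> \<le> prob ({\<omega>\<in>space N. S t \<omega> \<le> ?s / A} \<union> {\<omega>\<in>space N. 1 / A * ?s < S t \<omega> \<and> S t \<omega> \<le> 2 * ?s})"
      by (intro finite_measure_mono) auto
    also have "\<dots> \<le> prob {\<omega>\<in>space N. S t \<omega> \<le> ?s / A} + prob {\<omega>\<in>space N. 1 / A * ?s < S t \<omega> \<and> S t \<omega> \<le> 2 * ?s}"
      by (intro measure_Un_le) measurable
    finally show "c \<le> prob {\<omega>\<in>space N. 1 / A * ?s < S t \<omega> \<and> S t \<omega> \<le> 2 * ?s}" using small by linarith
  qed
qed

text \<open>
  All that the heat kernel estimates use about the law \<open>\<mu>\<close> of the subordinator at time \<open>t\<close>. The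
  factor \<open>K\<close> separates the values of the order of the time scale from those produced by a single jump.
\<close>

definition law_bounds :: "real \<Rightarrow> real \<Rightarrow> real \<Rightarrow> real \<Rightarrow> real \<Rightarrow> real \<Rightarrow> real \<Rightarrow> real measure \<Rightarrow> bool" where
  "law_bounds k \<epsilon> K \<delta> C c t \<mu> \<longleftrightarrow>
     prob_space \<mu> \<and> sets \<mu> = sets borel \<and> (AE u in \<mu>. 0 < u) \<and>
     (\<integral>\<^sup>+u. ennreal (max 1 ((time_scale t / u) powr k)) \<partial>\<mu>) \<le> ennreal C \<and>
     ennreal c \<le> emeasure \<mu> {\<epsilon> * time_scale t..2 * time_scale t} \<and>
     (\<forall>v. K * time_scale t \<le> v \<longrightarrow> v \<le> Rm \<longrightarrow> emeasure \<mu> {v<..} \<le> ennreal (C * (t * w v))) \<and>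
     (\<forall>v. K * time_scale t \<le> v \<longrightarrow> v \<le> Rm \<longrightarrow> ennreal (c * (t * w v)) \<le> emeasure \<mu> {\<delta> * v..v})"

lemma subordinator_law_bounds:
  fixes k T :: real
  assumes k: "0 \<le> k" and T: "0 < T"
  obtains \<epsilon> K \<delta> C c where "0 < \<epsilon>" "\<epsilon> \<le> 1" "2 \<le> K" "0 < \<delta>" "\<delta> \<le> 1" "0 < C" "0 < c"
    "\<And>(N :: 'w measure) S t. driftless_subordinator N S \<phi> \<nu> \<Longrightarrow> 0 < t \<Longrightarrow> t \<le> T \<Longrightarrow>
      law_bounds k \<epsilon> K \<delta> C c t (distr N borel (S t))"
proof -
  obtain Ca where Ca: "0 < Ca" "\<And>(N :: 'w measure) S t v. driftless_subordinator N S \<phi> \<nu> \<Longrightarrow> 0 < t \<Longrightarrow> 0 < v \<Longrightarrow> v \<le> Rm \<Longrightarrow>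
    t * \<phi> (6 / v) \<le> 1 \<Longrightarrow> measure N {\<omega>\<in>space N. v < S t \<omega>} \<le> Ca * (t * w v)"
    by (fact prob_large_upper[where ?'w = 'w])
  obtain \<delta> ca where \<delta>: "0 < \<delta>" "\<delta> \<le> 1 / 8" "0 < ca"
    "\<And>(N :: 'w measure) S t v. driftless_subordinator N S \<phi> \<nu> \<Longrightarrow> 0 < t \<Longrightarrow> 0 < v \<Longrightarrow> v \<le> Rm \<Longrightarrow>
    t * \<phi> (2 / (\<delta> * v)) \<le> 1 \<Longrightarrow> ca * (t * w v) \<le> measure N {\<omega>\<in>space N. \<delta> * v < S t \<omega> \<and> S t \<omega> \<le> v}"
    by (fact prob_window_lower[where ?'w = 'w])
  obtain Cb where Cb: "0 < Cb" "\<And>(N :: 'w measure) S t. driftless_subordinator N S \<phi> \<nu> \<Longrightarrow> 0 < t \<Longrightarrow> t \<le> T \<Longrightarrow>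
    (\<integral>\<^sup>+\<omega>. ennreal (max 1 ((time_scale t / S t \<omega>) powr k)) \<partial>N) \<le> ennreal Cb"
    by (fact negative_moment[OF k T, where ?'w = 'w])
  obtain \<epsilon> cb where \<epsilon>: "0 < \<epsilon>" "\<epsilon> \<le> 1" "0 < cb" "\<And>(N :: 'w measure) S t. driftless_subordinator N S \<phi> \<nu> \<Longrightarrow> 0 < t \<Longrightarrow> t \<le> T \<Longrightarrow>
    cb \<le> measure N {\<omega>\<in>space N. \<epsilon> * time_scale t < S t \<omega> \<and> S t \<omega> \<le> 2 * time_scale t}"
    by (fact prob_near_scale[OF T, where ?'w = 'w])
  \<comment> \<open>For \<open>v \<ge> K s\<close> both arguments \<open>6 / v\<close> and \<open>2 / (\<delta> v)\<close> are at most \<open>1 / s\<close>, where \<open>t \<phi>\<close> equals \<open>1\<close>.\<close>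
  define K where "K = max 6 (2 / \<delta>)"
  define C where "C = max Ca Cb"
  define c where "c = min ca cb"
  show thesis
  proof (rule that[of \<epsilon> K \<delta> C c])
    fix N :: "'w measure" and S t
    assume N: "driftless_subordinator N S \<phi> \<nu>" and t: "0 < t" "t \<le> T"
    interpret driftless \<nu> \<phi> N S by unfold_locales (rule N)
    let ?s = "time_scale t" and ?\<mu> = "distr N borel (S t)"
    have s: "0 < ?s" using t by (intro time_scale_pos)
    have [measurable]: "S t \<in> borel_measurable N" using t by (intro value_measurable) simp
    have em: "emeasure ?\<mu> A = ennreal (prob {\<omega>\<in>space N. S t \<omega> \<in> A})" if "A \<in> sets borel" for A
      using that by (subst emeasure_distr) (auto simp: emeasure_eq_measure vimage_def Int_def conj_commute)
    have pos: "AE \<omega> in N. 0 < S t \<omega>"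
    proof -
      have "prob {\<omega>\<in>space N. S t \<omega> \<le> 0} \<le> e" if e: "0 < e" for e
      proof -
        obtain u where u: "0 < u" "(1 - ln e) / t < \<phi> u" using exponent_unbounded by blast
        have "prob {\<omega>\<in>space N. S t \<omega> \<le> 0} \<le> prob {\<omega>\<in>space N. S t \<omega> \<le> 1 / u}"
          using u by (intro finite_measure_mono) (auto intro: order_trans)
        also have "\<dots> \<le> exp (1 - t * \<phi> u)" using prob_small_upper[of t "1 / u"] u t by simp
        also have "\<dots> \<le> exp (ln e)" using u t by (simp add: field_simps)
        finally show ?thesis using e by simp
      qed
      then have "prob {\<omega>\<in>space N. S t \<omega> \<le> 0} = 0"
        by (meson dense_ge measure_nonneg order_antisym)
      then have "AE \<omega> in N. \<omega> \<notin> {\<omega>\<in>space N. S t \<omega> \<le> 0}"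
        by (intro AE_not_in) (simp add: null_sets_def emeasure_eq_measure)
      with AE_space show ?thesis by eventually_elim auto
    qed
    have scale: "t * \<phi> (a / v) \<le> 1" if "a * ?s \<le> v" "0 < a" for a v
    proof -
      have "0 < a * ?s" using that s by simp
      then have v: "0 < v" using that by linarith
      then have "a / v \<le> 1 / ?s" using that s by (simp add: field_simps)
      with v have "\<phi> (a / v) \<le> 1 / t" using exponent_mono[of "a / v" "1 / ?s"] exponent_time_scale[OF t(1)] that by simp
      then show ?thesis using t by (simp add: field_simps)
    qed
    have tw: "0 \<le> t * w v" for v using t tail_nonneg by simp
    show "law_bounds k \<epsilon> K \<delta> C c t ?\<mu>"
      unfolding law_bounds_def
    proof (intro conjI allI impI)
      show "prob_space ?\<mu>" by (rule prob_space_distr) simp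
      show "AE u in ?\<mu>. 0 < u" using pos by (subst AE_distr_iff) auto
      have "(\<integral>\<^sup>+u. ennreal (max 1 ((?s / u) powr k)) \<partial>?\<mu>) = (\<integral>\<^sup>+\<omega>. ennreal (max 1 ((?s / S t \<omega>) powr k)) \<partial>N)"
        by (intro nn_integral_distr) measurable
      also have "\<dots> \<le> ennreal Cb" using Cb(2)[OF N t] .
      also have "\<dots> \<le> ennreal C" by (intro ennreal_leI) (simp add: C_def)
      finally show "(\<integral>\<^sup>+u. ennreal (max 1 ((?s / u) powr k)) \<partial>?\<mu>) \<le> ennreal C" .
      have "c \<le> prob {\<omega>\<in>space N. \<epsilon> * ?s < S t \<omega> \<and> S t \<omega> \<le> 2 * ?s}" using \<epsilon>(4)[OF N t] by (simp add: c_def)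
      also have "\<dots> \<le> prob {\<omega>\<in>space N. S t \<omega> \<in> {\<epsilon> * ?s..2 * ?s}}" by (intro finite_measure_mono) auto
      finally show "ennreal c \<le> emeasure ?\<mu> {\<epsilon> * ?s..2 * ?s}" by (simp add: em ennreal_leI)
    next
      fix v assume v: "K * ?s \<le> v" "v \<le> Rm"
      have "6 * ?s \<le> K * ?s" "2 / \<delta> * ?s \<le> K * ?s"
        using s by (intro mult_right_mono; simp add: K_def)+
      then have 6: "6 * ?s \<le> v" "2 / \<delta> * ?s \<le> v" using v by auto
      then have v0: "0 < v" using s by simp
      have "prob {\<omega>\<in>space N. S t \<omega> \<in> {v<..}} \<le> Ca * (t * w v)"
        using Ca(2)[OF N t(1) v0 v(2) scale[OF 6(1)]] by simp
      also have "\<dots> \<le> C * (t * w v)" using tw by (intro mult_right_mono) (auto simp: C_def)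
      finally show "emeasure ?\<mu> {v<..} \<le> ennreal (C * (t * w v))" by (simp add: em ennreal_leI)
      have "2 / (\<delta> * v) = (2 / \<delta>) / v" by simp
      then have "t * \<phi> (2 / (\<delta> * v)) \<le> 1" using scale[OF 6(2)] \<delta> by simp
      then have "ca * (t * w v) \<le> prob {\<omega>\<in>space N. \<delta> * v < S t \<omega> \<and> S t \<omega> \<le> v}"
        using \<delta>(4)[OF N t(1) v0 v(2)] by simp
      also have "\<dots> \<le> prob {\<omega>\<in>space N. S t \<omega> \<in> {\<delta> * v..v}}" by (intro finite_measure_mono) auto
      finally have "ca * (t * w v) \<le> prob {\<omega>\<in>space N. S t \<omega> \<in> {\<delta> * v..v}}" .
      moreover have "c * (t * w v) \<le> ca * (t * w v)" using tw by (intro mult_right_mono) (auto simp: c_def)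
      ultimately show "ennreal (c * (t * w v)) \<le> emeasure ?\<mu> {\<delta> * v..v}" by (simp add: em ennreal_leI)
    qed auto
  qed (use \<epsilon> \<delta> Ca Cb in \<open>auto simp: K_def C_def c_def\<close>)
qed

end

section \<open>Integrals against the law of the subordinator\<close>

context poly_levy
begin

text \<open>
  A sufficiently high power of \<open>u / r\<close> makes the values \<open>u \<le> r\<close> negligible against one jump beyond
  \<open>r\<close>, since the tail grows at most like \<open>u powr - \<beta>2\<close> as \<open>u\<close> decreases.
\<close>

lemma truncated_moment:
  assumes law: "law_bounds k \<epsilon> K \<delta> C c t \<mu>" and t: "0 < t" and K: "0 < K" and C: "0 < C"
    and r: "K * time_scale t \<le> r" "r \<le> Rm" and n: "\<beta>2 < n"
  shows "(\<integral>\<^sup>+u. ennreal (min 1 ((u / r) powr n)) * indicator {K * time_scale t<..} u \<partial>\<mu>)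
    \<le> ennreal (2 powr n * C * c2 * (1 / (1 - (1 / 2) powr (n - \<beta>2))) * (t * w r))"
proof -
  have sets [measurable_cong]: "sets \<mu> = sets borel" using law by (simp add: law_bounds_def)
  let ?s = "time_scale t"
  have s: "0 < ?s" using t by (rule time_scale_pos)
  have Ks: "0 < K * ?s" using K s by simp
  have r0: "0 < r" using r Ks by linarith
  have n0: "0 < n" using n \<beta>1_pos \<beta>12 by linarith
  define q where "q = (1 / 2 :: real) powr (n - \<beta>2)"
  have q: "0 < q" "q < 1" using n by (auto simp: q_def powr01_less_one)
  define m where "m j = max (K * ?s) ((1 / 2) ^ j * r)" for j :: nat
  define b where "b j = 2 powr n * ((1 / 2) ^ j) powr n" for j :: nat
  have b0: "0 \<le> b j" for j by (simp add: b_def)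
  have point: "ennreal (min 1 ((u / r) powr n)) * indicator {K * ?s<..} u
      \<le> (\<Sum>j. ennreal (b j) * indicator {m j<..} u)" for u
  proof (cases "K * ?s < u")
    case True
    then have u: "0 < u" using Ks by linarith
    have "\<exists>j. min 1 ((u / r) powr n) \<le> b j \<and> m j < u"
    proof (cases "u \<le> r")
      case False
      have "1 \<le> b 0" using n0 by (auto simp: b_def intro!: ge_one_powr_ge_zero)
      then show ?thesis using False r True by (intro exI[of _ 0]) (auto simp: m_def)
    next
      case le: True
      have "0 < u / r" "u / r \<le> 1" using u le r0 by auto
      then obtain j where j: "u / r \<le> (1 / 2) ^ j" "(1 / 2) ^ Suc j < u / r" by (rule dyadic_level)
      have "(u / r) powr n \<le> ((1 / 2) ^ j) powr n" using j u r0 n0 by (intro powr_mono2) auto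
      also have "\<dots> = b (Suc j)" by (simp add: b_def powr_mult powr_divide)
      finally have "(u / r) powr n \<le> b (Suc j)" .
      moreover have "m (Suc j) < u" using j(2) True r0 by (auto simp: m_def field_simps)
      ultimately show ?thesis by (intro exI[of _ "Suc j"]) auto
    qed
    then obtain j where j: "min 1 ((u / r) powr n) \<le> b j" "m j < u" by blast
    have "ennreal (min 1 ((u / r) powr n)) * indicator {K * ?s<..} u \<le> ennreal (b j) * indicator {m j<..} u"
      using j True by (auto intro: ennreal_leI)
    also have "\<dots> \<le> (\<Sum>j. ennreal (b j) * indicator {m j<..} u)"
    proof -
      have "f j \<le> suminf f" for f :: "nat \<Rightarrow> ennreal"
        using sum_le_suminf[of f "{j}"] by simp
      then show ?thesis .
    qed
    finally show ?thesis .
  qed simp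
  have tail: "ennreal (b j) * emeasure \<mu> {m j<..} \<le> ennreal (2 powr n * C * c2 * (t * w r) * q ^ j)" for j
  proof -
    have m: "K * ?s \<le> m j" "m j \<le> r" "0 < m j" "(1 / 2) ^ j * r \<le> m j"
      using r Ks r0 by (auto simp: m_def mult_left_le_one_le power_le_one)
    have "emeasure \<mu> {m j<..} \<le> ennreal (C * (t * w (m j)))"
      using law m r unfolding law_bounds_def by auto
    also have "\<dots> \<le> ennreal (C * (t * (c2 * (2 ^ j) powr \<beta>2 * w r)))"
    proof (intro ennreal_leI mult_left_mono)
      have "w (m j) \<le> c2 * (r / m j) powr \<beta>2 * w r" using m r by (intro tail_upper) auto
      also have "\<dots> \<le> c2 * (2 ^ j) powr \<beta>2 * w r"
      proof (intro mult_right_mono mult_left_mono powr_mono2)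
        show "r / m j \<le> 2 ^ j" using m r0 by (simp add: field_simps power_one_over)
      qed (use c2_pos \<beta>1_pos \<beta>12 tail_nonneg m r0 in auto)
      finally show "w (m j) \<le> c2 * (2 ^ j) powr \<beta>2 * w r" .
    qed (use C t in auto)
    finally have "ennreal (b j) * emeasure \<mu> {m j<..} \<le> ennreal (b j) * ennreal (C * (t * (c2 * (2 ^ j) powr \<beta>2 * w r)))"
      by (rule mult_left_mono) simp
    also have "\<dots> = ennreal (b j * (C * (t * (c2 * (2 ^ j) powr \<beta>2 * w r))))"
      using b0 by (simp add: ennreal_mult')
    also have "b j * (C * (t * (c2 * (2 ^ j) powr \<beta>2 * w r))) = 2 powr n * C * c2 * (t * w r) * (((1 / 2) ^ j) powr n * (2 ^ j) powr \<beta>2)"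
      by (simp add: b_def mult_ac)
    also have "((1 / 2) ^ j) powr n * (2 ^ j) powr \<beta>2 = q ^ j"
    proof -
      have "(2 ^ j :: real) = 2 powr real j" "((1 / 2) ^ j :: real) = 2 powr (- real j)"
        by (simp_all add: powr_realpow powr_minus power_one_over inverse_eq_divide)
      then have "((1 / 2) ^ j) powr n * (2 ^ j) powr \<beta>2 = 2 powr (real j * (\<beta>2 - n))"
        by (simp add: powr_powr powr_add[symmetric] algebra_simps)
      moreover have "q = 2 powr (\<beta>2 - n)"
        by (simp add: q_def powr_divide powr_minus_divide[symmetric])
      ultimately show ?thesis by (simp add: powr_power mult.commute)
    qed
    finally show ?thesis .
  qed
  have X0: "0 \<le> 2 powr n * C * c2 * (t * w r)" using C c2_pos t tail_nonneg by simp
  have "(\<integral>\<^sup>+u. ennreal (min 1 ((u / r) powr n)) * indicator {K * ?s<..} u \<partial>\<mu>)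
      \<le> (\<integral>\<^sup>+u. (\<Sum>j. ennreal (b j) * indicator {m j<..} u) \<partial>\<mu>)"
    by (intro nn_integral_mono point)
  also have "\<dots> = (\<Sum>j. ennreal (b j) * emeasure \<mu> {m j<..})"
    by (subst nn_integral_suminf) (auto simp: nn_integral_cmult sets)
  also have "\<dots> \<le> (\<Sum>j. ennreal (2 powr n * C * c2 * (t * w r) * q ^ j))"
    by (intro suminf_le tail) auto
  also have "\<dots> = ennreal (\<Sum>j. 2 powr n * C * c2 * (t * w r) * q ^ j)"
    using X0 q by (intro suminf_ennreal2 summable_mult summable_geometric) auto
  also have "(\<Sum>j. 2 powr n * C * c2 * (t * w r) * q ^ j) = 2 powr n * C * c2 * (t * w r) * (1 / (1 - q))"
    using q by (subst suminf_mult) (auto intro!: summable_geometric simp: suminf_geometric)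
  finally show ?thesis by (simp add: q_def mult_ac)
qed

text \<open>
  For a non-increasing \<open>g\<close> and \<open>u > a\<close> one has \<open>u g(u) \<le> a g(a) + \<integral> g\<close> over \<open>[a, u]\<close>; the
  integral against the law of the subordinator is then a tail integral.
\<close>

lemma first_moment_upper:
  fixes g :: "real \<Rightarrow> real"
  assumes law: "law_bounds k \<epsilon> K \<delta> C c t \<mu>" and t: "0 < t" and K: "0 < K" and C: "0 < C"
    and b: "b \<le> Rm" and g: "antimono g" "\<And>u. 0 \<le> g u"
  shows "(\<integral>\<^sup>+u. ennreal (u * g u) * indicator {K * time_scale t<..b} u \<partial>\<mu>)
    \<le> ennreal (K * time_scale t * g (K * time_scale t)) +
      ennreal (C * t) * (\<integral>\<^sup>+v. ennreal (g v * w v) * indicator {K * time_scale t..b} v \<partial>lborel)"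
proof -
  interpret prob_space \<mu> using law by (simp add: law_bounds_def)
  have sets [measurable_cong]: "sets \<mu> = sets borel" using law by (simp add: law_bounds_def)
  interpret pair_sigma_finite lborel \<mu> ..
  let ?a = "K * time_scale t"
  have a: "0 < ?a" using K time_scale_pos[OF t] by simp
  have g_meas [measurable]: "g \<in> borel_measurable borel" by (rule antimono_measurable[OF g(1)])
  have point: "ennreal (u * g u) * indicator {?a<..b} u
     \<le> ennreal (?a * g ?a) + (\<integral>\<^sup>+v. ennreal (g v) * indicator {(v, u). ?a \<le> v \<and> v \<le> b \<and> v < u} (v, u) \<partial>lborel)" for u
  proof (cases "u \<in> {?a<..b}")
    case True
    then have u: "?a < u" "u \<le> b" by auto
    have "u * g u = ?a * g u + (u - ?a) * g u" by (simp add: algebra_simps)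
    also have "\<dots> \<le> ?a * g ?a + (u - ?a) * g u"
      using u a antimonoD[OF g(1), of ?a u] by (intro add_right_mono mult_left_mono) auto
    finally have le: "u * g u \<le> ?a * g ?a + (u - ?a) * g u" .
    have "ennreal (u * g u) \<le> ennreal (?a * g ?a) + ennreal ((u - ?a) * g u)"
    proof -
      have "ennreal (?a * g ?a + (u - ?a) * g u) = ennreal (?a * g ?a) + ennreal ((u - ?a) * g u)"
        using u a K time_scale_pos[OF t] g(2) by (intro ennreal_plus mult_nonneg_nonneg) auto
      with ennreal_leI[OF le] show ?thesis by simp
    qed
    also have "ennreal ((u - ?a) * g u) = (\<integral>\<^sup>+v. ennreal (g u) * indicator {?a..<u} v \<partial>lborel)"
      using u g(2) by (simp add: nn_integral_cmult ennreal_mult mult.commute)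
    also have "\<dots> \<le> (\<integral>\<^sup>+v. ennreal (g v) * indicator {(v, u). ?a \<le> v \<and> v \<le> b \<and> v < u} (v, u) \<partial>lborel)"
      using u antimonoD[OF g(1)] by (intro nn_integral_mono) (auto simp: indicator_def intro!: ennreal_leI)
    finally show ?thesis using True by (simp add: add_left_mono)
  qed simp
  have "(\<integral>\<^sup>+u. ennreal (u * g u) * indicator {?a<..b} u \<partial>\<mu>) \<le>
     (\<integral>\<^sup>+u. ennreal (?a * g ?a) + (\<integral>\<^sup>+v. ennreal (g v) * indicator {(v, u). ?a \<le> v \<and> v \<le> b \<and> v < u} (v, u) \<partial>lborel) \<partial>\<mu>)"
    by (intro nn_integral_mono point)
  also have "\<dots> = ennreal (?a * g ?a) + (\<integral>\<^sup>+u. (\<integral>\<^sup>+v. ennreal (g v) * indicator {(v, u). ?a \<le> v \<and> v \<le> b \<and> v < u} (v, u) \<partial>lborel) \<partial>\<mu>)"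
    by (subst nn_integral_add) (auto simp: emeasure_space_1)
  also have "(\<integral>\<^sup>+u. (\<integral>\<^sup>+v. ennreal (g v) * indicator {(v, u). ?a \<le> v \<and> v \<le> b \<and> v < u} (v, u) \<partial>lborel) \<partial>\<mu>)
      = (\<integral>\<^sup>+v. (\<integral>\<^sup>+u. ennreal (g v) * indicator {(v, u). ?a \<le> v \<and> v \<le> b \<and> v < u} (v, u) \<partial>\<mu>) \<partial>lborel)"
    by (intro Fubini') measurable
  also have "\<dots> \<le> (\<integral>\<^sup>+v. ennreal (C * t) * (ennreal (g v * w v) * indicator {?a..b} v) \<partial>lborel)"
  proof (intro nn_integral_mono)
    fix v :: real
    have "(\<integral>\<^sup>+u. ennreal (g v) * indicator {(v, u). ?a \<le> v \<and> v \<le> b \<and> v < u} (v, u) \<partial>\<mu>)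
        = (\<integral>\<^sup>+u. (ennreal (g v) * indicator {?a..b} v) * indicator {v<..} u \<partial>\<mu>)"
      by (intro nn_integral_cong) (auto simp: indicator_def)
    also have "\<dots> = (ennreal (g v) * indicator {?a..b} v) * emeasure \<mu> {v<..}"
      by (simp add: nn_integral_cmult sets)
    also have "\<dots> \<le> ennreal (C * t) * (ennreal (g v * w v) * indicator {?a..b} v)"
    proof (cases "v \<in> {?a..b}")
      case True
      then have "emeasure \<mu> {v<..} \<le> ennreal (C * (t * w v))" using law b unfolding law_bounds_def by auto
      then have "ennreal (g v) * emeasure \<mu> {v<..} \<le> ennreal (g v) * ennreal (C * (t * w v))" by (rule mult_left_mono) simp
      also have "\<dots> = ennreal (C * t) * ennreal (g v * w v)"
        using g(2) C t tail_nonneg by (simp add: ennreal_mult[symmetric] mult_ac)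
      finally show ?thesis using True by simp
    qed simp
    finally show "(\<integral>\<^sup>+u. ennreal (g v) * indicator {(v, u). ?a \<le> v \<and> v \<le> b \<and> v < u} (v, u) \<partial>\<mu>)
      \<le> ennreal (C * t) * (ennreal (g v * w v) * indicator {?a..b} v)" .
  qed
  also have "\<dots> = ennreal (C * t) * (\<integral>\<^sup>+v. ennreal (g v * w v) * indicator {?a..b} v \<partial>lborel)"
    by (intro nn_integral_cmult) measurable
  finally show ?thesis by (simp add: add_left_mono)
qed

text \<open>
  Conversely every \<open>v\<close> carries a window \<open>[\<delta> v, v]\<close> of probability at least \<open>t w(v)\<close>, and a value
  \<open>u\<close> lies in the windows of \<open>v \<in> [u, u / \<delta>]\<close>, a set of length at most \<open>u / \<delta>\<close> on which
  \<open>g(v) \<le> g(u)\<close>.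
\<close>

lemma first_moment_lower:
  fixes g :: "real \<Rightarrow> real"
  assumes law: "law_bounds k \<epsilon> K \<delta> C c t \<mu>" and t: "0 < t" and K: "0 < K" and c: "0 < c" and \<delta>: "0 < \<delta>"
    and b: "b \<le> Rm" and g: "antimono g" "\<And>u. 0 \<le> g u"
  shows "ennreal (c * t) * (\<integral>\<^sup>+v. ennreal (g v * w v) * indicator {K * time_scale t..b} v \<partial>lborel)
    \<le> ennreal (1 / \<delta>) * (\<integral>\<^sup>+u. ennreal (u * g u) * indicator {0<..b} u \<partial>\<mu>)"
proof -
  interpret prob_space \<mu> using law by (simp add: law_bounds_def)
  have sets [measurable_cong]: "sets \<mu> = sets borel" using law by (simp add: law_bounds_def)
  interpret pair_sigma_finite lborel \<mu> ..
  let ?a = "K * time_scale t"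
  have a: "0 < ?a" using K time_scale_pos[OF t] by simp
  have g_meas [measurable]: "g \<in> borel_measurable borel" by (rule antimono_measurable[OF g(1)])
  let ?W = "{(v, u). ?a \<le> v \<and> v \<le> b \<and> \<delta> * v \<le> u \<and> u \<le> v}"
  have "ennreal (c * t) * (\<integral>\<^sup>+v. ennreal (g v * w v) * indicator {?a..b} v \<partial>lborel)
      = (\<integral>\<^sup>+v. ennreal (c * t) * (ennreal (g v * w v) * indicator {?a..b} v) \<partial>lborel)"
    by (intro nn_integral_cmult[symmetric]) measurable
  also have "\<dots> \<le> (\<integral>\<^sup>+v. (\<integral>\<^sup>+u. ennreal (g v) * indicator ?W (v, u) \<partial>\<mu>) \<partial>lborel)"
  proof (intro nn_integral_mono)
    fix v :: real
    have "ennreal (c * t) * (ennreal (g v * w v) * indicator {?a..b} v)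
       \<le> (ennreal (g v) * indicator {?a..b} v) * emeasure \<mu> {\<delta> * v..v}"
    proof (cases "v \<in> {?a..b}")
      case True
      then have "ennreal (c * (t * w v)) \<le> emeasure \<mu> {\<delta> * v..v}" using law b unfolding law_bounds_def by auto
      then have "ennreal (g v) * ennreal (c * (t * w v)) \<le> ennreal (g v) * emeasure \<mu> {\<delta> * v..v}"
        by (rule mult_left_mono) simp
      moreover have "ennreal (c * t) * ennreal (g v * w v) = ennreal (g v) * ennreal (c * (t * w v))"
        using g(2) c t tail_nonneg by (simp add: ennreal_mult[symmetric] mult_ac)
      ultimately show ?thesis using True by simp
    qed simp
    also have "\<dots> = (\<integral>\<^sup>+u. (ennreal (g v) * indicator {?a..b} v) * indicator {\<delta> * v..v} u \<partial>\<mu>)"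
      by (simp add: nn_integral_cmult sets)
    also have "\<dots> = (\<integral>\<^sup>+u. ennreal (g v) * indicator ?W (v, u) \<partial>\<mu>)"
      by (intro nn_integral_cong) (auto simp: indicator_def)
    finally show "ennreal (c * t) * (ennreal (g v * w v) * indicator {?a..b} v)
      \<le> (\<integral>\<^sup>+u. ennreal (g v) * indicator ?W (v, u) \<partial>\<mu>)" .
  qed
  also have "\<dots> = (\<integral>\<^sup>+u. (\<integral>\<^sup>+v. ennreal (g v) * indicator ?W (v, u) \<partial>lborel) \<partial>\<mu>)"
    by (intro Fubini'[symmetric]) measurable
  also have "\<dots> \<le> (\<integral>\<^sup>+u. ennreal (1 / \<delta>) * (ennreal (u * g u) * indicator {0<..b} u) \<partial>\<mu>)"
  proof (intro nn_integral_mono)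
    fix u :: real
    show "(\<integral>\<^sup>+v. ennreal (g v) * indicator ?W (v, u) \<partial>lborel) \<le> ennreal (1 / \<delta>) * (ennreal (u * g u) * indicator {0<..b} u)"
    proof (cases "u \<in> {0<..b}")
      case True
      have "(\<integral>\<^sup>+v. ennreal (g v) * indicator ?W (v, u) \<partial>lborel) \<le> (\<integral>\<^sup>+v. ennreal (g u) * indicator {0..u / \<delta>} v \<partial>lborel)"
        using a \<delta> antimonoD[OF g(1)] True by (intro nn_integral_mono) (auto simp: indicator_def field_simps intro!: ennreal_leI)
      also have "\<dots> = ennreal (g u) * ennreal (u / \<delta>)" using True \<delta> by (simp add: nn_integral_cmult)
      also have "\<dots> = ennreal (1 / \<delta>) * ennreal (u * g u)"
        using True \<delta> g(2) by (simp add: ennreal_mult[symmetric] mult_ac)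
      finally show ?thesis using True by simp
    next
      case False
      have "\<not> (?a \<le> v \<and> v \<le> b \<and> \<delta> * v \<le> u \<and> u \<le> v)" for v
      proof
        assume v: "?a \<le> v \<and> v \<le> b \<and> \<delta> * v \<le> u \<and> u \<le> v"
        then have "0 < \<delta> * v" using a \<delta> by (intro mult_pos_pos) auto
        then show False using v False by auto
      qed
      then have "indicator ?W (v, u) = (0 :: ennreal)" for v by (simp add: indicator_def)
      then show ?thesis by simp
    qed
  qed
  also have "\<dots> = ennreal (1 / \<delta>) * (\<integral>\<^sup>+u. ennreal (u * g u) * indicator {0<..b} u \<partial>\<mu>)"
    by (intro nn_integral_cmult) measurable
  finally show ?thesis .
qed

end

section \<open>Scale functions and volumes\<close>

locale scale_function =
  fixes \<Phi> :: "real \<Rightarrow> real"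
  assumes nonneg: "\<And>r. 0 \<le> r \<Longrightarrow> 0 \<le> \<Phi> r"
    and strict: "strict_mono_on {0..} \<Phi>"
    and scaling: "power_scaling \<Phi>"
begin

lemma scale_less_iff: "0 \<le> r \<Longrightarrow> 0 \<le> R \<Longrightarrow> \<Phi> r < \<Phi> R \<longleftrightarrow> r < R"
  using strict by (simp add: strict_mono_on_less)

lemma scale_pos: "0 < r \<Longrightarrow> 0 < \<Phi> r"
  using scale_less_iff[of 0 r] nonneg[of 0] by simp

lemma scale_small: assumes "0 < u" obtains r where "0 < r" "\<Phi> r \<le> u"
proof -
  obtain a1 a2 c1 c2 where a: "0 < a1" "0 < c1" and
    sc: "\<And>r R. 0 < r \<Longrightarrow> r \<le> R \<Longrightarrow> c1 * (R / r) powr a1 \<le> \<Phi> R / \<Phi> r \<and> \<Phi> R / \<Phi> r \<le> c2 * (R / r) powr a2"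
    using scaling unfolding power_scaling_def by metis
  define b where "b = max 1 ((\<Phi> 1 / (c1 * u)) powr (1 / a1))"
  have "\<Phi> 1 / (c1 * u) = ((\<Phi> 1 / (c1 * u)) powr (1 / a1)) powr a1"
    using a assms scale_pos[of 1] by (simp add: powr_powr)
  also have "\<dots> \<le> b powr a1" using a by (intro powr_mono2) (auto simp: b_def)
  finally have "\<Phi> 1 \<le> c1 * b powr a1 * u" using a assms by (simp add: field_simps)
  moreover have "c1 * b powr a1 \<le> \<Phi> 1 / \<Phi> (1 / b)" using sc[of "1 / b" 1] by (auto simp: b_def)
  moreover have "0 < \<Phi> (1 / b)" by (intro scale_pos) (auto simp: b_def)
  ultimately have "c1 * b powr a1 * \<Phi> (1 / b) \<le> c1 * b powr a1 * u" by (simp add: field_simps)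
  moreover have "0 < c1 * b powr a1" using a by (auto simp: b_def)
  ultimately have "\<Phi> (1 / b) \<le> u" by (simp only: mult_le_cancel_left_pos)
  then show thesis by (intro that[of "1 / b"]) (auto simp: b_def)
qed

lemma scale_large: obtains r where "0 < r" "u < \<Phi> r"
proof -
  obtain a1 a2 c1 c2 where a: "0 < a1" "0 < c1" and
    sc: "\<And>r R. 0 < r \<Longrightarrow> r \<le> R \<Longrightarrow> c1 * (R / r) powr a1 \<le> \<Phi> R / \<Phi> r \<and> \<Phi> R / \<Phi> r \<le> c2 * (R / r) powr a2"
    using scaling unfolding power_scaling_def by metis
  have p1: "0 < \<Phi> 1" by (rule scale_pos) simp
  define v where "v = max 1 (u + 1)"
  define b where "b = max 1 ((v / (c1 * \<Phi> 1)) powr (1 / a1))"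
  have "v / (c1 * \<Phi> 1) = ((v / (c1 * \<Phi> 1)) powr (1 / a1)) powr a1"
    using a p1 by (simp add: powr_powr v_def)
  also have "\<dots> \<le> b powr a1" using a by (intro powr_mono2) (auto simp: b_def)
  finally have "v \<le> c1 * b powr a1 * \<Phi> 1" using a p1 by (simp add: field_simps)
  also have "\<dots> \<le> \<Phi> b" using sc[of 1 b] p1 by (auto simp: b_def field_simps)
  finally have "u < \<Phi> b" by (simp add: v_def)
  then show thesis by (intro that[of b]) (auto simp: b_def)
qed

lemma scale_zero: "\<Phi> 0 = 0"
proof (rule ccontr)
  assume "\<Phi> 0 \<noteq> 0"
  then have "0 < \<Phi> 0" using nonneg[of 0] by simp
  then obtain r where "0 < r" "\<Phi> r \<le> \<Phi> 0" by (rule scale_small)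
  then show False using scale_less_iff[of 0 r] by simp
qed

lemma rinv_set: "{r. 0 \<le> r \<and> u < \<Phi> r} \<noteq> {}" "bdd_below {r. 0 \<le> r \<and> u < \<Phi> r}"
proof -
  obtain r where "0 < r" "u < \<Phi> r" by (rule scale_large)
  then show "{r. 0 \<le> r \<and> u < \<Phi> r} \<noteq> {}" by (auto intro!: exI[of _ r])
  show "bdd_below {r. 0 \<le> r \<and> u < \<Phi> r}" by (rule bdd_belowI[of _ 0]) simp
qed

lemma rinv_gt: assumes "rinv \<Phi> u < b" shows "u < \<Phi> b"
proof -
  obtain r where r: "0 \<le> r" "u < \<Phi> r" "r < b"
    using assms cInf_lessD[OF rinv_set(1)] unfolding rinv_def by blast
  then have "\<Phi> r < \<Phi> b" using scale_less_iff[of r b] by simp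
  then show ?thesis using r by simp
qed

lemma rinv_le: assumes "0 \<le> a" "a < rinv \<Phi> u" shows "\<Phi> a \<le> u"
proof (rule ccontr)
  assume "\<not> \<Phi> a \<le> u"
  then have "rinv \<Phi> u \<le> a" unfolding rinv_def using assms by (intro cInf_lower rinv_set) auto
  then show False using assms by simp
qed

lemma rinv_pos: assumes "0 < u" shows "0 < rinv \<Phi> u"
proof -
  obtain r where r: "0 < r" "\<Phi> r \<le> u" using scale_small[OF assms] .
  have "r \<le> rinv \<Phi> u"
    unfolding rinv_def
  proof (rule cInf_greatest[OF rinv_set(1)])
    fix v assume "v \<in> {r. 0 \<le> r \<and> u < \<Phi> r}"
    then have "\<Phi> r < \<Phi> v" "0 \<le> v" using r by auto
    then show "r \<le> v" using scale_less_iff[of r v] r by simp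
  qed
  then show ?thesis using r by simp
qed

lemma rinv_scale: "0 \<le> r \<Longrightarrow> rinv \<Phi> (\<Phi> r) = r"
  using rinv_eq_inverse[OF strict] .

lemma rinv_mono: assumes "0 < u" "u \<le> v" shows "rinv \<Phi> u \<le> rinv \<Phi> v"
proof (rule ccontr)
  assume "\<not> rinv \<Phi> u \<le> rinv \<Phi> v"
  then obtain a where a: "rinv \<Phi> v < a" "a < rinv \<Phi> u" using dense not_le by metis
  then show False using rinv_gt[OF a(1)] rinv_le[of a u] rinv_pos[of v] assms by simp
qed

text \<open>
  The scale function need not be continuous. Radii slightly below and above \<open>rinv \<Phi> u\<close> have
  scales at most and above \<open>u\<close>, so the scaling of the inverse follows from that of \<open>\<Phi>\<close> by a limit.
\<close>

lemma rinv_scaling: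
  obtains k1 k2 c C where "0 < k1" "0 < k2" "0 < c" "0 < C"
    "\<And>u v. 0 < u \<Longrightarrow> u \<le> v \<Longrightarrow> c * (v / u) powr k1 * rinv \<Phi> u \<le> rinv \<Phi> v"
    "\<And>u v. 0 < u \<Longrightarrow> u \<le> v \<Longrightarrow> rinv \<Phi> v \<le> C * (v / u) powr k2 * rinv \<Phi> u"
proof -
  obtain a1 a2 c1 c2 where a: "0 < a1" "0 < a2" "0 < c1" "0 < c2" and
    sc: "\<And>r R. 0 < r \<Longrightarrow> r \<le> R \<Longrightarrow> c1 * (R / r) powr a1 \<le> \<Phi> R / \<Phi> r \<and> \<Phi> R / \<Phi> r \<le> c2 * (R / r) powr a2"
    using scaling unfolding power_scaling_def by metis
  define C where "C = max 1 ((1 / c1) powr (1 / a1))"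
  define c where "c = (1 / c2) powr (1 / a2)"
  show thesis
  proof (rule that[of "1 / a2" "1 / a1" c C])
    fix u v :: real assume uv: "0 < u" "u \<le> v"
    have pos: "0 < rinv \<Phi> u" "0 < rinv \<Phi> v" using uv rinv_pos by auto
    have vu: "1 \<le> v / u" using uv by simp
    show "rinv \<Phi> v \<le> C * (v / u) powr (1 / a1) * rinv \<Phi> u"
    proof (rule field_le_mult_one_interval)
      fix z :: real assume z: "0 < z" "z < 1"
      have "z * (rinv \<Phi> v) \<le> C * (v / u) powr (1 / a1) * b" if b: "rinv \<Phi> u < b" for b
      proof (cases "b \<le> z * rinv \<Phi> v")
        case True
        have b0: "0 < b" using b pos by simp
        let ?x = "z * rinv \<Phi> v / b"
        have "c1 * ?x powr a1 \<le> \<Phi> (z * rinv \<Phi> v) / \<Phi> b" using sc[OF b0 True] by simp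
        also have "\<dots> \<le> v / u"
        proof (rule frac_le)
          show "\<Phi> (z * rinv \<Phi> v) \<le> v" using z pos by (intro rinv_le) auto
          show "u \<le> \<Phi> b" using rinv_gt[OF b] by simp
        qed (use uv in auto)
        finally have "1 / c1 * (c1 * ?x powr a1) \<le> 1 / c1 * (v / u)" using a by (intro mult_left_mono) auto
        then have "?x powr a1 \<le> 1 / c1 * (v / u)" using a by simp
        then have "(?x powr a1) powr (1 / a1) \<le> (1 / c1 * (v / u)) powr (1 / a1)"
          using a by (intro powr_mono2) auto
        also have "(?x powr a1) powr (1 / a1) = ?x" using a z pos b0 by (simp add: powr_powr)
        also have "(1 / c1 * (v / u)) powr (1 / a1) = (1 / c1) powr (1 / a1) * (v / u) powr (1 / a1)"
          using a uv by (intro powr_mult) 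
        also have "\<dots> \<le> C * (v / u) powr (1 / a1)" by (intro mult_right_mono) (auto simp: C_def)
        finally show ?thesis using b0 by (simp add: pos_divide_le_eq)
      next
        case False
        have "1 \<le> (v / u) powr (1 / a1)" using vu a by (intro ge_one_powr_ge_zero) auto
        then have "1 \<le> C * (v / u) powr (1 / a1)" using mult_mono[of 1 C 1 "(v / u) powr (1 / a1)"] by (simp add: C_def)
        then have "1 * b \<le> C * (v / u) powr (1 / a1) * b" using b pos by (intro mult_right_mono) auto
        then show ?thesis using False by linarith
      qed
      then have "z * rinv \<Phi> v / (C * (v / u) powr (1 / a1)) \<le> b" if "rinv \<Phi> u < b" for b
        using that uv by (simp add: pos_divide_le_eq C_def mult.commute)
      then have "z * rinv \<Phi> v / (C * (v / u) powr (1 / a1)) \<le> rinv \<Phi> u" by (rule dense_ge)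
      then show "z * rinv \<Phi> v \<le> C * (v / u) powr (1 / a1) * rinv \<Phi> u"
        using uv by (simp add: pos_divide_le_eq C_def mult.commute)
    qed
    show "c * (v / u) powr (1 / a2) * rinv \<Phi> u \<le> rinv \<Phi> v"
    proof (rule field_le_mult_one_interval)
      fix z :: real assume z: "0 < z" "z < 1"
      have "z * (c * (v / u) powr (1 / a2) * rinv \<Phi> u) \<le> b" if b: "rinv \<Phi> v < b" for b
      proof -
        have le: "z * rinv \<Phi> u \<le> b" using b z pos rinv_mono[OF uv] mult_le_cancel_right1[of z "rinv \<Phi> u"]
          by (smt (verit) mult_left_le_one_le)
        have zp: "0 < z * rinv \<Phi> u" using z pos by simp
        let ?x = "b / (z * rinv \<Phi> u)"
        have "v / u \<le> \<Phi> b / \<Phi> (z * rinv \<Phi> u)"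
        proof (rule frac_le)
          show "\<Phi> (z * rinv \<Phi> u) \<le> u" using z pos by (intro rinv_le) auto
          show "v \<le> \<Phi> b" using rinv_gt[OF b] by simp
          show "0 < \<Phi> (z * rinv \<Phi> u)" using zp by (rule scale_pos)
          show "0 \<le> \<Phi> b" using b pos by (intro nonneg) simp
        qed
        also have "\<dots> \<le> c2 * ?x powr a2" using sc[OF zp le] by simp
        finally have "1 / c2 * (v / u) \<le> 1 / c2 * (c2 * ?x powr a2)" using a by (intro mult_left_mono) auto
        then have "1 / c2 * (v / u) \<le> ?x powr a2" using a by simp
        then have "(1 / c2 * (v / u)) powr (1 / a2) \<le> (?x powr a2) powr (1 / a2)"
          using a uv by (intro powr_mono2) auto
        also have "(?x powr a2) powr (1 / a2) = ?x" using a zp le by (simp add: powr_powr)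
        also have "(1 / c2 * (v / u)) powr (1 / a2) = c * (v / u) powr (1 / a2)"
          unfolding c_def using a uv by (intro powr_mult)
        finally have "c * (v / u) powr (1 / a2) * (z * rinv \<Phi> u) \<le> b" using zp by (simp add: pos_le_divide_eq)
        then show ?thesis by (simp add: mult_ac)
      qed
      then show "z * (c * (v / u) powr (1 / a2) * rinv \<Phi> u) \<le> rinv \<Phi> v" by (rule dense_ge)
    qed
  qed (use a in \<open>auto simp: c_def C_def\<close>)
qed

end

lemma volume_growth_bounded:
  fixes m :: "'a::metric_space measure"
  assumes "volume_growth m"
  obtains d1 d2 where "0 < d1" "0 < d2"
    "\<And>M. \<exists>C\<ge>1. \<forall>x r R. 0 < r \<longrightarrow> r \<le> R \<longrightarrow> R \<le> M \<longrightarrow> 0 < vol m x r \<and>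
      (R / r) powr d1 * vol m x r \<le> C * vol m x R \<and> vol m x R \<le> C * (R / r) powr d2 * vol m x r"
proof -
  obtain R_E d1 d2 where d: "(0::ereal) < R_E" "0 < d1" "d1 \<le> d2" and
    growth: "\<And>a. 1 \<le> a \<Longrightarrow> \<exists>C\<ge>1. \<forall>x r R. 0 < r \<longrightarrow> r \<le> R \<longrightarrow> ereal R < ereal a * R_E \<longrightarrow>
          inverse C * (R / r) powr d1 \<le> vol m x R / vol m x r \<and>
          vol m x R / vol m x r \<le> C * (R / r) powr d2"
    using assms unfolding volume_growth_def by metis
  show thesis
  proof (rule that[of d1 d2])
    fix M
    obtain a where a: "1 \<le> a" "ereal M < ereal a * R_E"
    proof (cases R_E)
      case (real b)
      then have "0 < b" using d by simp
      then show thesis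
        using that[of "max 1 (M / b + 1)"] real by (auto simp: max_def field_simps)
    next
      case PInf
      then show thesis using that[of 1] by simp
    qed (use d in auto)
    obtain C where C: "1 \<le> C" and CV: "\<And>x r R. 0 < r \<Longrightarrow> r \<le> R \<Longrightarrow> ereal R < ereal a * R_E \<Longrightarrow>
          inverse C * (R / r) powr d1 \<le> vol m x R / vol m x r \<and>
          vol m x R / vol m x r \<le> C * (R / r) powr d2"
      using growth[OF a(1)] by blast
    have less: "ereal R < ereal a * R_E" if "R \<le> M" for R
      using that a(2) by (meson ereal_less_eq(3) order.strict_trans1)
    have pos: "0 < vol m x r" if "0 < r" "r \<le> M" for x r
    proof -
      have "0 < inverse C * (r / r) powr d1" using C that by simp
      also have "\<dots> \<le> vol m x r / vol m x r" using CV[of r r x] less that by simp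
      finally have "vol m x r \<noteq> 0" by auto
      then show ?thesis by (simp add: vol_def zero_less_measure_iff)
    qed
    show "\<exists>C\<ge>1. \<forall>x r R. 0 < r \<longrightarrow> r \<le> R \<longrightarrow> R \<le> M \<longrightarrow> 0 < vol m x r \<and>
      (R / r) powr d1 * vol m x r \<le> C * vol m x R \<and> vol m x R \<le> C * (R / r) powr d2 * vol m x r"
    proof (intro exI[of _ C] conjI C allI impI)
      fix x r R assume r: "0 < r" "r \<le> R" "R \<le> M"
      show v: "0 < vol m x r" using pos r by auto
      show "(R / r) powr d1 * vol m x r \<le> C * vol m x R" "vol m x R \<le> C * (R / r) powr d2 * vol m x r"
        using CV[OF r(1,2) less[OF r(3)], of x] C v by (auto simp: field_simps)
    qed
  qed (use d in auto)
qed

text \<open>Volume growth excludes isolated points, so that the open set has positive diameter.\<close>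

lemma diameter_pos:
  fixes m :: "'a::metric_space measure" and D :: "'a set"
  assumes vg: "volume_growth m" and D: "open D" "x \<in> D" "bounded D"
  shows "0 < diameter D"
proof (rule ccontr)
  assume "\<not> 0 < diameter D"
  then have "y = x" if "y \<in> D" for y
    using diameter_bounded_bound[OF D(3) that D(2)] by (metis dist_le_zero_iff not_less order_trans)
  then have Dx: "D = {x}" using D by blast
  obtain e where e: "0 < e" "ball x e \<subseteq> D" using D by (meson openE)
  obtain d1 d2 where d1: "0 < d1" and
    growth: "\<And>M. \<exists>C\<ge>1. \<forall>x r R. 0 < r \<longrightarrow> r \<le> R \<longrightarrow> R \<le> M \<longrightarrow> 0 < vol m x r \<and>
      (R / r) powr d1 * vol m x r \<le> C * vol m x R \<and> vol m x R \<le> C * (R / r) powr d2 * vol m x r"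
    using volume_growth_bounded[OF vg] by metis
  obtain C where C: "1 \<le> C" and pos: "\<And>x r. 0 < r \<Longrightarrow> r \<le> e \<Longrightarrow> 0 < vol m x r"
    and low: "\<And>x r R. 0 < r \<Longrightarrow> r \<le> R \<Longrightarrow> R \<le> e \<Longrightarrow> (R / r) powr d1 * vol m x r \<le> C * vol m x R"
    using growth[of e] by (meson order_refl)
  have ball: "ball x r = {x}" if "0 < r" "r \<le> e" for r using that e Dx by (auto simp: subset_iff)
  define b where "b = (C + 1) powr (1 / d1)"
  have b: "1 \<le> b" "b powr d1 = C + 1" using C d1 by (auto simp: b_def powr_powr intro!: ge_one_powr_ge_zero)
  have eb: "e / b \<le> e" "0 < e / b" using b e by (auto simp: field_simps)
  have "(e / (e / b)) powr d1 * vol m x (e / b) \<le> C * vol m x e" using low[OF eb(2,1)] by simp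
  then have "(C + 1) * vol m x e \<le> C * vol m x e"
    using e b eb ball[of e] ball[of "e / b"] by (simp add: vol_def)
  then show False using pos[of e x] e by (simp add: algebra_simps)
qed

text \<open>
  A ball of radius \<open>M\<close> centred in \<open>D\<close> lies in the ball of radius \<open>M + diameter D\<close> around every other point
  of \<open>D\<close>.
\<close>

lemma volume_uniform:
  fixes m :: "'a::metric_space measure"
  assumes vg: "volume_growth m" and sets [measurable_cong]: "sets m = sets borel" and D: "bounded D" and M: "0 < M"
  obtains a b where "0 < a" "0 < b" "\<And>x. x \<in> D \<Longrightarrow> a \<le> vol m x M" "\<And>x. x \<in> D \<Longrightarrow> vol m x M \<le> b"
proof (cases "D = {}")
  case True
  then show thesis using that[of 1 1] by simp
next
  case False
  then obtain x0 where x0: "x0 \<in> D" by blast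
  define M' where "M' = M + diameter D"
  have M': "M \<le> M'" using D by (simp add: M'_def diameter_ge_0)
  obtain d1 d2 where
    growth: "\<And>M. \<exists>C\<ge>1. \<forall>x r R. 0 < r \<longrightarrow> r \<le> R \<longrightarrow> R \<le> M \<longrightarrow> 0 < vol m x r \<and>
      (R / r) powr d1 * vol m x r \<le> C * vol m x R \<and> vol m x R \<le> C * (R / r) powr d2 * vol m x r"
    using volume_growth_bounded[OF vg] by metis
  obtain C where C: "1 \<le> C" and pos: "\<And>x r. 0 < r \<Longrightarrow> r \<le> M' \<Longrightarrow> 0 < vol m x r"
    and up: "\<And>x r R. 0 < r \<Longrightarrow> r \<le> R \<Longrightarrow> R \<le> M' \<Longrightarrow> vol m x R \<le> C * (R / r) powr d2 * vol m x r"
    using growth[of M'] by (meson order_refl)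
  have mono: "vol m x M \<le> vol m y M'" if "x \<in> D" "y \<in> D" for x y
  proof -
    have fin: "emeasure m (ball y M') \<noteq> \<infinity>"
      using pos[of M' y] M M' by (auto simp: vol_def measure_def)
    have "dist x y \<le> diameter D" using diameter_bounded_bound[OF D that] .
    then have "ball x M \<subseteq> ball y M'" by (auto simp: M'_def) (smt (verit) dist_commute dist_triangle)
    then show ?thesis
      unfolding vol_def using fin by (intro measure_mono_fmeasurable) (auto simp: fmeasurable_def sets less_top)
  qed
  define k where "k = C * (M' / M) powr d2"
  have k: "0 < k" using C M M' by (simp add: k_def)
  show thesis
  proof (rule that[of "vol m x0 M / k" "vol m x0 M'"])
    show "0 < vol m x0 M / k" "0 < vol m x0 M'" using pos[of M x0] pos[of M' x0] k M M' by auto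
    fix x assume x: "x \<in> D"
    show "vol m x M \<le> vol m x0 M'" using mono[OF x x0] .
    have "vol m x0 M \<le> k * vol m x M" using mono[OF x0 x] up[of M M' x] M M' by (simp add: k_def)
    then show "vol m x0 M / k \<le> vol m x M" using k by (simp add: field_simps)
  qed
qed

section \<open>Integrating a heat kernel against the law of the subordinator\<close>

text \<open>
  The constants collected here depend on the space, the process and the time horizon, but not on
  \<open>t\<close>, \<open>x\<close> and \<open>y\<close>: \<open>k1\<close>, \<open>k2\<close>, \<open>e1\<close>, \<open>e2\<close> belong to the scaling of \<open>rinv \<Phi>\<close>; \<open>\<gamma>\<close> and \<open>Cg\<close> to the doubling of
  the boundary function; \<open>\<kappa>\<close>, \<open>CW\<close>, \<open>Wmax\<close> to the growth of volumes of scales up to \<open>M1\<close>; \<open>k\<close>, \<open>\<epsilon>\<close>, \<open>K\<close>, \<open>\<delta>\<close>,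
  \<open>C\<close>, \<open>c\<close> to the law of the subordinator; \<open>a1\<close> to \<open>a4\<close> to the heat kernel. The condition on \<open>k\<close> says that
  the negative moments absorb the growth of boundary function and volume at small times, and \<open>Kb\<close> that
  the Gaussian factor absorbs the same growth together with a power higher than \<open>\<beta>2\<close>.
\<close>

locale subordination_constants = poly_levy \<nu> \<phi> Rm c1 c2 \<beta>1 \<beta>2 + scale_function \<Phi>
  for \<nu> \<phi> Rm c1 c2 \<beta>1 \<beta>2 \<Phi> +
  fixes k1 k2 e1 e2 \<gamma> Cg \<kappa> CW Wmax M1 k \<epsilon> K \<delta> C c a1 a2 a3 a4 C0 Kb :: real
  assumes k12: "0 < k1" "0 < k2" and e12: "0 < e1" "0 < e2"
    and rinv_lower: "\<And>u v. 0 < u \<Longrightarrow> u \<le> v \<Longrightarrow> e1 * (v / u) powr k1 * rinv \<Phi> u \<le> rinv \<Phi> v"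
    and rinv_upper: "\<And>u v. 0 < u \<Longrightarrow> u \<le> v \<Longrightarrow> rinv \<Phi> v \<le> e2 * (v / u) powr k2 * rinv \<Phi> u"
    and exponents: "0 \<le> \<gamma>" "0 \<le> \<kappa>" "\<gamma> + \<kappa> \<le> k"
    and Cg: "1 \<le> Cg" and CW: "1 \<le> CW" and Wmax: "0 < Wmax"
    and law_constants: "0 < \<epsilon>" "\<epsilon> \<le> 1" "2 \<le> K" "0 < \<delta>" "\<delta> \<le> 1" "0 < C" "0 < c"
    and kernel_constants: "0 < a1" "0 < a2" "0 < a3" "0 < a4"
    and C0: "0 \<le> C0" "C0 \<le> 1"
    and gaussian_decay: "0 < Kb"
      "\<And>x. 1 \<le> x \<Longrightarrow> x powr ((\<gamma> + \<kappa> + (\<beta>2 + 1)) / (2 * k1)) * exp (- (a4 * e1\<^sup>2) * x) \<le> Kb"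
begin

text \<open>
  In \<open>kernel_at t \<mu> g W \<rho> z p\<close> the pair of points is fixed: \<open>\<mu>\<close> is the law of the subordinator at
  time \<open>t\<close>, \<open>g u\<close> is the boundary function at time \<open>u\<close>, \<open>W u\<close> the volume of the ball of scale
  \<open>u\<close>, \<open>\<rho>\<close> the distance of the points, \<open>z\<close> the value of the jump scale at \<open>\<rho>\<close>, and \<open>p u\<close> the heat
  kernel at time \<open>u\<close>. All constants belong to the locale, which makes the estimates uniform.
\<close>

definition kernel_at :: "real \<Rightarrow> real measure \<Rightarrow> (real \<Rightarrow> real) \<Rightarrow> (real \<Rightarrow> real) \<Rightarrow> real \<Rightarrow> real \<Rightarrow> (real \<Rightarrow> ennreal) \<Rightarrow> bool" where
  "kernel_at t \<mu> g W \<rho> z p \<longleftrightarrow>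
    0 < t \<and> K * time_scale t \<le> M1 \<and> law_bounds k \<epsilon> K \<delta> C c t \<mu> \<and>
    antimono g \<and> (\<forall>u. 0 \<le> g u) \<and>
    (\<forall>u v. 0 < u \<longrightarrow> u \<le> v \<longrightarrow> u powr \<gamma> * g u \<le> Cg * (v powr \<gamma> * g v)) \<and>
    (\<forall>u. 0 < u \<longrightarrow> u \<le> M1 \<longrightarrow> 0 < W u \<and> W u \<le> Wmax) \<and>
    (\<forall>u v. 0 < u \<longrightarrow> u \<le> v \<longrightarrow> v \<le> M1 \<longrightarrow> W u \<le> CW * W v \<and> W v \<le> CW * (v / u) powr \<kappa> * W u) \<and>
    0 \<le> \<rho> \<and> 4 * \<Phi> \<rho> \<le> Rm \<and> 4 * \<Phi> \<rho> \<le> M1 \<and> \<Phi> \<rho> \<le> z \<and>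
    (\<forall>u. 0 < u \<longrightarrow> u \<le> M1 \<longrightarrow>
      p u \<le> ennreal (a3 * (g u / W u)) \<and>
      ennreal (a1 * (g u / W u) * exp (- a2 * (\<rho> / rinv \<Phi> u)\<^sup>2)) \<le> p u) \<and>
    (\<forall>u. 0 < u \<longrightarrow> u \<le> M1 \<longrightarrow> 0 < \<rho> \<longrightarrow>
      p u \<le> ennreal (a3 * (C0 * (u * g u) / (W (\<Phi> \<rho>) * z) + g u / W u * exp (- a4 * (\<rho> / rinv \<Phi> u)\<^sup>2))) \<and>
      ennreal (a1 * g u * min (1 / W u) (C0 * u / (W (\<Phi> \<rho>) * z))) \<le> p u) \<and>
    (\<forall>u>M1. p u \<le> ennreal (a3 * g u))"

text \<open>
  \<open>ratio_below\<close> and \<open>ratio_above\<close> compare the radii of scale \<open>u\<close> and \<open>s\<close> for \<open>u \<ge> \<epsilon> s\<close> and for \<open>u \<le> K s\<close>; they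
  determine the Gaussian exponents at time \<open>s\<close> from those of the heat kernel.
\<close>

definition "ratio_below = 1 / e1 + e2 * (1 / \<epsilon>) powr k2"
definition "ratio_above = 1 / e1 + e2 * K powr k2"
definition "lower_exponent = a2 * ratio_below\<^sup>2"
definition "upper_exponent = a4 / ratio_above\<^sup>2"
definition "lower_factor = a1 / (Cg * 2 powr \<gamma> * (CW * 2 powr \<kappa>))"
definition "near_factor = Cg * CW + CW"

lemma ratio_pos: "0 < ratio_below" "0 < ratio_above"
  using e12 law_constants by (auto simp: ratio_below_def ratio_above_def intro!: add_pos_pos)

lemma lower_exponent_pos: "0 < lower_exponent" and upper_exponent_pos: "0 < upper_exponent"
  using ratio_pos kernel_constants by (auto simp: lower_exponent_def upper_exponent_def)

lemma lower_factor_pos: "0 < lower_factor"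
  using Cg CW kernel_constants by (auto simp: lower_factor_def)

lemma near_factor_ge: "1 \<le> near_factor"
  using Cg CW mult_mono[of 1 Cg 1 CW] by (auto simp: near_factor_def)

lemma rinv_le_below: assumes "0 < s" "\<epsilon> * s \<le> u" shows "rinv \<Phi> s \<le> ratio_below * rinv \<Phi> u"
proof -
  have u: "0 < u" using assms law_constants by (meson mult_pos_pos order.strict_trans2)
  have pos: "0 < rinv \<Phi> s" "0 < rinv \<Phi> u" using u assms by (auto intro: rinv_pos)
  show ?thesis
  proof (cases "s \<le> u")
    case True
    have "e1 * 1 * rinv \<Phi> s \<le> e1 * (u / s) powr k1 * rinv \<Phi> s"
      using e12 pos True assms k12 by (intro mult_right_mono mult_left_mono ge_one_powr_ge_zero) auto
    also have "\<dots> \<le> rinv \<Phi> u" using rinv_lower[of s u] True assms by simp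
    finally have "rinv \<Phi> s \<le> 1 / e1 * rinv \<Phi> u" using e12 by (simp add: field_simps)
    also have "\<dots> \<le> ratio_below * rinv \<Phi> u" using pos e12 by (intro mult_right_mono) (auto simp: ratio_below_def)
    finally show ?thesis .
  next
    case False
    have "rinv \<Phi> s \<le> e2 * (s / u) powr k2 * rinv \<Phi> u" using rinv_upper[of u s] False u by simp
    also have "\<dots> \<le> e2 * (1 / \<epsilon>) powr k2 * rinv \<Phi> u"
      using e12 pos u assms law_constants k12
      by (intro mult_right_mono mult_left_mono powr_mono2) (auto simp: field_simps)
    also have "\<dots> \<le> ratio_below * rinv \<Phi> u" using pos e12 by (intro mult_right_mono) (auto simp: ratio_below_def)
    finally show ?thesis .
  qed
qed

lemma rinv_le_above: assumes "0 < u" "u \<le> K * s" shows "rinv \<Phi> u \<le> ratio_above * rinv \<Phi> s"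
proof -
  have s: "0 < s" using assms law_constants by (smt (verit) mult_nonneg_nonpos)
  have pos: "0 < rinv \<Phi> s" "0 < rinv \<Phi> u" using s assms by (auto intro: rinv_pos)
  show ?thesis
  proof (cases "u \<le> s")
    case True
    have "e1 * 1 * rinv \<Phi> u \<le> e1 * (s / u) powr k1 * rinv \<Phi> u"
      using e12 pos True assms k12 by (intro mult_right_mono mult_left_mono ge_one_powr_ge_zero) auto
    also have "\<dots> \<le> rinv \<Phi> s" using rinv_lower[of u s] True assms by simp
    finally have "rinv \<Phi> u \<le> 1 / e1 * rinv \<Phi> s" using e12 by (simp add: field_simps)
    also have "\<dots> \<le> ratio_above * rinv \<Phi> s" using pos e12 by (intro mult_right_mono) (auto simp: ratio_above_def)
    finally show ?thesis .
  next
    case False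
    have "rinv \<Phi> u \<le> e2 * (u / s) powr k2 * rinv \<Phi> s" using rinv_upper[of s u] False s by simp
    also have "\<dots> \<le> e2 * K powr k2 * rinv \<Phi> s"
      using e12 pos s assms law_constants k12
      by (intro mult_right_mono mult_left_mono powr_mono2) (auto simp: field_simps)
    also have "\<dots> \<le> ratio_above * rinv \<Phi> s" using pos e12 by (intro mult_right_mono) (auto simp: ratio_above_def)
    finally show ?thesis .
  qed
qed

lemma square_ratio_le:
  fixes \<rho> a b q :: real
  assumes "0 \<le> \<rho>" "0 < a" "0 < b" "a \<le> q * b" "0 < q"
  shows "(\<rho> / b)\<^sup>2 \<le> q\<^sup>2 * (\<rho> / a)\<^sup>2"
proof -
  have "\<rho> / b \<le> q * (\<rho> / a)" using assms by (simp add: field_simps mult_left_mono)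
  then have "(\<rho> / b)\<^sup>2 \<le> (q * (\<rho> / a))\<^sup>2" using assms by (intro power_mono) auto
  then show ?thesis by (simp only: power_mult_distrib)
qed

end

locale subordinate_kernel_at = subordination_constants +
  fixes t :: real and \<mu> :: "real measure" and g W :: "real \<Rightarrow> real" and \<rho> z :: real and p :: "real \<Rightarrow> ennreal"
  assumes kernel_at: "kernel_at t \<mu> g W \<rho> z p"
begin

abbreviation s :: real where "s \<equiv> time_scale t"

lemma t_pos: "0 < t" and Ks_le: "K * s \<le> M1" and law: "law_bounds k \<epsilon> K \<delta> C c t \<mu>"
  and g_antimono: "antimono g" and g_nonneg: "0 \<le> g u"
  and \<rho>_nonneg: "0 \<le> \<rho>" and \<rho>_Rm: "4 * \<Phi> \<rho> \<le> Rm" and \<rho>_M1: "4 * \<Phi> \<rho> \<le> M1" and z_ge: "\<Phi> \<rho> \<le> z"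
  using kernel_at unfolding kernel_at_def by auto

lemma g_doubling: "0 < u \<Longrightarrow> u \<le> v \<Longrightarrow> u powr \<gamma> * g u \<le> Cg * (v powr \<gamma> * g v)"
  and W_pos: "0 < u \<Longrightarrow> u \<le> M1 \<Longrightarrow> 0 < W u" and W_max: "0 < u \<Longrightarrow> u \<le> M1 \<Longrightarrow> W u \<le> Wmax"
  and W_mono: "0 < u \<Longrightarrow> u \<le> v \<Longrightarrow> v \<le> M1 \<Longrightarrow> W u \<le> CW * W v"
  and W_growth: "0 < u \<Longrightarrow> u \<le> v \<Longrightarrow> v \<le> M1 \<Longrightarrow> W v \<le> CW * (v / u) powr \<kappa> * W u"
  and p_le: "0 < u \<Longrightarrow> u \<le> M1 \<Longrightarrow> p u \<le> ennreal (a3 * (g u / W u))"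
  and p_ge: "0 < u \<Longrightarrow> u \<le> M1 \<Longrightarrow> ennreal (a1 * (g u / W u) * exp (- a2 * (\<rho> / rinv \<Phi> u)\<^sup>2)) \<le> p u"
  and p_le_off: "0 < u \<Longrightarrow> u \<le> M1 \<Longrightarrow> 0 < \<rho> \<Longrightarrow>
      p u \<le> ennreal (a3 * (C0 * (u * g u) / (W (\<Phi> \<rho>) * z) + g u / W u * exp (- a4 * (\<rho> / rinv \<Phi> u)\<^sup>2)))"
  and p_ge_off: "0 < u \<Longrightarrow> u \<le> M1 \<Longrightarrow> 0 < \<rho> \<Longrightarrow>
      ennreal (a1 * g u * min (1 / W u) (C0 * u / (W (\<Phi> \<rho>) * z))) \<le> p u"
  and p_le_late: "M1 < u \<Longrightarrow> p u \<le> ennreal (a3 * g u)"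
  using kernel_at unfolding kernel_at_def by auto

lemma s_pos: "0 < s" using t_pos by (rule time_scale_pos)

lemma s_M1: "s \<le> M1" "2 * s \<le> M1"
proof -
  have "2 * s \<le> K * s" using law_constants s_pos by (intro mult_right_mono) auto
  then show "s \<le> M1" "2 * s \<le> M1" using Ks_le s_pos by linarith+
qed

lemma sets_\<mu> [measurable_cong, simp]: "sets \<mu> = sets borel"
  using law by (simp add: law_bounds_def)

lemma AE_pos: "AE u in \<mu>. 0 < u" using law by (simp add: law_bounds_def)

lemma prob_space_\<mu>: "prob_space \<mu>" using law by (simp add: law_bounds_def)

lemma g_measurable [measurable]: "g \<in> borel_measurable borel"
  by (rule antimono_measurable[OF g_antimono])

lemma g_mono: "u \<le> v \<Longrightarrow> g v \<le> g u" using g_antimono by (auto dest: antimonoD)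

lemma g_growth: assumes "0 < u" "u \<le> v" shows "g u \<le> Cg * (v / u) powr \<gamma> * g v"
proof -
  have "u powr \<gamma> * g u \<le> Cg * (v powr \<gamma> * g v)" by (rule g_doubling[OF assms])
  then have "g u \<le> Cg * (v powr \<gamma> * g v) / u powr \<gamma>" using assms by (simp add: field_simps)
  then show ?thesis using assms by (simp add: powr_divide)
qed

text \<open>
  The boundary function decreases in time and the volume increases, so their quotient is
  non-increasing up to a constant; towards small times it grows at most polynomially.
\<close>

lemma quotient_growth:
  assumes "0 < u" "u \<le> v" "v \<le> M1"
  shows "g u / W u \<le> Cg * CW * (v / u) powr (\<gamma> + \<kappa>) * (g v / W v)"
proof -
  have W: "0 < W u" "0 < W v" using W_pos assms by auto
  have "1 / W u \<le> CW * (v / u) powr \<kappa> / W v"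
    using W_growth[OF assms] W by (simp add: field_simps)
  then have "g u * (1 / W u) \<le> (Cg * (v / u) powr \<gamma> * g v) * (CW * (v / u) powr \<kappa> / W v)"
    using g_growth[OF assms(1,2)] W g_nonneg Cg by (intro mult_mono) auto
  then show ?thesis by (simp add: powr_add mult_ac)
qed

lemma quotient_decay:
  assumes "0 < u" "u \<le> v" "v \<le> M1"
  shows "g v / W v \<le> CW * (g u / W u)"
proof -
  have W: "0 < W u" "0 < W v" using W_pos assms by auto
  have "g v * (1 / W v) \<le> g u * (CW / W u)"
    using g_mono[OF assms(2)] g_nonneg W W_mono[OF assms] by (intro mult_mono) (auto simp: field_simps)
  then show ?thesis by (simp add: mult_ac)
qed

text \<open>
  After a time \<open>v\<close> the kernel is at most of the order of its on-diagonal size at time \<open>v\<close>. Beyond \<open>M1\<close>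
  this uses that volumes of scale at most \<open>M1\<close> are bounded.
\<close>

lemma p_far: assumes "0 < v" "v \<le> u" "v \<le> M1" shows "p u \<le> ennreal (a3 * (CW + Wmax) * (g v / W v))"
proof (cases "u \<le> M1")
  case True
  have "p u \<le> ennreal (a3 * (g u / W u))" using True assms by (intro p_le) auto
  also have "a3 * (g u / W u) \<le> a3 * (CW * (g v / W v))"
    using quotient_decay[of v u] True assms kernel_constants by (intro mult_left_mono) auto
  also have "\<dots> \<le> a3 * ((CW + Wmax) * (g v / W v))"
    using kernel_constants Wmax g_nonneg[of v] W_pos[of v] assms by (intro mult_left_mono mult_right_mono) auto
  finally show ?thesis by (simp add: mult.assoc ennreal_leI)
next
  case False
  have W: "0 < W v" "W v \<le> Wmax" using W_pos W_max assms by auto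
  have "p u \<le> ennreal (a3 * g u)" using False by (intro p_le_late) simp
  also have "a3 * g u \<le> a3 * ((CW + Wmax) * (g v / W v))"
  proof (rule mult_left_mono)
    have "g u \<le> g v * 1" using g_mono[OF assms(2)] by simp
    also have "\<dots> \<le> g v * ((CW + Wmax) / W v)"
      using W CW g_nonneg by (intro mult_left_mono) (auto simp: field_simps)
    finally show "g u \<le> (CW + Wmax) * (g v / W v)" by (simp add: mult_ac)
  qed (use kernel_constants in simp)
  finally show ?thesis by (simp add: mult.assoc ennreal_leI)
qed

text \<open>
  For small \<open>u\<close> the quotient may blow up, but at most like the power of \<open>s / u\<close> whose expectation is
  bounded.
\<close>

lemma quotient_near:
  assumes "0 < u" "u \<le> K * s"
  shows "g u / W u \<le> near_factor * max 1 ((s / u) powr k) * (g s / W s)"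
proof -
  have q: "0 \<le> g s / W s" using g_nonneg W_pos[of s] s_pos s_M1 by simp
  have uM: "u \<le> M1" using assms Ks_le by simp
  show ?thesis
  proof (cases "u \<le> s")
    case True
    have "g u / W u \<le> Cg * CW * (s / u) powr (\<gamma> + \<kappa>) * (g s / W s)"
      using quotient_growth[of u s] True assms s_M1 by simp
    also have "\<dots> \<le> near_factor * max 1 ((s / u) powr k) * (g s / W s)"
    proof (intro mult_right_mono mult_mono q)
      have "(s / u) powr (\<gamma> + \<kappa>) \<le> (s / u) powr k"
        using True assms exponents by (intro powr_mono) auto
      then show "(s / u) powr (\<gamma> + \<kappa>) \<le> max 1 ((s / u) powr k)" by simp
    qed (use Cg CW near_factor_ge in \<open>auto simp: near_factor_def\<close>)
    finally show ?thesis .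
  next
    case False
    have "g u / W u \<le> CW * (g s / W s)" using quotient_decay[of s u] False s_pos uM by simp
    also have "\<dots> \<le> (near_factor * max 1 ((s / u) powr k)) * (g s / W s)"
    proof (intro mult_right_mono q)
      have "CW * 1 \<le> near_factor * max 1 ((s / u) powr k)"
        using Cg CW by (intro mult_mono) (auto simp: near_factor_def)
      then show "CW \<le> near_factor * max 1 ((s / u) powr k)" by simp
    qed
    finally show ?thesis .
  qed
qed

lemma quotient_s_nonneg: "0 \<le> g s / W s"
  using g_nonneg W_pos[of s] s_pos s_M1 by simp

text \<open>
  At times comparable with the time scale every ingredient of the kernel is comparable with its value
  at \<open>s\<close>, and the Gaussian exponent changes by a constant factor.
\<close>

lemma bulk_lower:
  assumes "\<epsilon> * s \<le> u" "u \<le> 2 * s"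
  shows "ennreal (lower_factor * (g s / W s) * exp (- lower_exponent * (\<rho> / rinv \<Phi> s)\<^sup>2)) \<le> p u"
    and "g s \<le> Cg * 2 powr \<gamma> * g u" and "0 < u"
proof -
  show u: "0 < u" using assms law_constants s_pos by (meson mult_pos_pos order.strict_trans2)
  have uM: "u \<le> M1" using assms s_M1 by simp
  have W: "0 < W u" "0 < W s" using W_pos u uM s_pos s_M1 by auto
  show g: "g s \<le> Cg * 2 powr \<gamma> * g u"
  proof (cases "u \<le> s")
    case True
    have "1 * 1 * g s \<le> Cg * 2 powr \<gamma> * g u"
      using g_mono[OF True] g_nonneg Cg exponents by (intro mult_mono ge_one_powr_ge_zero) auto
    then show ?thesis by simp
  next
    case False
    have "g s \<le> Cg * (u / s) powr \<gamma> * g u" using False s_pos by (intro g_growth) auto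
    also have "\<dots> \<le> Cg * 2 powr \<gamma> * g u"
      using assms s_pos Cg exponents g_nonneg u by (intro mult_right_mono mult_left_mono powr_mono2) (auto simp: field_simps)
    finally show ?thesis .
  qed
  have Wu: "W u \<le> CW * 2 powr \<kappa> * W s"
  proof (cases "u \<le> s")
    case True
    have "W u \<le> CW * 1 * W s" using W_mono[OF u True s_M1(1)] by simp
    also have "\<dots> \<le> CW * 2 powr \<kappa> * W s"
      using CW W exponents by (intro mult_right_mono mult_left_mono ge_one_powr_ge_zero) auto
    finally show ?thesis .
  next
    case False
    have "W u \<le> CW * (u / s) powr \<kappa> * W s" using False s_pos uM by (intro W_growth) auto
    also have "\<dots> \<le> CW * 2 powr \<kappa> * W s"
      using assms s_pos CW exponents W u by (intro mult_right_mono mult_left_mono powr_mono2) (auto simp: field_simps)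
    finally show ?thesis .
  qed
  have "lower_factor * (g s / W s) * exp (- lower_exponent * (\<rho> / rinv \<Phi> s)\<^sup>2)
      \<le> a1 * (g u / W u) * exp (- a2 * (\<rho> / rinv \<Phi> u)\<^sup>2)"
  proof (rule mult_mono)
    have "1 / W s \<le> CW * 2 powr \<kappa> / W u" using Wu W by (simp add: field_simps)
    then have "g s * (1 / W s) \<le> (Cg * 2 powr \<gamma> * g u) * (CW * 2 powr \<kappa> / W u)"
      using g W g_nonneg Cg by (intro mult_mono) auto
    then have "lower_factor * (g s / W s) \<le> lower_factor * (Cg * 2 powr \<gamma> * (CW * 2 powr \<kappa>) * (g u / W u))"
      using lower_factor_pos by (intro mult_left_mono) (auto simp: mult_ac)
    then show "lower_factor * (g s / W s) \<le> a1 * (g u / W u)"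
      using Cg CW by (simp add: lower_factor_def)
    have "(\<rho> / rinv \<Phi> u)\<^sup>2 \<le> ratio_below\<^sup>2 * (\<rho> / rinv \<Phi> s)\<^sup>2"
      using rinv_le_below[OF s_pos assms(1)] \<rho>_nonneg rinv_pos[OF s_pos] rinv_pos[OF u] ratio_pos by (intro square_ratio_le)
    then have "a2 * (\<rho> / rinv \<Phi> u)\<^sup>2 \<le> a2 * (ratio_below\<^sup>2 * (\<rho> / rinv \<Phi> s)\<^sup>2)"
      using kernel_constants by (intro mult_left_mono) auto
    then show "exp (- lower_exponent * (\<rho> / rinv \<Phi> s)\<^sup>2) \<le> exp (- a2 * (\<rho> / rinv \<Phi> u)\<^sup>2)"
      by (simp add: lower_exponent_def mult_ac)
  qed (use kernel_constants W g_nonneg in auto)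
  then show "ennreal (lower_factor * (g s / W s) * exp (- lower_exponent * (\<rho> / rinv \<Phi> s)\<^sup>2)) \<le> p u"
    using p_ge[OF u uM] by (meson ennreal_leI order_trans)
qed

lemma integral_lower:
  assumes A: "A \<in> sets borel" and P: "ennreal b \<le> emeasure \<mu> A" and ab: "0 \<le> a" "0 \<le> b"
    and le: "\<And>u. u \<in> A \<Longrightarrow> ennreal a \<le> p u"
  shows "ennreal (b * a) \<le> (\<integral>\<^sup>+u. p u \<partial>\<mu>)"
proof -
  have "ennreal (b * a) = ennreal a * ennreal b" using ab by (simp add: ennreal_mult mult.commute)
  also have "\<dots> \<le> ennreal a * emeasure \<mu> A" using P by (rule mult_left_mono) simp
  also have "\<dots> = (\<integral>\<^sup>+u. ennreal a * indicator A u \<partial>\<mu>)" using A by (simp add: nn_integral_cmult_indicator)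
  also have "\<dots> \<le> (\<integral>\<^sup>+u. p u \<partial>\<mu>)" using le by (intro nn_integral_mono) (auto simp: indicator_def)
  finally show ?thesis .
qed

lemma bulk_lower_integral:
  "ennreal (c * (lower_factor * (g s / W s) * exp (- lower_exponent * (\<rho> / rinv \<Phi> s)\<^sup>2))) \<le> (\<integral>\<^sup>+u. p u \<partial>\<mu>)"
proof (rule integral_lower[where A = "{\<epsilon> * s..2 * s}"])
  show "ennreal c \<le> emeasure \<mu> {\<epsilon> * s..2 * s}" using law by (simp add: law_bounds_def)
  show "0 \<le> lower_factor * (g s / W s) * exp (- lower_exponent * (\<rho> / rinv \<Phi> s)\<^sup>2)"
    using lower_factor_pos by (intro mult_nonneg_nonneg quotient_s_nonneg) auto
qed (use bulk_lower(1) law_constants in auto)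

subsection \<open>Distances below the scale\<close>

lemma ratio_le_near: assumes "\<Phi> \<rho> \<le> K * s" shows "\<rho> / rinv \<Phi> s \<le> ratio_above"
proof (cases "\<rho> = 0")
  case True
  then show ?thesis using ratio_pos by simp
next
  case False
  then have "0 < \<Phi> \<rho>" using \<rho>_nonneg scale_pos by simp
  then have "rinv \<Phi> (\<Phi> \<rho>) \<le> ratio_above * rinv \<Phi> s" using assms by (intro rinv_le_above)
  then show ?thesis using rinv_pos[OF s_pos] \<rho>_nonneg by (simp add: rinv_scale field_simps)
qed

lemma exp_ratio_near:
  assumes "\<Phi> \<rho> \<le> K * s" "0 \<le> a" shows "exp (- a * ratio_above\<^sup>2) \<le> exp (- a * (\<rho> / rinv \<Phi> s)\<^sup>2)"
proof -
  have "(\<rho> / rinv \<Phi> s)\<^sup>2 \<le> ratio_above\<^sup>2"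
    using ratio_le_near[OF assms(1)] \<rho>_nonneg rinv_pos[OF s_pos] by (intro power_mono) auto
  then show ?thesis using assms(2) by (simp add: mult_left_mono)
qed

lemma near_diagonal_lower:
  assumes "\<Phi> \<rho> \<le> s"
  shows "ennreal (c * lower_factor * exp (- lower_exponent * ratio_above\<^sup>2) * (g s / W s)) \<le> (\<integral>\<^sup>+u. p u \<partial>\<mu>)"
proof -
  have "s \<le> K * s" using s_pos law_constants by simp
  then have e: "exp (- lower_exponent * ratio_above\<^sup>2) \<le> exp (- lower_exponent * (\<rho> / rinv \<Phi> s)\<^sup>2)"
    using assms lower_exponent_pos by (intro exp_ratio_near) auto
  have "c * lower_factor * exp (- lower_exponent * ratio_above\<^sup>2) * (g s / W s) =
      c * (lower_factor * (g s / W s) * exp (- lower_exponent * ratio_above\<^sup>2))" by (simp add: mult_ac)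
  also have "\<dots> \<le> c * (lower_factor * (g s / W s) * exp (- lower_exponent * (\<rho> / rinv \<Phi> s)\<^sup>2))"
    using e lower_factor_pos law_constants
    by (intro mult_left_mono mult_nonneg_nonneg quotient_s_nonneg) auto
  finally show ?thesis using bulk_lower_integral by (meson ennreal_leI order_trans)
qed

lemma moment_bound: "(\<integral>\<^sup>+u. ennreal (max 1 ((s / u) powr k)) \<partial>\<mu>) \<le> ennreal C"
  using law by (simp add: law_bounds_def)

lemma near_diagonal_upper:
  "(\<integral>\<^sup>+u. p u \<partial>\<mu>) \<le> ennreal (a3 * (near_factor + CW + Wmax) * C * (g s / W s))"
proof -
  let ?A = "a3 * (near_factor + CW + Wmax) * (g s / W s)"
  have A: "0 \<le> ?A"
    using kernel_constants near_factor_ge CW Wmax by (intro mult_nonneg_nonneg quotient_s_nonneg) auto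
  have "AE u in \<mu>. p u \<le> ennreal ?A * ennreal (max 1 ((s / u) powr k))"
    using AE_pos
  proof eventually_elim
    case (elim u)
    have "p u \<le> ennreal (?A * max 1 ((s / u) powr k))"
    proof (cases "u \<le> s")
      case True
      have uK: "u \<le> K * s" using True s_pos law_constants by (smt (verit) mult_le_cancel_right1)
      have "p u \<le> ennreal (a3 * (g u / W u))" using elim True s_M1 by (intro p_le) auto
      also have "a3 * (g u / W u) \<le> a3 * (near_factor * max 1 ((s / u) powr k) * (g s / W s))"
        using quotient_near[OF elim uK] kernel_constants by (intro mult_left_mono) auto
      also have "\<dots> \<le> a3 * ((near_factor + CW + Wmax) * max 1 ((s / u) powr k) * (g s / W s))"
        using kernel_constants quotient_s_nonneg CW Wmax by (intro mult_left_mono mult_right_mono) auto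
      also have "\<dots> = ?A * max 1 ((s / u) powr k)" by (simp add: mult_ac)
      finally show ?thesis by (simp add: ennreal_leI)
    next
      case False
      have "p u \<le> ennreal (a3 * (CW + Wmax) * (g s / W s))" using False s_pos s_M1 by (intro p_far) auto
      also have "a3 * (CW + Wmax) * (g s / W s) \<le> ?A * 1"
        unfolding mult_1_right using kernel_constants near_factor_ge
        by (intro mult_right_mono mult_left_mono quotient_s_nonneg) auto
      also have "\<dots> \<le> ?A * max 1 ((s / u) powr k)" using A by (intro mult_left_mono) auto
      finally show ?thesis by (simp add: ennreal_leI)
    qed
    then show ?case by (simp only: ennreal_mult'[OF A])
  qed
  then have "(\<integral>\<^sup>+u. p u \<partial>\<mu>) \<le> (\<integral>\<^sup>+u. ennreal ?A * ennreal (max 1 ((s / u) powr k)) \<partial>\<mu>)"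
    by (rule nn_integral_mono_AE)
  also have "\<dots> = ennreal ?A * (\<integral>\<^sup>+u. ennreal (max 1 ((s / u) powr k)) \<partial>\<mu>)"
    by (intro nn_integral_cmult) measurable
  also have "\<dots> \<le> ennreal ?A * ennreal C" by (intro mult_left_mono moment_bound) simp
  also have "\<dots> = ennreal (?A * C)" by (rule ennreal_mult'[OF A, symmetric])
  finally show ?thesis by (simp add: mult_ac)
qed

end

subsection \<open>Distances above the scale\<close>

context subordination_constants
begin

definition "jump_factor = a1 / (4 * (CW * 4 powr \<kappa>))"

lemma jump_factor_pos: "0 < jump_factor" using kernel_constants CW by (simp add: jump_factor_def)

definition "window_factor = a1 / CW * exp (- a2 * (e2 * (1 / \<delta>) powr k2)\<^sup>2)"
definition "jump_lower_factor = min (c * window_factor) (c * lower_factor / (2 * CW * exp (lower_exponent * ratio_above\<^sup>2)))"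

lemma jump_lower_factor_pos: "0 < jump_lower_factor"
  using kernel_constants CW law_constants lower_factor_pos by (simp add: jump_lower_factor_def window_factor_def)

definition "off_lower = Min {c * lower_factor, c * jump_factor * \<epsilon> / (Cg * 2 powr \<gamma>), jump_factor * \<delta> * c, jump_lower_factor} / (2 * K + 4)"

lemma off_lower_pos: "0 < off_lower"
  using law_constants lower_factor_pos jump_factor_pos jump_lower_factor_pos Cg by (simp add: off_lower_def)

definition "early_factor = a3 * (K + Cg + near_factor)"

lemma early_factor_pos: "0 < early_factor"
  using kernel_constants law_constants Cg near_factor_ge by (simp add: early_factor_def)

definition "late_factor = a3 * (CW + Wmax + Cg * CW * Kb)"

lemma late_factor_pos: "0 < late_factor"
  using kernel_constants Wmax Cg CW gaussian_decay by (simp add: late_factor_def add_pos_pos)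

definition "moment_factor = 2 powr (\<beta>2 + 1) * C * c2 * (1 / (1 - (1 / 2) powr ((\<beta>2 + 1) - \<beta>2)))"

lemma moment_factor_pos: "0 < moment_factor"
  using law_constants c2_pos by (simp add: moment_factor_def)

definition "off_upper = early_factor * C + a3 * (K + C) + late_factor * (moment_factor + CW * exp (upper_exponent * ratio_above\<^sup>2))"

lemma off_upper_pos: "0 < off_upper"
  using early_factor_pos late_factor_pos moment_factor_pos CW law_constants kernel_constants
  by (auto simp: off_upper_def intro!: add_pos_pos mult_pos_pos)

end

locale off_diagonal_kernel_at = subordinate_kernel_at +
  fixes B :: real
  assumes far: "time_scale t \<le> \<Phi> \<rho>"
    and B: "0 \<le> B" "ennreal B = (\<integral>\<^sup>+v. ennreal (g v * w v) * indicator {2 * time_scale t..4 * \<Phi> \<rho>} v \<partial>lborel)"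
begin

abbreviation r :: real where "r \<equiv> \<Phi> \<rho>"

text \<open>
  The estimate has three terms. \<open>bulk\<close> is the Gaussian term at the time scale, \<open>single_jump\<close> stems from one
  jump of the subordinator of size \<open>r\<close>, and \<open>kernel_jump\<close> from the jump part of the heat kernel.
\<close>

definition J :: real where "J = C0 / (W r * z)"

definition bulk :: "real \<Rightarrow> real" where "bulk a = g s / W s * exp (- a * (\<rho> / rinv \<Phi> s)\<^sup>2)"

definition single_jump :: real where "single_jump = g r * (t * w r / W r)"

definition kernel_jump :: real where "kernel_jump = J * (t * B + s * g s)"

lemma r_pos: "0 < r" using far s_pos by simp

lemma \<rho>_pos: "0 < \<rho>" using r_pos \<rho>_nonneg scale_zero by (cases "\<rho> = 0") auto

lemma r_M1: "r \<le> M1" and r_Rm: "r \<le> Rm" and W_r: "0 < W r" and z_pos: "0 < z"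
  using r_pos \<rho>_M1 \<rho>_Rm z_ge W_pos[of r] by auto

lemma rinv_r: "rinv \<Phi> r = \<rho>" using \<rho>_nonneg by (rule rinv_scale)

lemma J_nonneg: "0 \<le> J" using C0 W_r z_pos by (simp add: J_def)

lemma bulk_nonneg: "0 \<le> bulk a"
  unfolding bulk_def by (intro mult_nonneg_nonneg quotient_s_nonneg) auto

lemma single_jump_nonneg: "0 \<le> single_jump"
  using g_nonneg t_pos tail_nonneg W_r by (simp add: single_jump_def)

lemma quotient_r_nonneg: "0 \<le> g r / W r" using g_nonneg W_r by simp

lemma t_tail_le: assumes "s \<le> v" shows "t * w v \<le> 2"
proof -
  have "w v \<le> 2 * \<phi> (1 / v)" using assms s_pos by (intro tail_le_exponent) simp
  also have "\<dots> \<le> 2 * \<phi> (1 / s)" using assms s_pos by (auto intro!: exponent_mono simp: frac_le)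
  also have "\<dots> = 2 / t" using exponent_time_scale[OF t_pos] by simp
  finally show ?thesis using t_pos by (simp add: field_simps)
qed

text \<open>If \<open>r\<close> is comparable with the time scale, the bulk term dominates.\<close>

lemma quotient_r_le_bulk:
  assumes "r \<le> K * s" "0 \<le> a"
  shows "g r / W r \<le> CW * exp (a * ratio_above\<^sup>2) * bulk a"
proof -
  have "g r / W r \<le> CW * (g s / W s)" using quotient_decay[OF s_pos far r_M1] .
  also have "\<dots> = CW * exp (a * ratio_above\<^sup>2) * (g s / W s * exp (- a * ratio_above\<^sup>2))"
    by (simp add: exp_minus field_simps)
  also have "\<dots> \<le> CW * exp (a * ratio_above\<^sup>2) * bulk a"
    unfolding bulk_def using exp_ratio_near[OF assms] CW
    by (intro mult_left_mono quotient_s_nonneg) auto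
  finally show ?thesis .
qed

subsubsection \<open>Lower bound\<close>

text \<open>
  At times \<open>u \<le> 4 r\<close> the jump part of the kernel is at most \<open>4 / W r\<close> because \<open>z \<ge> r\<close>, so the on-diagonal
  bound does not truncate it by more than a constant.
\<close>

lemma p_jump_lower:
  assumes "0 < u" "u \<le> 4 * r"
  shows "ennreal (jump_factor * J * (u * g u)) \<le> p u"
proof -
  have uM: "u \<le> M1" using assms \<rho>_M1 by simp
  have Wu: "0 < W u" using W_pos assms uM by simp
  have W: "W u \<le> CW * 4 powr \<kappa> * W r"
  proof (cases "u \<le> r")
    case True
    have "W u \<le> CW * 1 * W r" using W_mono[OF assms(1) True r_M1] by simp
    also have "\<dots> \<le> CW * 4 powr \<kappa> * W r"
      using CW W_r exponents by (intro mult_right_mono mult_left_mono ge_one_powr_ge_zero) auto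
    finally show ?thesis .
  next
    case False
    have "W u \<le> CW * (u / r) powr \<kappa> * W r" using False r_pos uM by (intro W_growth) auto
    also have "\<dots> \<le> CW * 4 powr \<kappa> * W r"
      using assms r_pos CW exponents W_r by (intro mult_right_mono mult_left_mono powr_mono2) (auto simp: field_simps)
    finally show ?thesis .
  qed
  define q where "q = CW * 4 powr \<kappa>"
  have q: "1 \<le> q" unfolding q_def using CW exponents mult_mono[of 1 CW 1 "4 powr \<kappa>"] ge_one_powr_ge_zero[of 4 \<kappa>] by auto
  have "C0 * u / (W r * z) \<le> 1 * (4 * z) / (W r * z)"
    using C0 assms z_ge z_pos W_r by (intro divide_right_mono mult_mono) auto
  also have "\<dots> = 4 / W r" using z_pos by simp
  finally have a: "J * u \<le> 4 / W r" by (simp add: J_def)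
  have "J * u / (4 * q) \<le> (4 / W r) / (4 * q)" using a q by (intro divide_right_mono) auto
  also have "\<dots> = 1 / (q * W r)" using q by simp
  also have "\<dots> \<le> 1 / W u" using W Wu q_def by (intro divide_left_mono mult_pos_pos) (use q W_r in auto)
  finally have 1: "J * u / (4 * q) \<le> 1 / W u" .
  have "J * u / (4 * q) \<le> J * u / 1" using J_nonneg assms q by (intro divide_left_mono) auto
  then have 2: "J * u / (4 * q) \<le> C0 * u / (W r * z)" by (simp add: J_def)
  have "jump_factor * J * (u * g u) = a1 * g u * (J * u / (4 * q))" by (simp add: jump_factor_def q_def)
  also have "\<dots> \<le> a1 * g u * min (1 / W u) (C0 * u / (W r * z))"
    using 1 2 kernel_constants g_nonneg by (intro mult_left_mono) auto
  finally show ?thesis using p_ge_off[OF assms(1) uM \<rho>_pos] by (meson ennreal_leI order_trans)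
qed

lemma lower_bulk: "ennreal (c * lower_factor * bulk lower_exponent) \<le> (\<integral>\<^sup>+u. p u \<partial>\<mu>)"
  using bulk_lower_integral by (simp add: bulk_def mult_ac)

lemma lower_kernel_jump_bulk:
  "ennreal (c * jump_factor * \<epsilon> / (Cg * 2 powr \<gamma>) * (J * (s * g s))) \<le> (\<integral>\<^sup>+u. p u \<partial>\<mu>)"
proof -
  let ?a = "jump_factor * J * (\<epsilon> * s * (g s / (Cg * 2 powr \<gamma>)))"
  have q: "0 < Cg * 2 powr \<gamma>" using Cg by simp
  have "ennreal (c * ?a) \<le> (\<integral>\<^sup>+u. p u \<partial>\<mu>)"
  proof (rule integral_lower[where A = "{\<epsilon> * s..2 * s}"])
    show "ennreal c \<le> emeasure \<mu> {\<epsilon> * s..2 * s}" using law by (simp add: law_bounds_def)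
    show "0 \<le> ?a" using jump_factor_pos J_nonneg law_constants s_pos g_nonneg q by (intro mult_nonneg_nonneg divide_nonneg_pos) auto
    fix u assume u: "u \<in> {\<epsilon> * s..2 * s}"
    note b = bulk_lower[of u]
    have "g s / (Cg * 2 powr \<gamma>) \<le> g u" using b(2) u q by (simp add: pos_divide_le_eq mult_ac)
    then have "\<epsilon> * s * (g s / (Cg * 2 powr \<gamma>)) \<le> u * g u"
      using u b(3) g_nonneg q by (intro mult_mono divide_nonneg_pos) auto
    then have "?a \<le> jump_factor * J * (u * g u)"
      using jump_factor_pos J_nonneg by (intro mult_left_mono) auto
    moreover have "u \<le> 4 * r" using u far r_pos by auto
    then have "ennreal (jump_factor * J * (u * g u)) \<le> p u" using b(3) u by (intro p_jump_lower) auto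
    ultimately show "ennreal ?a \<le> p u" by (meson ennreal_leI order_trans)
  qed (use law_constants in auto)
  then show ?thesis by (simp add: mult_ac)
qed

text \<open>
  Below \<open>K s\<close> the function \<open>t w\<close> is at most \<open>2\<close>, so this part of the integral is no more than a multiple of
  \<open>s g(s)\<close>; tail bounds for the subordinator are available only above \<open>K s\<close>.
\<close>

lemma B_split:
  obtains B' where "0 \<le> B'"
    "ennreal B' = (\<integral>\<^sup>+v. ennreal (g v * w v) * indicator {K * s..4 * r} v \<partial>lborel)"
    "B' \<le> B" "t * B \<le> 2 * K * (s * g s) + t * B'"
proof -
  let ?I = "\<integral>\<^sup>+v. ennreal (g v * w v) * indicator {K * s..4 * r} v \<partial>lborel"
  have K2: "2 * s \<le> K * s" using law_constants s_pos by (intro mult_right_mono) auto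
  have le: "?I \<le> ennreal B" unfolding B(2) using K2 by (intro nn_integral_mono) (auto simp: indicator_def)
  then obtain B' where B': "0 \<le> B'" "ennreal B' = ?I"
    by (cases ?I rule: ennreal_cases) (auto simp: top_unique)
  have "ennreal (t * B) = ennreal t * ennreal B" using t_pos B by (simp add: ennreal_mult)
  also have "\<dots> = (\<integral>\<^sup>+v. ennreal t * (ennreal (g v * w v) * indicator {2 * s..4 * r} v) \<partial>lborel)"
    unfolding B(2) by (intro nn_integral_cmult[symmetric]) measurable
  also have "\<dots> \<le> (\<integral>\<^sup>+v. ennreal (2 * g s) * indicator {0..K * s} v + ennreal t * (ennreal (g v * w v) * indicator {K * s..4 * r} v) \<partial>lborel)"
  proof (intro nn_integral_mono)
    fix v
    show "ennreal t * (ennreal (g v * w v) * indicator {2 * s..4 * r} v)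
        \<le> ennreal (2 * g s) * indicator {0..K * s} v + ennreal t * (ennreal (g v * w v) * indicator {K * s..4 * r} v)"
    proof (cases "v \<in> {2 * s..K * s} \<and> v \<le> 4 * r")
      case True
      then have v: "s \<le> v" "0 \<le> v" using s_pos by auto
      have "t * w v * g v \<le> 2 * g s"
        using t_tail_le[OF v(1)] g_mono[OF v(1)] g_nonneg t_pos tail_nonneg by (intro mult_mono) auto
      then have "ennreal t * ennreal (g v * w v) \<le> ennreal (2 * g s)"
        using t_pos by (simp add: ennreal_mult'[symmetric] ennreal_leI mult_ac)
      then show ?thesis using True v by (simp add: add_increasing2)
    next
      case False
      then show ?thesis by (auto simp: indicator_def)
    qed
  qed
  also have "\<dots> = (\<integral>\<^sup>+v. ennreal (2 * g s) * indicator {0..K * s} v \<partial>lborel) + ennreal t * ?I"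
    by (subst nn_integral_add) (auto simp: nn_integral_cmult)
  also have "(\<integral>\<^sup>+v. ennreal (2 * g s) * indicator {0..K * s} v \<partial>lborel) = ennreal (2 * g s) * ennreal (K * s)"
    using law_constants s_pos by (simp add: nn_integral_cmult)
  also have "\<dots> = ennreal (2 * K * (s * g s))"
    using g_nonneg law_constants s_pos by (simp add: ennreal_mult[symmetric] mult_ac)
  also have "ennreal (2 * K * (s * g s)) + ennreal t * ?I = ennreal (2 * K * (s * g s) + t * B')"
    using B' t_pos g_nonneg law_constants s_pos by (simp add: ennreal_mult flip: B'(2))
  finally have "t * B \<le> 2 * K * (s * g s) + t * B'"
    using B' t_pos g_nonneg law_constants s_pos by (subst (asm) ennreal_le_iff) auto
  moreover have "B' \<le> B"
    using le unfolding B'(2)[symmetric] by (simp only: ennreal_le_iff[OF B(1)])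
  ultimately show thesis using B' by (intro that) auto
qed

lemma lower_kernel_jump_tail:
  assumes B': "0 \<le> B'" "ennreal B' = (\<integral>\<^sup>+v. ennreal (g v * w v) * indicator {K * s..4 * r} v \<partial>lborel)"
  shows "ennreal (jump_factor * \<delta> * c * (J * (t * B'))) \<le> (\<integral>\<^sup>+u. p u \<partial>\<mu>)"
proof -
  let ?E = "\<integral>\<^sup>+u. ennreal (u * g u) * indicator {0<..4 * r} u \<partial>\<mu>"
  have jJ: "0 \<le> jump_factor * J" using jump_factor_pos J_nonneg by simp
  have "ennreal (c * t) * ennreal B' \<le> ennreal (1 / \<delta>) * ?E"
    unfolding B'(2) using law_constants
    by (intro first_moment_lower[OF law t_pos _ _ _ \<rho>_Rm g_antimono g_nonneg]) auto
  then have "ennreal (jump_factor * J * \<delta>) * (ennreal (c * t) * ennreal B') \<le> ennreal (jump_factor * J * \<delta>) * (ennreal (1 / \<delta>) * ?E)"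
    by (rule mult_left_mono) simp
  also have "\<dots> = ennreal (jump_factor * J) * ?E"
    using jJ law_constants by (simp add: ennreal_mult'[symmetric] mult.assoc[symmetric])
  also have "\<dots> = (\<integral>\<^sup>+u. ennreal (jump_factor * J) * (ennreal (u * g u) * indicator {0<..4 * r} u) \<partial>\<mu>)"
    by (intro nn_integral_cmult[symmetric]) measurable
  also have "\<dots> \<le> (\<integral>\<^sup>+u. p u \<partial>\<mu>)"
  proof (intro nn_integral_mono)
    fix u
    show "ennreal (jump_factor * J) * (ennreal (u * g u) * indicator {0<..4 * r} u) \<le> p u"
      using p_jump_lower[of u] jJ by (auto simp: indicator_def ennreal_mult'[symmetric])
  qed
  also have "ennreal (jump_factor * J * \<delta>) * (ennreal (c * t) * ennreal B') = ennreal (jump_factor * \<delta> * c * (J * (t * B')))"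
    using jJ law_constants t_pos B'(1) by (simp add: ennreal_mult'[symmetric] mult_ac)
  finally show ?thesis .
qed

text \<open>
  If \<open>r > K s\<close>, the subordinator takes a value in \<open>[\<delta> r, r]\<close> with probability of order \<open>t w(r)\<close>, and at
  these times the kernel is of on-diagonal size. Otherwise \<open>t w(r)\<close> is bounded and the term is absorbed
  by the bulk.
\<close>

lemma lower_single_jump: "ennreal (jump_lower_factor * single_jump) \<le> (\<integral>\<^sup>+u. p u \<partial>\<mu>)"
proof (cases "r \<le> K * s")
  case True
  let ?q = "2 * CW * exp (lower_exponent * ratio_above\<^sup>2)"
  have q: "0 < ?q" using CW by simp
  have "single_jump = t * w r * (g r / W r)" by (simp add: single_jump_def)
  also have "\<dots> \<le> 2 * (g r / W r)" using t_tail_le[OF far] by (intro mult_right_mono quotient_r_nonneg)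
  also have "\<dots> \<le> ?q * bulk lower_exponent"
    using quotient_r_le_bulk[OF True, of lower_exponent] lower_exponent_pos by simp
  finally have le: "single_jump \<le> ?q * bulk lower_exponent" .
  have "jump_lower_factor * single_jump \<le> c * lower_factor / ?q * (?q * bulk lower_exponent)"
    using le single_jump_nonneg law_constants lower_factor_pos q
    by (intro mult_mono divide_nonneg_pos) (auto simp: jump_lower_factor_def)
  also have "\<dots> = c * lower_factor * bulk lower_exponent" using q CW by simp
  finally show ?thesis using lower_bulk by (meson ennreal_leI order_trans)
next
  case False
  let ?a = "window_factor * (g r / W r)"
  have "ennreal (c * (t * w r) * ?a) \<le> (\<integral>\<^sup>+u. p u \<partial>\<mu>)"
  proof (rule integral_lower[where A = "{\<delta> * r..r}"])
    show "ennreal (c * (t * w r)) \<le> emeasure \<mu> {\<delta> * r..r}"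
      using law False r_Rm unfolding law_bounds_def by auto
    show "0 \<le> ?a" using kernel_constants CW by (intro mult_nonneg_nonneg quotient_r_nonneg) (auto simp: window_factor_def)
    show "0 \<le> c * (t * w r)" using law_constants t_pos tail_nonneg by simp
    fix u assume u: "u \<in> {\<delta> * r..r}"
    have u0: "0 < u" using u r_pos law_constants by (metis atLeastAtMost_iff mult_pos_pos order.strict_trans2)
    have uM: "u \<le> M1" using u r_M1 by simp
    have "g r / W r \<le> CW * (g u / W u)" using quotient_decay[of u r] u u0 r_M1 by simp
    then have "a1 / CW * (g r / W r) \<le> a1 / CW * (CW * (g u / W u))"
      using kernel_constants CW by (intro mult_left_mono) auto
    then have 1: "a1 / CW * (g r / W r) \<le> a1 * (g u / W u)" using CW by simp
    have "\<rho> \<le> e2 * (r / u) powr k2 * rinv \<Phi> u" using rinv_upper[of u r] u u0 rinv_r by simp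
    also have "\<dots> \<le> e2 * (1 / \<delta>) powr k2 * rinv \<Phi> u"
      using e12 rinv_pos[OF u0] u u0 r_pos law_constants k12
      by (intro mult_right_mono mult_left_mono powr_mono2) (auto simp: field_simps)
    finally have "\<rho> / rinv \<Phi> u \<le> e2 * (1 / \<delta>) powr k2" using rinv_pos[OF u0] by (simp add: pos_divide_le_eq)
    then have "(\<rho> / rinv \<Phi> u)\<^sup>2 \<le> (e2 * (1 / \<delta>) powr k2)\<^sup>2" using \<rho>_nonneg rinv_pos[OF u0] by (intro power_mono) auto
    then have 2: "exp (- a2 * (e2 * (1 / \<delta>) powr k2)\<^sup>2) \<le> exp (- a2 * (\<rho> / rinv \<Phi> u)\<^sup>2)"
      using kernel_constants by (simp add: mult_left_mono)
    have "?a = a1 / CW * (g r / W r) * exp (- a2 * (e2 * (1 / \<delta>) powr k2)\<^sup>2)" by (simp add: window_factor_def)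
    also have "\<dots> \<le> a1 * (g u / W u) * exp (- a2 * (\<rho> / rinv \<Phi> u)\<^sup>2)"
      by (rule mult_mono[OF 1 2]) (use kernel_constants g_nonneg W_pos[OF u0 uM] in auto)
    finally show "ennreal ?a \<le> p u" using p_ge[OF u0 uM] by (meson ennreal_leI order_trans)
  qed simp
  moreover have "jump_lower_factor * single_jump \<le> c * window_factor * single_jump"
    using single_jump_nonneg by (intro mult_right_mono) (auto simp: jump_lower_factor_def)
  moreover have "c * window_factor * single_jump = c * (t * w r) * ?a" by (simp add: single_jump_def)
  ultimately show ?thesis by (metis ennreal_leI order_trans)
qed

lemma off_diagonal_lower:
  "ennreal (off_lower * (kernel_jump + bulk lower_exponent + single_jump)) \<le> (\<integral>\<^sup>+u. p u \<partial>\<mu>)"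
proof -
  obtain B' where B': "0 \<le> B'"
    "ennreal B' = (\<integral>\<^sup>+v. ennreal (g v * w v) * indicator {K * s..4 * r} v \<partial>lborel)"
    "t * B \<le> 2 * K * (s * g s) + t * B'" by (rule B_split)
  define q where "q = Min {c * lower_factor, c * jump_factor * \<epsilon> / (Cg * 2 powr \<gamma>), jump_factor * \<delta> * c, jump_lower_factor}"
  have q: "q \<le> c * lower_factor" "q \<le> c * jump_factor * \<epsilon> / (Cg * 2 powr \<gamma>)" "q \<le> jump_factor * \<delta> * c" "q \<le> jump_lower_factor"
    by (auto simp: q_def)
  have q0: "0 < q" using law_constants lower_factor_pos jump_factor_pos jump_lower_factor_pos Cg by (simp add: q_def)
  define x1 x2 x3 x4 where "x1 = J * (s * g s)" and "x2 = J * (t * B')" and "x3 = bulk lower_exponent" and "x4 = single_jump"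
  have x0: "0 \<le> x1" "0 \<le> x2" "0 \<le> x3" "0 \<le> x4"
    using J_nonneg s_pos g_nonneg t_pos B' bulk_nonneg single_jump_nonneg by (auto simp: x1_def x2_def x3_def x4_def)
  define x where "x = max (max x1 x2) (max x3 x4)"
  have step: "ennreal (q * y) \<le> (\<integral>\<^sup>+u. p u \<partial>\<mu>)"
    if "ennreal (b * y) \<le> (\<integral>\<^sup>+u. p u \<partial>\<mu>)" "q \<le> b" "0 \<le> y" for b y
    using that by (meson ennreal_leI mult_right_mono order_trans)
  have "ennreal (q * x1) \<le> (\<integral>\<^sup>+u. p u \<partial>\<mu>)" "ennreal (q * x2) \<le> (\<integral>\<^sup>+u. p u \<partial>\<mu>)"
    "ennreal (q * x3) \<le> (\<integral>\<^sup>+u. p u \<partial>\<mu>)" "ennreal (q * x4) \<le> (\<integral>\<^sup>+u. p u \<partial>\<mu>)"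
    using step[OF lower_kernel_jump_bulk q(2)] step[OF lower_kernel_jump_tail[OF B'(1,2)] q(3)]
      step[OF lower_bulk q(1)] step[OF lower_single_jump q(4)] x0
    by (auto simp: x1_def x2_def x3_def x4_def)
  then have main: "ennreal (q * x) \<le> (\<integral>\<^sup>+u. p u \<partial>\<mu>)" by (auto simp: x_def max_def)
  \<comment> \<open>The sum is at most \<open>2 K + 4\<close> times the largest of the four quantities, which explains the
    denominator in \<open>off_lower\<close>.\<close>
  have "kernel_jump \<le> (2 * K + 1) * x1 + x2"
  proof -
    have "J * (t * B + s * g s) \<le> J * (2 * K * (s * g s) + t * B' + s * g s)"
      using B'(3) J_nonneg by (intro mult_left_mono) auto
    then show ?thesis by (simp add: kernel_jump_def x1_def x2_def algebra_simps)
  qed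
  also have "\<dots> \<le> (2 * K + 1) * x + x"
    using law_constants by (intro add_mono mult_left_mono) (auto simp: x_def)
  finally have "kernel_jump \<le> (2 * K + 1) * x + x" .
  moreover have "bulk lower_exponent \<le> x" "single_jump \<le> x" by (auto simp: x_def x3_def x4_def)
  ultimately have "kernel_jump + bulk lower_exponent + single_jump \<le> (2 * K + 1) * x + x + x + x" by linarith
  also have "\<dots> = (2 * K + 4) * x" by (simp add: algebra_simps)
  finally have "off_lower * (kernel_jump + bulk lower_exponent + single_jump) \<le> off_lower * ((2 * K + 4) * x)"
    using off_lower_pos by (intro mult_left_mono) auto
  also have "\<dots> = q * x" using law_constants by (simp add: off_lower_def q_def)
  finally show ?thesis using main by (meson ennreal_leI order_trans)
qed

subsubsection \<open>Upper bound\<close>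

text \<open>
  At times up to \<open>K s\<close> both parts of the kernel are bounded by their values at time \<open>s\<close>, up to a negative
  power of \<open>u / s\<close>.
\<close>

lemma p_early:
  assumes u: "0 < u" "u \<le> K * s"
  shows "p u \<le> ennreal (early_factor * (J * (s * g s) + bulk upper_exponent) * max 1 ((s / u) powr k))"
proof -
  let ?m = "max 1 ((s / u) powr k)"
  have uM: "u \<le> M1" using u Ks_le by simp
  have sg: "0 \<le> s * g s" using s_pos g_nonneg by simp
  have ug: "u * g u \<le> (K + Cg) * ?m * (s * g s)"
  proof (cases "u \<le> s")
    case True
    have "u * g u \<le> s * (Cg * (s / u) powr \<gamma> * g s)"
      using True u g_growth[OF u(1) True] g_nonneg by (intro mult_mono) auto
    also have "\<dots> = (Cg * (s / u) powr \<gamma>) * (s * g s)" by simp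
    also have "\<dots> \<le> ((K + Cg) * ?m) * (s * g s)"
    proof (intro mult_right_mono mult_mono sg)
      have "(s / u) powr \<gamma> \<le> (s / u) powr k" using True u exponents by (intro powr_mono) auto
      then show "(s / u) powr \<gamma> \<le> ?m" by simp
    qed (use Cg law_constants in auto)
    finally show ?thesis .
  next
    case False
    have "u * g u \<le> K * s * g s" using False u g_mono[of s u] g_nonneg by (intro mult_mono) auto
    also have "\<dots> = K * 1 * (s * g s)" by simp
    also have "\<dots> \<le> ((K + Cg) * ?m) * (s * g s)"
      using Cg law_constants by (intro mult_right_mono mult_mono sg) auto
    finally show ?thesis .
  qed
  have e: "exp (- a4 * (\<rho> / rinv \<Phi> u)\<^sup>2) \<le> exp (- upper_exponent * (\<rho> / rinv \<Phi> s)\<^sup>2)"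
  proof -
    have "(\<rho> / rinv \<Phi> s)\<^sup>2 \<le> ratio_above\<^sup>2 * (\<rho> / rinv \<Phi> u)\<^sup>2"
      using rinv_le_above[OF u] \<rho>_nonneg rinv_pos[OF s_pos] rinv_pos[OF u(1)] ratio_pos by (intro square_ratio_le)
    then have "(\<rho> / rinv \<Phi> s)\<^sup>2 / ratio_above\<^sup>2 \<le> (\<rho> / rinv \<Phi> u)\<^sup>2"
      using ratio_pos by (simp add: pos_divide_le_eq mult.commute)
    then have "a4 * ((\<rho> / rinv \<Phi> s)\<^sup>2 / ratio_above\<^sup>2) \<le> a4 * (\<rho> / rinv \<Phi> u)\<^sup>2"
      using kernel_constants by (intro mult_left_mono) auto
    then show ?thesis by (simp add: upper_exponent_def)
  qed
  have "g u / W u * exp (- a4 * (\<rho> / rinv \<Phi> u)\<^sup>2)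
      \<le> near_factor * ?m * (g s / W s) * exp (- upper_exponent * (\<rho> / rinv \<Phi> s)\<^sup>2)"
    using quotient_near[OF u] e near_factor_ge
    by (intro mult_mono mult_nonneg_nonneg quotient_s_nonneg) auto
  also have "\<dots> = near_factor * ?m * bulk upper_exponent" by (simp add: bulk_def)
  finally have gauss: "g u / W u * exp (- a4 * (\<rho> / rinv \<Phi> u)\<^sup>2) \<le> near_factor * ?m * bulk upper_exponent" .
  have kj: "J * (u * g u) \<le> J * ((K + Cg) * ?m * (s * g s))" using ug J_nonneg by (rule mult_left_mono)
  have "a3 * (J * (u * g u) + g u / W u * exp (- a4 * (\<rho> / rinv \<Phi> u)\<^sup>2))
      \<le> a3 * (J * ((K + Cg) * ?m * (s * g s)) + near_factor * ?m * bulk upper_exponent)"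
    using kernel_constants by (intro mult_left_mono[OF add_mono[OF kj gauss]]) simp
  also have "\<dots> = a3 * ?m * ((K + Cg) * (J * (s * g s)) + near_factor * bulk upper_exponent)"
    by (simp add: algebra_simps)
  also have "\<dots> \<le> a3 * ?m * ((K + Cg + near_factor) * (J * (s * g s)) + (K + Cg + near_factor) * bulk upper_exponent)"
  proof (intro mult_left_mono add_mono)
    show "(K + Cg) * (J * (s * g s)) \<le> (K + Cg + near_factor) * (J * (s * g s))"
      by (rule mult_right_mono[OF _ mult_nonneg_nonneg[OF J_nonneg sg]]) (use near_factor_ge in simp)
    show "near_factor * bulk upper_exponent \<le> (K + Cg + near_factor) * bulk upper_exponent"
      using law_constants Cg bulk_nonneg by (intro mult_right_mono) auto
  qed (use kernel_constants in auto)
  also have "\<dots> = early_factor * (J * (s * g s) + bulk upper_exponent) * ?m"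
    by (simp add: early_factor_def algebra_simps)
  finally have "a3 * (J * (u * g u) + g u / W u * exp (- a4 * (\<rho> / rinv \<Phi> u)\<^sup>2))
      \<le> early_factor * (J * (s * g s) + bulk upper_exponent) * ?m" .
  moreover have "p u \<le> ennreal (a3 * (J * (u * g u) + g u / W u * exp (- a4 * (\<rho> / rinv \<Phi> u)\<^sup>2)))"
    using p_le_off[OF u(1) uM \<rho>_pos] by (simp add: J_def)
  ultimately show ?thesis by (meson ennreal_leI order_trans)
qed

text \<open>For \<open>u \<le> r\<close> the Gaussian factor beats any power of \<open>r / u\<close>.\<close>

lemma gaussian_early:
  assumes u: "0 < u" "u \<le> r"
  shows "g u / W u * exp (- a4 * (\<rho> / rinv \<Phi> u)\<^sup>2) \<le> Cg * CW * Kb * (g r / W r) * (u / r) powr (\<beta>2 + 1)"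
proof -
  define x where "x = (r / u) powr (2 * k1)"
  have ru: "1 \<le> r / u" using u by simp
  have x: "1 \<le> x" unfolding x_def using ru k12 by (intro ge_one_powr_ge_zero) auto
  have \<eta>: "0 < rinv \<Phi> u" using u by (intro rinv_pos)
  have "e1 * (r / u) powr k1 * rinv \<Phi> u \<le> \<rho>" using rinv_lower[OF u] rinv_r by simp
  then have "e1 * (r / u) powr k1 \<le> \<rho> / rinv \<Phi> u" using \<eta> by (simp add: pos_le_divide_eq)
  then have "(e1 * (r / u) powr k1)\<^sup>2 \<le> (\<rho> / rinv \<Phi> u)\<^sup>2" using e12 by (intro power_mono) auto
  moreover have "(e1 * (r / u) powr k1)\<^sup>2 = e1\<^sup>2 * x"
    by (simp add: power_mult_distrib x_def power2_eq_square powr_add[symmetric])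
  ultimately have "a4 * (e1\<^sup>2 * x) \<le> a4 * (\<rho> / rinv \<Phi> u)\<^sup>2" using kernel_constants by (intro mult_left_mono) auto
  then have e: "exp (- a4 * (\<rho> / rinv \<Phi> u)\<^sup>2) \<le> exp (- (a4 * e1\<^sup>2) * x)" by (simp add: mult.assoc)
  have "x powr ((\<gamma> + \<kappa> + (\<beta>2 + 1)) / (2 * k1)) = (r / u) powr (\<gamma> + \<kappa> + (\<beta>2 + 1))"
    using k12 by (simp add: x_def powr_powr)
  also have "\<dots> = (r / u) powr (\<gamma> + \<kappa>) * (r / u) powr (\<beta>2 + 1)" by (rule powr_add)
  finally have "(r / u) powr (\<gamma> + \<kappa>) * (r / u) powr (\<beta>2 + 1) * exp (- (a4 * e1\<^sup>2) * x) \<le> Kb"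
    using gaussian_decay(2)[OF x] by simp
  then have "((r / u) powr (\<gamma> + \<kappa>) * exp (- (a4 * e1\<^sup>2) * x)) * (r / u) powr (\<beta>2 + 1) \<le> Kb" by (simp add: mult_ac)
  then have "(r / u) powr (\<gamma> + \<kappa>) * exp (- (a4 * e1\<^sup>2) * x) \<le> Kb / (r / u) powr (\<beta>2 + 1)"
    using ru by (subst pos_le_divide_eq) auto
  also have "\<dots> = Kb * (u / r) powr (\<beta>2 + 1)" using u r_pos by (simp add: powr_divide)
  finally have d: "(r / u) powr (\<gamma> + \<kappa>) * exp (- (a4 * e1\<^sup>2) * x) \<le> Kb * (u / r) powr (\<beta>2 + 1)" .
  have "g u / W u * exp (- a4 * (\<rho> / rinv \<Phi> u)\<^sup>2)
      \<le> (Cg * CW * (r / u) powr (\<gamma> + \<kappa>) * (g r / W r)) * exp (- (a4 * e1\<^sup>2) * x)"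
    using quotient_growth[OF u r_M1] e Cg CW by (intro mult_mono mult_nonneg_nonneg quotient_r_nonneg) auto
  also have "\<dots> = Cg * CW * (g r / W r) * ((r / u) powr (\<gamma> + \<kappa>) * exp (- (a4 * e1\<^sup>2) * x))" by (simp add: mult_ac)
  also have "\<dots> \<le> Cg * CW * (g r / W r) * (Kb * (u / r) powr (\<beta>2 + 1))"
    using d Cg CW by (intro mult_left_mono mult_nonneg_nonneg quotient_r_nonneg) auto
  finally show ?thesis by (simp add: mult_ac)
qed

text \<open>
  After time \<open>K s\<close> the kernel splits into its jump part, present up to time \<open>4 r\<close>, and a remainder that
  is of on-diagonal size from time \<open>r\<close> on and negligible before.
\<close>

lemma p_late:
  assumes u: "K * s < u"
  shows "p u \<le> ennreal (a3 * J * (u * g u)) * indicator {K * s<..4 * r} u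
      + ennreal (late_factor * (g r / W r) * min 1 ((u / r) powr (\<beta>2 + 1)))"
proof -
  have u0: "0 < u" using u s_pos law_constants by (meson less_trans mult_pos_pos order.strict_trans2 zero_less_numeral)
  let ?q = "g r / W r"
  have q: "0 \<le> ?q" by (rule quotient_r_nonneg)
  show ?thesis
  proof (cases "u \<le> 4 * r")
    case True
    have uM: "u \<le> M1" using True \<rho>_M1 by simp
    have "g u / W u * exp (- a4 * (\<rho> / rinv \<Phi> u)\<^sup>2) \<le> (CW + Wmax + Cg * CW * Kb) * ?q * min 1 ((u / r) powr (\<beta>2 + 1))"
    proof (cases "u \<le> r")
      case ur: True
      have m: "min 1 ((u / r) powr (\<beta>2 + 1)) = (u / r) powr (\<beta>2 + 1)"
        using u0 ur r_pos \<beta>1_pos \<beta>12 by (simp add: min_absorb2 powr_le1)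
      have "Cg * CW * Kb * ?q * (u / r) powr (\<beta>2 + 1) \<le> (CW + Wmax + Cg * CW * Kb) * ?q * (u / r) powr (\<beta>2 + 1)"
        using CW Wmax by (intro mult_right_mono q) auto
      then show ?thesis using gaussian_early[OF u0 ur] unfolding m by linarith
    next
      case False
      have m: "min 1 ((u / r) powr (\<beta>2 + 1)) = 1"
        using False r_pos \<beta>1_pos \<beta>12 by (simp add: min_absorb1 ge_one_powr_ge_zero)
      have "g u / W u * exp (- a4 * (\<rho> / rinv \<Phi> u)\<^sup>2) \<le> (CW * ?q) * 1"
      proof (rule mult_mono)
        show "g u / W u \<le> CW * ?q" using False r_pos uM by (intro quotient_decay) auto
        show "0 \<le> CW * ?q" using CW by (intro mult_nonneg_nonneg q) simp
      qed (use kernel_constants in auto)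
      also have "\<dots> \<le> (CW + Wmax + Cg * CW * Kb) * ?q"
        using Wmax Cg CW gaussian_decay q by (auto intro!: mult_right_mono simp del: times_divide_eq_right)
      finally show ?thesis unfolding m by simp
    qed
    then have "a3 * (J * (u * g u) + g u / W u * exp (- a4 * (\<rho> / rinv \<Phi> u)\<^sup>2))
        \<le> a3 * (J * (u * g u) + (CW + Wmax + Cg * CW * Kb) * ?q * min 1 ((u / r) powr (\<beta>2 + 1)))"
      using kernel_constants by (intro mult_left_mono add_left_mono) auto
    also have "\<dots> = a3 * J * (u * g u) + late_factor * ?q * min 1 ((u / r) powr (\<beta>2 + 1))"
      by (simp add: late_factor_def distrib_left mult.assoc)
    finally have le: "a3 * (J * (u * g u) + g u / W u * exp (- a4 * (\<rho> / rinv \<Phi> u)\<^sup>2))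
        \<le> a3 * J * (u * g u) + late_factor * ?q * min 1 ((u / r) powr (\<beta>2 + 1))" .
    have "p u \<le> ennreal (a3 * (J * (u * g u) + g u / W u * exp (- a4 * (\<rho> / rinv \<Phi> u)\<^sup>2)))"
      using p_le_off[OF u0 uM \<rho>_pos] by (simp add: J_def)
    also have "\<dots> \<le> ennreal (a3 * J * (u * g u) + late_factor * ?q * min 1 ((u / r) powr (\<beta>2 + 1)))"
      using le by (rule ennreal_leI)
    also have "\<dots> = ennreal (a3 * J * (u * g u)) + ennreal (late_factor * ?q * min 1 ((u / r) powr (\<beta>2 + 1)))"
      using kernel_constants J_nonneg u0 g_nonneg late_factor_pos
      by (intro ennreal_plus mult_nonneg_nonneg q) auto
    finally show ?thesis using True u by simp
  next
    case False
    have m: "min 1 ((u / r) powr (\<beta>2 + 1)) = 1"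
      using False r_pos \<beta>1_pos \<beta>12 by (simp add: min_absorb1 ge_one_powr_ge_zero)
    have "p u \<le> ennreal (a3 * (CW + Wmax) * ?q)" using False r_pos r_M1 by (intro p_far) auto
    also have "a3 * (CW + Wmax) * ?q \<le> late_factor * ?q"
      unfolding late_factor_def using kernel_constants Cg CW gaussian_decay
      by (intro mult_right_mono mult_left_mono q) auto
    finally show ?thesis using False unfolding m by (simp add: ennreal_leI)
  qed
qed

lemma late_moment:
  "ennreal (late_factor * (g r / W r)) * (\<integral>\<^sup>+u. ennreal (min 1 ((u / r) powr (\<beta>2 + 1))) * indicator {K * s<..} u \<partial>\<mu>)
    \<le> ennreal (late_factor * (moment_factor * single_jump + CW * exp (upper_exponent * ratio_above\<^sup>2) * bulk upper_exponent))"
  (is "?q * ?E \<le> ennreal (late_factor * (?x + ?y))")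
proof -
  have q: "0 \<le> late_factor * (g r / W r)" using late_factor_pos by (intro mult_nonneg_nonneg quotient_r_nonneg) auto
  have x: "0 \<le> ?x" using moment_factor_pos single_jump_nonneg by simp
  have y: "0 \<le> ?y" using CW bulk_nonneg by simp
  show ?thesis
  proof (cases "K * s \<le> r")
    case True
    have "?E \<le> ennreal (moment_factor * (t * w r))"
      unfolding moment_factor_def using law_constants by (intro truncated_moment[OF law t_pos _ _ True r_Rm]) auto
    then have "?q * ?E \<le> ?q * ennreal (moment_factor * (t * w r))" by (rule mult_left_mono) simp
    also have "\<dots> = ennreal (late_factor * (g r / W r) * (moment_factor * (t * w r)))"
      by (rule ennreal_mult'[OF q, symmetric])
    also have "late_factor * (g r / W r) * (moment_factor * (t * w r)) = late_factor * ?x"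
      by (simp add: single_jump_def)
    also have "ennreal (late_factor * ?x) \<le> ennreal (late_factor * (?x + ?y))"
      using late_factor_pos y by (intro ennreal_leI mult_left_mono) auto
    finally show ?thesis .
  next
    case False
    interpret prob_space \<mu> by (rule prob_space_\<mu>)
    have "?E \<le> (\<integral>\<^sup>+u. 1 \<partial>\<mu>)"
      by (intro nn_integral_mono) (auto simp: indicator_def ennreal_le_1)
    then have "?q * ?E \<le> ?q * 1" by (intro mult_left_mono) (auto simp: emeasure_space_1)
    also have "\<dots> \<le> ennreal (late_factor * ?y)"
      using quotient_r_le_bulk[of upper_exponent] False upper_exponent_pos late_factor_pos
      by (auto intro!: ennreal_leI mult_left_mono simp del: times_divide_eq_right)
    also have "\<dots> \<le> ennreal (late_factor * (?x + ?y))"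
      using late_factor_pos x by (intro ennreal_leI mult_left_mono) auto
    finally show ?thesis .
  qed
qed

lemma off_diagonal_upper:
  "(\<integral>\<^sup>+u. p u \<partial>\<mu>) \<le> ennreal (off_upper * (kernel_jump + bulk upper_exponent + single_jump))"
proof -
  let ?x = "early_factor * (J * (s * g s) + bulk upper_exponent)"
  let ?q = "late_factor * (g r / W r)"
  let ?m = "\<lambda>u. max 1 ((s / u) powr k)" and ?n = "\<lambda>u. min 1 ((u / r) powr (\<beta>2 + 1))"
  let ?U1 = "\<lambda>u. ennreal ?x * ennreal (?m u)"
  let ?U2 = "\<lambda>u. ennreal (a3 * J) * (ennreal (u * g u) * indicator {K * s<..4 * r} u)"
  let ?U3 = "\<lambda>u. ennreal ?q * (ennreal (?n u) * indicator {K * s<..} u)"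
  have sg: "0 \<le> s * g s" using s_pos g_nonneg by simp
  have x: "0 \<le> ?x" using early_factor_pos J_nonneg sg bulk_nonneg by simp
  have q: "0 \<le> ?q" using late_factor_pos by (intro mult_nonneg_nonneg quotient_r_nonneg) auto
  have aJ: "0 \<le> a3 * J" using kernel_constants J_nonneg by simp
  have "AE u in \<mu>. p u \<le> ?U1 u + (?U2 u + ?U3 u)"
    using AE_pos
  proof eventually_elim
    case (elim u)
    show ?case
    proof (cases "u \<le> K * s")
      case True
      have "p u \<le> ?U1 u" using p_early[OF elim True] by (simp only: ennreal_mult'[OF x])
      then show ?thesis by (simp add: add_increasing2)
    next
      case False
      have "p u \<le> ennreal (a3 * J * (u * g u)) * indicator {K * s<..4 * r} u + ennreal (?q * ?n u)"
        using False by (intro p_late) simp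
      also have "\<dots> = ?U2 u + ?U3 u"
        unfolding ennreal_mult'[OF q] ennreal_mult'[OF aJ] using False by (auto simp: indicator_def)
      finally show ?thesis by (simp add: add_increasing)
    qed
  qed
  then have "(\<integral>\<^sup>+u. p u \<partial>\<mu>) \<le> (\<integral>\<^sup>+u. ?U1 u + (?U2 u + ?U3 u) \<partial>\<mu>)" by (rule nn_integral_mono_AE)
  also have "\<dots> = (\<integral>\<^sup>+u. ?U1 u \<partial>\<mu>) + ((\<integral>\<^sup>+u. ?U2 u \<partial>\<mu>) + (\<integral>\<^sup>+u. ?U3 u \<partial>\<mu>))"
    by (simp add: nn_integral_add)
  also have "\<dots> \<le> ennreal (early_factor * C * (J * (s * g s) + bulk upper_exponent)) +
      (ennreal (a3 * (K + C) * kernel_jump) +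
       ennreal (late_factor * (moment_factor * single_jump + CW * exp (upper_exponent * ratio_above\<^sup>2) * bulk upper_exponent)))"
  proof (intro add_mono)
    have "(\<integral>\<^sup>+u. ?U1 u \<partial>\<mu>) = ennreal ?x * (\<integral>\<^sup>+u. ennreal (?m u) \<partial>\<mu>)" by (intro nn_integral_cmult) measurable
    also have "\<dots> \<le> ennreal ?x * ennreal C" by (intro mult_left_mono moment_bound) simp
    also have "\<dots> = ennreal (?x * C)" by (rule ennreal_mult'[OF x, symmetric])
    finally show "(\<integral>\<^sup>+u. ?U1 u \<partial>\<mu>) \<le> ennreal (early_factor * C * (J * (s * g s) + bulk upper_exponent))"
      by (simp add: mult_ac)
  next
    obtain B' where B': "0 \<le> B'"
      "ennreal B' = (\<integral>\<^sup>+v. ennreal (g v * w v) * indicator {K * s..4 * r} v \<partial>lborel)" "B' \<le> B"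
      by (rule B_split)
    have "(\<integral>\<^sup>+u. ?U2 u \<partial>\<mu>) = ennreal (a3 * J) * (\<integral>\<^sup>+u. ennreal (u * g u) * indicator {K * s<..4 * r} u \<partial>\<mu>)"
      by (intro nn_integral_cmult) measurable
    also have "\<dots> \<le> ennreal (a3 * J) * (ennreal (K * s * g (K * s)) + ennreal (C * t) * ennreal B')"
      unfolding B'(2) using law_constants
      by (intro mult_left_mono first_moment_upper[OF law t_pos _ _ \<rho>_Rm g_antimono g_nonneg]) auto
    also have "\<dots> = ennreal (a3 * J * (K * s * g (K * s) + C * t * B'))"
      using law_constants t_pos B'(1) s_pos g_nonneg aJ by (simp add: ennreal_mult' ennreal_plus)
    also have "\<dots> \<le> ennreal (a3 * J * ((K + C) * (s * g s) + (K + C) * (t * B)))"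
    proof (intro ennreal_leI mult_left_mono aJ add_mono)
      have "s \<le> K * s" using law_constants s_pos by simp
      then have "K * s * g (K * s) \<le> K * s * g s" using law_constants s_pos g_mono by (intro mult_left_mono) auto
      also have "\<dots> = K * (s * g s)" by simp
      also have "\<dots> \<le> (K + C) * (s * g s)" using law_constants sg by (intro mult_right_mono) auto
      finally show "K * s * g (K * s) \<le> (K + C) * (s * g s)" .
      have "C * t * B' \<le> C * t * B" using law_constants t_pos B' by (intro mult_left_mono) auto
      also have "\<dots> = C * (t * B)" by simp
      also have "\<dots> \<le> (K + C) * (t * B)" using law_constants t_pos B by (intro mult_right_mono) auto
      finally show "C * t * B' \<le> (K + C) * (t * B)" .
    qed
    also have "a3 * J * ((K + C) * (s * g s) + (K + C) * (t * B)) = a3 * (K + C) * kernel_jump"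
      by (simp add: kernel_jump_def algebra_simps)
    finally show "(\<integral>\<^sup>+u. ?U2 u \<partial>\<mu>) \<le> ennreal (a3 * (K + C) * kernel_jump)" .
  next
    have "(\<integral>\<^sup>+u. ?U3 u \<partial>\<mu>) = ennreal ?q * (\<integral>\<^sup>+u. ennreal (?n u) * indicator {K * s<..} u \<partial>\<mu>)"
      by (intro nn_integral_cmult) measurable
    then show "(\<integral>\<^sup>+u. ?U3 u \<partial>\<mu>)
      \<le> ennreal (late_factor * (moment_factor * single_jump + CW * exp (upper_exponent * ratio_above\<^sup>2) * bulk upper_exponent))"
      using late_moment by simp
  qed
  also have "\<dots> = ennreal (early_factor * C * (J * (s * g s) + bulk upper_exponent) + (a3 * (K + C) * kernel_jump
      + late_factor * (moment_factor * single_jump + CW * exp (upper_exponent * ratio_above\<^sup>2) * bulk upper_exponent)))"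
  proof -
    have "0 \<le> early_factor * C * (J * (s * g s) + bulk upper_exponent)"
      using early_factor_pos law_constants J_nonneg sg bulk_nonneg by simp
    moreover have "0 \<le> a3 * (K + C) * kernel_jump"
      using kernel_constants law_constants J_nonneg sg t_pos B by (simp add: kernel_jump_def)
    moreover have "0 \<le> late_factor * (moment_factor * single_jump + CW * exp (upper_exponent * ratio_above\<^sup>2) * bulk upper_exponent)"
      using late_factor_pos moment_factor_pos single_jump_nonneg CW bulk_nonneg by simp
    ultimately show ?thesis by (simp only: ennreal_plus add_nonneg_nonneg)
  qed
  also have "\<dots> \<le> ennreal (off_upper * (kernel_jump + bulk upper_exponent + single_jump))"
  proof (rule ennreal_leI)
    define k1 k2 k3 k4 where "k1 = early_factor * C" and "k2 = a3 * (K + C)" and "k3 = late_factor * moment_factor"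
      and "k4 = late_factor * (CW * exp (upper_exponent * ratio_above\<^sup>2))"
    define z1 z2 z3 where "z1 = kernel_jump" and "z2 = bulk upper_exponent" and "z3 = single_jump"
    have k: "0 \<le> k1" "0 \<le> k2" "0 \<le> k3" "0 \<le> k4"
      using early_factor_pos late_factor_pos moment_factor_pos CW law_constants kernel_constants
      by (auto simp: k1_def k2_def k3_def k4_def)
    have J_le: "J * (s * g s) \<le> z1" using J_nonneg t_pos B by (simp add: z1_def kernel_jump_def mult_left_mono)
    have z: "0 \<le> z1" "0 \<le> z2" "0 \<le> z3"
      using J_le J_nonneg sg bulk_nonneg single_jump_nonneg
      by (auto simp: z2_def z3_def intro: order_trans[OF mult_nonneg_nonneg])
    have "early_factor * C * (J * (s * g s) + bulk upper_exponent) + (a3 * (K + C) * kernel_jump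
      + late_factor * (moment_factor * single_jump + CW * exp (upper_exponent * ratio_above\<^sup>2) * bulk upper_exponent))
      = k1 * (J * (s * g s) + z2) + (k2 * z1 + (k3 * z3 + k4 * z2))"
      by (simp add: k1_def k2_def k3_def k4_def z1_def z2_def z3_def algebra_simps)
    also have "\<dots> \<le> k1 * (z1 + z2) + (k2 * z1 + (k3 * z3 + k4 * z2))"
      using J_le k by (intro add_right_mono mult_left_mono) auto
    also have "\<dots> \<le> (k1 + k2 + (k3 + k4)) * (z1 + z2 + z3)"
    proof -
      have "0 \<le> k1 * z3" "0 \<le> k2 * z2" "0 \<le> k2 * z3" "0 \<le> k3 * z1" "0 \<le> k3 * z2" "0 \<le> k4 * z1" "0 \<le> k4 * z3"
        using k z by auto
      then show ?thesis by (simp add: algebra_simps)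
    qed
    also have "\<dots> = off_upper * (kernel_jump + bulk upper_exponent + single_jump)"
      by (simp add: off_upper_def k1_def k2_def k3_def k4_def z1_def z2_def z3_def algebra_simps)
    finally show "early_factor * C * (J * (s * g s) + bulk upper_exponent) + (a3 * (K + C) * kernel_jump
      + late_factor * (moment_factor * single_jump + CW * exp (upper_exponent * ratio_above\<^sup>2) * bulk upper_exponent))
      \<le> off_upper * (kernel_jump + bulk upper_exponent + single_jump)" .
  qed
  finally show ?thesis .
qed

end

section \<open>From the heat kernel condition to scalar bounds\<close>

lemma in_state_space: assumes "x \<in> D" shows "Some x \<in> space (state_space D)"
proof -
  have "{U. openin (compactified D) U} \<subseteq> Pow (topspace (compactified D))" using openin_subset by blast
  then have "space (state_space D) = topspace (compactified D)" unfolding state_space_def by (rule space_measure_of)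
  then show ?thesis using assms by (simp add: topspace_Alexandroff_compactification)
qed

text \<open>
  Freezing the boundary function after a time \<open>M\<close> extends its doubling property to all times, and
  setting it to \<open>1\<close> at non-positive times keeps it monotone on the whole line.
\<close>

definition frozen :: "real \<Rightarrow> (real \<Rightarrow> 'a \<Rightarrow> 'a \<Rightarrow> real) \<Rightarrow> 'a \<Rightarrow> 'a \<Rightarrow> real \<Rightarrow> real" where
  "frozen M h x y u = (if u \<le> 0 then 1 else h (min u M) x y)"

lemma frozen_eq: "0 < u \<Longrightarrow> u \<le> M \<Longrightarrow> frozen M h x y u = h u x y"
  by (simp add: frozen_def)

lemma frozen_boundary_function:
  assumes h: "boundary_function \<Phi> D h" and xy: "x \<in> D" "y \<in> D" and M: "0 < M"
  shows "antimono (frozen M h x y)" "0 \<le> frozen M h x y u"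
proof -
  have h01: "0 \<le> h s x y \<and> h s x y \<le> 1" if "0 < s" for s
    using h xy that unfolding boundary_function_def by blast
  have anti: "antimono_on {0<..} (\<lambda>s. h s x y)" using h xy unfolding boundary_function_def by blast
  show "0 \<le> frozen M h x y u" using h01 M by (simp add: frozen_def)
  show "antimono (frozen M h x y)"
  proof (rule antimonoI)
    fix u v :: real assume uv: "u \<le> v"
    show "frozen M h x y v \<le> frozen M h x y u"
    proof (cases "0 < u")
      case True
      then have "h (min v M) x y \<le> h (min u M) x y"
        using uv M monotone_onD[OF anti, of "min u M" "min v M"] by auto
      then show ?thesis using True uv by (simp add: frozen_def)
    next
      case False
      then show ?thesis using h01[of "min v M"] M by (simp add: frozen_def)
    qed
  qed
qed

lemma frozen_doubling:
  assumes dbl: "\<And>s t. 0 < s \<Longrightarrow> s \<le> t \<Longrightarrow> t \<le> M \<Longrightarrow> s powr \<gamma> * h s x y \<le> c * t powr \<gamma> * h t x y"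
    and h0: "\<And>s. 0 < s \<Longrightarrow> 0 \<le> h s x y" and M: "0 < M" and \<gamma>: "0 \<le> \<gamma>"
    and u: "0 < u" "u \<le> v"
  shows "u powr \<gamma> * frozen M h x y u \<le> max 1 c * (v powr \<gamma> * frozen M h x y v)"
proof -
  let ?u = "min u M" and ?v = "min v M"
  have uv: "0 < ?u" "?u \<le> ?v" "?v \<le> M" using u M by auto
  have "?u powr \<gamma> * h ?u x y \<le> max 1 c * (?v powr \<gamma> * h ?v x y)"
  proof -
    have "0 < ?v" using u M by simp
    then have "0 \<le> ?v powr \<gamma> * h ?v x y" using h0[of ?v] by (intro mult_nonneg_nonneg) auto
    then have "c * (?v powr \<gamma> * h ?v x y) \<le> max 1 c * (?v powr \<gamma> * h ?v x y)" by (intro mult_right_mono) auto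
    then show ?thesis using dbl[OF uv] by (simp only: mult.assoc)
  qed
  moreover have "u powr \<gamma> * h ?u x y \<le> max 1 c * (v powr \<gamma> * h ?v x y)"
    if "?u powr \<gamma> * h ?u x y \<le> max 1 c * (?v powr \<gamma> * h ?v x y)"
  proof (cases "u \<le> M")
    case True
    have "?v powr \<gamma> * h ?v x y \<le> v powr \<gamma> * h ?v x y"
      using uv h0[of ?v] \<gamma> by (intro mult_right_mono powr_mono2) auto
    then have "max 1 c * (?v powr \<gamma> * h ?v x y) \<le> max 1 c * (v powr \<gamma> * h ?v x y)"
      by (rule mult_left_mono) simp
    then show ?thesis using that True by simp
  next
    case False
    then have eq: "?u = M" "?v = M" using u by auto
    have "u powr \<gamma> * h M x y \<le> v powr \<gamma> * h M x y"
      using u h0[OF M] \<gamma> by (intro mult_right_mono powr_mono2) auto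
    also have "\<dots> \<le> max 1 c * (v powr \<gamma> * h M x y)"
      using h0[OF M] mult_right_mono[of 1 "max 1 c" "v powr \<gamma> * h M x y"] by simp
    finally show ?thesis by (simp only: eq)
  qed
  ultimately have "u powr \<gamma> * h ?u x y \<le> max 1 c * (v powr \<gamma> * h ?v x y)" by blast
  then show ?thesis using u by (simp add: frozen_def)
qed

text \<open>
  The exponent \<open>\<kappa>\<close> is the same for every bound \<open>M\<close> on the scales. This breaks a circle: \<open>\<kappa>\<close> determines which
  negative moment of the subordinator is needed, and the bounds for its law determine \<open>M\<close>.
\<close>

lemma (in scale_function) scaled_volume:
  fixes m :: "'a::metric_space measure"
  assumes vg: "volume_growth m" and sets: "sets m = sets borel" and D: "bounded D"
  obtains \<kappa> where "0 \<le> \<kappa>"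
    "\<And>M. 1 \<le> M \<Longrightarrow> \<exists>C\<ge>1. \<exists>a>0. \<exists>b>0. \<forall>x\<in>D.
      (\<forall>u. 0 < u \<longrightarrow> u \<le> M \<longrightarrow> 0 < vol m x (rinv \<Phi> u) \<and> vol m x (rinv \<Phi> u) \<le> b) \<and>
      (\<forall>u v. 0 < u \<longrightarrow> u \<le> v \<longrightarrow> v \<le> M \<longrightarrow> vol m x (rinv \<Phi> u) \<le> C * vol m x (rinv \<Phi> v) \<and>
        vol m x (rinv \<Phi> v) \<le> C * (v / u) powr \<kappa> * vol m x (rinv \<Phi> u)) \<and>
      (\<forall>u. 1 \<le> u \<longrightarrow> u \<le> M \<longrightarrow> a \<le> vol m x (rinv \<Phi> u))"
proof -
  obtain k1 k2 e1 e2 where k: "0 < k1" "0 < k2" "0 < e1" "0 < e2"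
    "\<And>u v. 0 < u \<Longrightarrow> u \<le> v \<Longrightarrow> e1 * (v / u) powr k1 * rinv \<Phi> u \<le> rinv \<Phi> v"
    and up: "\<And>u v. 0 < u \<Longrightarrow> u \<le> v \<Longrightarrow> rinv \<Phi> v \<le> e2 * (v / u) powr k2 * rinv \<Phi> u"
    by (fact rinv_scaling)
  obtain d1 d2 where d: "0 < d1" "0 < d2" and
    growth: "\<And>M. \<exists>C\<ge>1. \<forall>x r R. 0 < r \<longrightarrow> r \<le> R \<longrightarrow> R \<le> M \<longrightarrow> 0 < vol m x r \<and>
      (R / r) powr d1 * vol m x r \<le> C * vol m x R \<and> vol m x R \<le> C * (R / r) powr d2 * vol m x r"
    using volume_growth_bounded[OF vg] by metis
  show thesis
  proof (rule that[of "k2 * d2"])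
    show "0 \<le> k2 * d2" using k d by simp
    fix M :: real assume M: "1 \<le> M"
    let ?R = "rinv \<Phi> M"
    have R: "0 < ?R" using M by (intro rinv_pos) simp
    obtain C where C: "1 \<le> C" and gr: "\<And>x r R. 0 < r \<Longrightarrow> r \<le> R \<Longrightarrow> R \<le> ?R \<Longrightarrow> 0 < vol m x r \<and>
      (R / r) powr d1 * vol m x r \<le> C * vol m x R \<and> vol m x R \<le> C * (R / r) powr d2 * vol m x r"
      using growth[of ?R] by blast
    obtain a b where ab: "0 < a" "0 < b" "\<And>x. x \<in> D \<Longrightarrow> a \<le> vol m x ?R" "\<And>x. x \<in> D \<Longrightarrow> vol m x ?R \<le> b"
      using volume_uniform[OF vg sets D R] by metis
    define C' where "C' = C * max 1 (e2 powr d2)"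
    have C': "1 \<le> C'" "C \<le> C'" "C * e2 powr d2 \<le> C'"
      using C mult_mono[of 1 C 1 "max 1 (e2 powr d2)"] mult_left_mono[of 1 "max 1 (e2 powr d2)" C]
        mult_left_mono[of "e2 powr d2" "max 1 (e2 powr d2)" C] by (auto simp: C'_def)
    have pos: "0 < vol m x (rinv \<Phi> u)" if "0 < u" "u \<le> M" for x u
      using gr[of "rinv \<Phi> u" "rinv \<Phi> u" x] rinv_pos[OF that(1)] rinv_mono[OF that] by simp
    have mono: "vol m x (rinv \<Phi> u) \<le> C' * vol m x (rinv \<Phi> v)" if "0 < u" "u \<le> v" "v \<le> M" for x u v
    proof -
      have le: "0 < rinv \<Phi> u" "rinv \<Phi> u \<le> rinv \<Phi> v" "rinv \<Phi> v \<le> ?R" using that by (auto intro: rinv_pos rinv_mono)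
      have "1 * vol m x (rinv \<Phi> u) \<le> (rinv \<Phi> v / rinv \<Phi> u) powr d1 * vol m x (rinv \<Phi> u)"
        using le d pos[of u x] that by (intro mult_right_mono ge_one_powr_ge_zero) auto
      also have "\<dots> \<le> C * vol m x (rinv \<Phi> v)" using gr[OF le] by blast
      also have "\<dots> \<le> C' * vol m x (rinv \<Phi> v)" using C' pos[of v x] that by (intro mult_right_mono) auto
      finally show ?thesis by simp
    qed
    have grow: "vol m x (rinv \<Phi> v) \<le> C' * (v / u) powr (k2 * d2) * vol m x (rinv \<Phi> u)" if "0 < u" "u \<le> v" "v \<le> M" for x u v
    proof -
      have le: "0 < rinv \<Phi> u" "rinv \<Phi> u \<le> rinv \<Phi> v" "rinv \<Phi> v \<le> ?R" using that by (auto intro: rinv_pos rinv_mono)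
      have "rinv \<Phi> v / rinv \<Phi> u \<le> e2 * (v / u) powr k2" using up[OF that(1,2)] le by (simp add: pos_divide_le_eq)
      then have "(rinv \<Phi> v / rinv \<Phi> u) powr d2 \<le> (e2 * (v / u) powr k2) powr d2"
        using le d by (intro powr_mono2) auto
      also have "\<dots> = e2 powr d2 * (v / u) powr (k2 * d2)" using k that by (simp add: powr_mult powr_powr)
      finally have q: "(rinv \<Phi> v / rinv \<Phi> u) powr d2 \<le> e2 powr d2 * (v / u) powr (k2 * d2)" .
      have "vol m x (rinv \<Phi> v) \<le> C * (rinv \<Phi> v / rinv \<Phi> u) powr d2 * vol m x (rinv \<Phi> u)" using gr[OF le] by blast
      also have "\<dots> \<le> C * (e2 powr d2 * (v / u) powr (k2 * d2)) * vol m x (rinv \<Phi> u)"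
        using q C pos[of u x] that by (intro mult_right_mono mult_left_mono) auto
      also have "\<dots> = (C * e2 powr d2) * (v / u) powr (k2 * d2) * vol m x (rinv \<Phi> u)" by simp
      also have "\<dots> \<le> C' * (v / u) powr (k2 * d2) * vol m x (rinv \<Phi> u)"
        using C' pos[of u x] that by (intro mult_right_mono) auto
      finally show ?thesis .
    qed
    define a' where "a' = a / (C' * M powr (k2 * d2))"
    have q: "0 < C' * M powr (k2 * d2)" using C' M by simp
    show "\<exists>C\<ge>1. \<exists>a>0. \<exists>b>0. \<forall>x\<in>D.
      (\<forall>u. 0 < u \<longrightarrow> u \<le> M \<longrightarrow> 0 < vol m x (rinv \<Phi> u) \<and> vol m x (rinv \<Phi> u) \<le> b) \<and>
      (\<forall>u v. 0 < u \<longrightarrow> u \<le> v \<longrightarrow> v \<le> M \<longrightarrow> vol m x (rinv \<Phi> u) \<le> C * vol m x (rinv \<Phi> v) \<and>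
        vol m x (rinv \<Phi> v) \<le> C * (v / u) powr (k2 * d2) * vol m x (rinv \<Phi> u)) \<and>
      (\<forall>u. 1 \<le> u \<longrightarrow> u \<le> M \<longrightarrow> a \<le> vol m x (rinv \<Phi> u))"
    proof (rule exI[of _ C'], intro conjI C'(1), rule exI[of _ a'], intro conjI, goal_cases)
      case 1
      show ?case using ab q by (simp add: a'_def)
    next
      case 2
      show ?case
      proof (rule exI[of _ "C' * b"], intro conjI ballI allI impI)
        show "0 < C' * b" using C' ab by simp
        fix x assume x: "x \<in> D"
        show "0 < vol m x (rinv \<Phi> u)" if "0 < u" "u \<le> M" for u using pos[OF that] .
        show "vol m x (rinv \<Phi> u) \<le> C' * b" if "0 < u" "u \<le> M" for u
        proof -
          have "vol m x (rinv \<Phi> u) \<le> C' * vol m x ?R" using mono[OF that order_refl] .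
          also have "\<dots> \<le> C' * b" using ab(4)[OF x] C' by (intro mult_left_mono) auto
          finally show ?thesis .
        qed
        show "vol m x (rinv \<Phi> u) \<le> C' * vol m x (rinv \<Phi> v)"
          "vol m x (rinv \<Phi> v) \<le> C' * (v / u) powr (k2 * d2) * vol m x (rinv \<Phi> u)"
          if "0 < u" "u \<le> v" "v \<le> M" for u v using mono[OF that] grow[OF that] by auto
        show "a' \<le> vol m x (rinv \<Phi> u)" if u: "1 \<le> u" "u \<le> M" for u
        proof -
          have "a \<le> vol m x ?R" using ab(3)[OF x] .
          also have "\<dots> \<le> C' * (M / u) powr (k2 * d2) * vol m x (rinv \<Phi> u)" using u by (intro grow) auto
          also have "\<dots> \<le> C' * M powr (k2 * d2) * vol m x (rinv \<Phi> u)"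
            using u M C' k d pos[of u x] by (intro mult_right_mono mult_left_mono powr_mono2) (auto simp: field_simps)
          finally show ?thesis using q by (simp add: a'_def pos_divide_le_eq mult_ac)
        qed
      qed
    qed
  qed
qed

lemma hk_profile_upper:
  assumes V: "0 < vol m x (rinv \<Phi> t)"
  shows "hk_profile m \<Phi> \<Psi> C0 c t x y \<le> ennreal (1 / vol m x (rinv \<Phi> t))"
  using V divide_ennreal[of 1 "vol m x (rinv \<Phi> t)"] by (simp add: hk_profile_def)

lemma hk_profile_lower:
  assumes V: "0 < vol m x (rinv \<Phi> t)" and c: "0 \<le> c"
  shows "ennreal (1 / vol m x (rinv \<Phi> t) * exp (- c * (dist x y / rinv \<Phi> t)\<^sup>2)) \<le> hk_profile m \<Phi> \<Psi> C0 c t x y"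
proof -
  let ?V = "vol m x (rinv \<Phi> t)" and ?e = "exp (- c * (dist x y / rinv \<Phi> t)\<^sup>2)"
  have eq: "1 / ennreal ?V = ennreal (1 / ?V)" using V divide_ennreal[of 1 ?V] by simp
  have e: "exp (- c * (dist x y)\<^sup>2 / (rinv \<Phi> t)\<^sup>2) = ?e" by (simp add: power_divide)
  have "1 / ?V * ?e \<le> 1 / ?V * 1" using V c by (intro mult_left_mono) auto
  then have "ennreal (1 / ?V * ?e) \<le> ennreal (1 / ?V)" by (intro ennreal_leI) simp
  moreover have "ennreal (1 / ?V * ?e) = ennreal (1 / ?V) * ennreal ?e" using V by (intro ennreal_mult) auto
  ultimately show ?thesis unfolding hk_profile_def eq e by (simp add: add_increasing)
qed

lemma hk_profile_off_diagonal:
  assumes V: "0 < vol m x (rinv \<Phi> t)" and z: "0 < vol m x (dist x y)" "0 < \<Psi> (dist x y)" and t: "0 \<le> C0" "0 \<le> t"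
  shows "hk_profile m \<Phi> \<Psi> C0 c t x y \<le> ennreal (C0 * t / (vol m x (dist x y) * \<Psi> (dist x y))
      + 1 / vol m x (rinv \<Phi> t) * exp (- c * (dist x y / rinv \<Phi> t)\<^sup>2))"
    and "ennreal (min (1 / vol m x (rinv \<Phi> t)) (C0 * t / (vol m x (dist x y) * \<Psi> (dist x y)))) \<le> hk_profile m \<Phi> \<Psi> C0 c t x y"
proof -
  let ?V = "vol m x (rinv \<Phi> t)" and ?e = "exp (- c * (dist x y / rinv \<Phi> t)\<^sup>2)"
  let ?z = "vol m x (dist x y) * \<Psi> (dist x y)"
  have eq: "1 / ennreal ?V = ennreal (1 / ?V)" using V divide_ennreal[of 1 ?V] by simp
  have e: "exp (- c * (dist x y)\<^sup>2 / (rinv \<Phi> t)\<^sup>2) = ?e" by (simp add: power_divide)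
  have zz: "ennreal (C0 * t) / ennreal ?z = ennreal (C0 * t / ?z)" using z t by (intro divide_ennreal) auto
  have p: "0 \<le> C0 * t / ?z" "0 \<le> 1 / ?V" using z t V by auto
  have prof: "hk_profile m \<Phi> \<Psi> C0 c t x y = min (ennreal (1 / ?V)) (ennreal (C0 * t / ?z + 1 / ?V * ?e))"
    unfolding hk_profile_def eq e zz using p by (simp add: ennreal_plus ennreal_mult'[symmetric] del: times_divide_eq_left)
  show "hk_profile m \<Phi> \<Psi> C0 c t x y \<le> ennreal (C0 * t / ?z + 1 / ?V * ?e)" by (simp add: prof)
  show "ennreal (min (1 / ?V) (C0 * t / ?z)) \<le> hk_profile m \<Phi> \<Psi> C0 c t x y"
    unfolding prof using V by (auto intro!: ennreal_leI simp: min_le_iff_disj)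
qed

context subordination_constants
begin

lemma psi_le_iff: assumes t: "0 < t" and \<rho>: "0 \<le> \<rho>" shows "psi \<phi> \<Phi> \<rho> \<le> t \<longleftrightarrow> \<Phi> \<rho> \<le> time_scale t"
proof (cases "\<rho> = 0")
  case True
  then show ?thesis using t time_scale_pos[OF t] by (simp add: psi_def scale_zero)
next
  case False
  then have r: "0 < \<Phi> \<rho>" using \<rho> by (intro scale_pos) simp
  have s: "0 < time_scale t" by (rule time_scale_pos[OF t])
  have "psi \<phi> \<Phi> \<rho> \<le> t \<longleftrightarrow> \<phi> (1 / time_scale t) \<le> \<phi> (1 / \<Phi> \<rho>)"
    using False t exponent_pos[of "1 / \<Phi> \<rho>"] r by (simp add: psi_def exponent_time_scale field_simps)
  also have "\<dots> \<longleftrightarrow> 1 / time_scale t \<le> 1 / \<Phi> \<rho>"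
    using exponent_less_iff[of "1 / \<Phi> \<rho>" "1 / time_scale t"] r s by (simp add: not_less[symmetric])
  also have "\<dots> \<longleftrightarrow> \<Phi> \<rho> \<le> time_scale t" using r s by (simp add: field_simps)
  finally show ?thesis .
qed

lemma le_psiD: assumes t: "0 < t" and \<rho>: "0 \<le> \<rho>" and le: "t \<le> psi \<phi> \<Phi> \<rho>" shows "time_scale t \<le> \<Phi> \<rho>"
proof -
  have "\<rho> \<noteq> 0" using le t by (auto simp: psi_def)
  then have r: "0 < \<Phi> \<rho>" using \<rho> by (intro scale_pos) simp
  have s: "0 < time_scale t" by (rule time_scale_pos[OF t])
  have "\<phi> (1 / \<Phi> \<rho>) \<le> \<phi> (1 / time_scale t)"
    using le t \<open>\<rho> \<noteq> 0\<close> exponent_pos[of "1 / \<Phi> \<rho>"] r by (simp add: psi_def exponent_time_scale field_simps)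
  then have "1 / \<Phi> \<rho> \<le> 1 / time_scale t"
    using exponent_less_iff[of "1 / time_scale t" "1 / \<Phi> \<rho>"] r s by (simp add: not_less[symmetric])
  then show ?thesis using r s by (simp add: field_simps)
qed

lemma rinv_psi: assumes t: "0 < t" shows "rinv (psi \<phi> \<Phi>) t = rinv \<Phi> (time_scale t)"
proof -
  have "{r. 0 \<le> r \<and> t < psi \<phi> \<Phi> r} = {r. 0 \<le> r \<and> time_scale t < \<Phi> r}"
    using psi_le_iff[OF t] by (auto simp: not_le[symmetric])
  then show ?thesis by (simp add: rinv_def)
qed

text \<open>The range of integration lies below \<open>M\<close>, where freezing has no effect.\<close>

lemma boundary_integral_frozen:
  assumes h: "boundary_function \<Phi> D h" and xy: "x \<in> D" "y \<in> D" and t: "0 < t"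
    and M: "0 < M" "4 * \<Phi> (dist x y) \<le> M"
  shows "0 \<le> boundary_integral \<phi> w \<Phi> h t x y"
    and "ennreal (boundary_integral \<phi> w \<Phi> h t x y) =
      (\<integral>\<^sup>+v. ennreal (frozen M h x y v * w v) * indicator {2 * time_scale t..4 * \<Phi> (dist x y)} v \<partial>lborel)"
proof -
  let ?A = "{2 * time_scale t..4 * \<Phi> (dist x y)}" and ?g = "frozen M h x y"
  have s: "0 < 2 * time_scale t" using time_scale_pos[OF t] by simp
  note g = frozen_boundary_function[OF h xy M(1)]
  have [measurable]: "?g \<in> borel_measurable borel" by (rule antimono_measurable[OF g(1)])
  have nn: "0 \<le> indicator ?A v * (?g v * w v)" for v
    using g(2) tail_nonneg by simp
  have int: "integrable lborel (\<lambda>v. indicator ?A v * (?g v * w v))"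
  proof (rule Bochner_Integration.integrable_bound)
    show "integrable lborel (\<lambda>v. ?g 0 * w (2 * time_scale t) * indicator ?A v)"
      by (intro integrable_mult_right) (simp add: integrable_indicator_iff emeasure_lborel_Icc_eq)
    have "indicator ?A v * (?g v * w v) \<le> ?g 0 * w (2 * time_scale t) * indicator ?A v" for v
    proof (cases "v \<in> ?A")
      case True
      have "?g v * w v \<le> ?g 0 * w (2 * time_scale t)"
        using True s g antimonoD[OF g(1), of 0 v] tail_antimono[OF s, of v] tail_nonneg by (intro mult_mono) auto
      then show ?thesis using True by simp
    qed simp
    then show "AE v in lborel. norm (indicator ?A v * (?g v * w v)) \<le> norm (?g 0 * w (2 * time_scale t) * indicator ?A v)"
      using nn by (intro AE_I2) (smt (verit) real_norm_def)
  qed measurable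
  have eq: "boundary_integral \<phi> w \<Phi> h t x y = (\<integral>v. indicator ?A v * (?g v * w v) \<partial>lborel)"
    unfolding boundary_integral_def set_lebesgue_integral_def
  proof (intro Bochner_Integration.integral_cong refl)
    fix v
    have "{2 / rinv \<phi> (1 / t)..4 * \<Phi> (dist x y)} = ?A" by (simp add: time_scale_def)
    moreover have "h v x y = ?g v" if "v \<in> ?A" using that s M by (intro frozen_eq[symmetric]) auto
    ultimately show "indicator {2 / rinv \<phi> (1 / t)..4 * \<Phi> (dist x y)} v *\<^sub>R (h v x y * w v) = indicator ?A v * (?g v * w v)"
      by (auto simp: indicator_def)
  qed
  show "0 \<le> boundary_integral \<phi> w \<Phi> h t x y" unfolding eq using nn by (intro integral_nonneg_AE) auto
  have "(\<integral>\<^sup>+v. ennreal (?g v * w v) * indicator ?A v \<partial>lborel) = (\<integral>\<^sup>+v. ennreal (indicator ?A v * (?g v * w v)) \<partial>lborel)"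
    by (intro nn_integral_cong) (auto simp: indicator_def)
  also have "\<dots> = ennreal (boundary_integral \<phi> w \<Phi> h t x y)"
    unfolding eq using nn by (intro nn_integral_eq_integral[OF int]) auto
  finally show "ennreal (boundary_integral \<phi> w \<Phi> h t x y) =
      (\<integral>\<^sup>+v. ennreal (?g v * w v) * indicator ?A v \<partial>lborel)" by simp
qed

end

text \<open>
  The heat kernel condition in terms of the frozen boundary function. After time \<open>1\<close> and up to a
  fixed time \<open>M1\<close>, all quantities in the short-time profile are comparable with constants, because
  the set is bounded.
\<close>

lemma (in scale_function) heat_kernel_bounds:
  fixes m :: "'a::metric_space measure" and p :: "real \<Rightarrow> 'a \<Rightarrow> 'a \<Rightarrow> ennreal"
  assumes HK: "HK_B m \<Phi> \<Psi> D h C0 p"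
    and h: "boundary_function \<Phi> D h" and \<Psi>: "\<And>r. 0 \<le> r \<Longrightarrow> \<Phi> r \<le> \<Psi> r"
    and M: "1 \<le> M" "M \<le> M1" and \<gamma>: "0 \<le> \<gamma>" and Cg: "1 \<le> Cg"
    and dbl: "\<And>x y u v. x \<in> D \<Longrightarrow> y \<in> D \<Longrightarrow> 0 < u \<Longrightarrow> u \<le> v \<Longrightarrow>
      u powr \<gamma> * frozen M h x y u \<le> Cg * (v powr \<gamma> * frozen M h x y v)"
    and vol: "0 < wmin" "0 < Wmax"
      "\<And>x u. x \<in> D \<Longrightarrow> 0 < u \<Longrightarrow> u \<le> M1 \<Longrightarrow> 0 < vol m x (rinv \<Phi> u) \<and> vol m x (rinv \<Phi> u) \<le> Wmax"
      "\<And>x u. x \<in> D \<Longrightarrow> 1 \<le> u \<Longrightarrow> u \<le> M1 \<Longrightarrow> wmin \<le> vol m x (rinv \<Phi> u)"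
    and diam: "\<Phi> (diameter D) \<le> M1"
  obtains a1 a2 a3 a4 where "0 < a1" "0 < a2" "0 < a3" "0 < a4"
    "\<And>x y u. x \<in> D \<Longrightarrow> y \<in> D \<Longrightarrow> 0 < u \<Longrightarrow> u \<le> M1 \<Longrightarrow>
      p u x y \<le> ennreal (a3 * (frozen M h x y u / vol m x (rinv \<Phi> u))) \<and>
      ennreal (a1 * (frozen M h x y u / vol m x (rinv \<Phi> u)) * exp (- a2 * (dist x y / rinv \<Phi> u)\<^sup>2)) \<le> p u x y"
    "\<And>x y u. x \<in> D \<Longrightarrow> y \<in> D \<Longrightarrow> 0 < u \<Longrightarrow> u \<le> M1 \<Longrightarrow> 0 < dist x y \<Longrightarrow>
      p u x y \<le> ennreal (a3 * (C0 * (u * frozen M h x y u) / (vol m x (dist x y) * \<Psi> (dist x y))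
        + frozen M h x y u / vol m x (rinv \<Phi> u) * exp (- a4 * (dist x y / rinv \<Phi> u)\<^sup>2))) \<and>
      ennreal (a1 * frozen M h x y u * min (1 / vol m x (rinv \<Phi> u)) (C0 * u / (vol m x (dist x y) * \<Psi> (dist x y)))) \<le> p u x y"
    "\<And>x y u. x \<in> D \<Longrightarrow> y \<in> D \<Longrightarrow> M1 < u \<Longrightarrow> p u x y \<le> ennreal (a3 * frozen M h x y u)"
proof -
  have bdd: "bounded D" and C0: "C0 \<in> {0, 1}" using HK by (auto simp: HK_B_def)
  have "\<exists>c1>0. \<exists>c2>0. \<exists>c3>0. \<exists>c4>0. \<forall>t\<in>{0<..1}. \<forall>x\<in>D. \<forall>y\<in>D.
        ennreal (c1 * h t x y) * hk_profile m \<Phi> \<Psi> C0 c2 t x y \<le> p t x y \<and>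
        p t x y \<le> ennreal (c3 * h t x y) * hk_profile m \<Phi> \<Psi> C0 c4 t x y"
    using HK unfolding HK_B_def by (elim conjE)
  then obtain c1 c2 c3 c4 where c: "0 < c1" "0 < c2" "0 < c3" "0 < c4" and
    short_ball: "\<forall>t\<in>{0<..1}. \<forall>x\<in>D. \<forall>y\<in>D.
        ennreal (c1 * h t x y) * hk_profile m \<Phi> \<Psi> C0 c2 t x y \<le> p t x y \<and>
        p t x y \<le> ennreal (c3 * h t x y) * hk_profile m \<Phi> \<Psi> C0 c4 t x y"
    by (elim exE conjE) (rule that; assumption)
  note short = short_ball[rule_format]
  have "\<exists>ev>0. \<exists>c1>0. \<exists>c2>0. \<forall>t\<ge>1. \<forall>x\<in>D. \<forall>y\<in>D.
        ennreal (c1 * exp (- ev * t) * h 1 x y) \<le> p t x y \<and>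
        p t x y \<le> ennreal (c2 * exp (- ev * t) * h 1 x y)"
    using HK unfolding HK_B_def by (elim conjE)
  then obtain ev d1 d2 where d: "0 < ev" "0 < d1" "0 < d2" and
    long_ball: "\<forall>t\<ge>1. \<forall>x\<in>D. \<forall>y\<in>D.
        ennreal (d1 * exp (- ev * t) * h 1 x y) \<le> p t x y \<and>
        p t x y \<le> ennreal (d2 * exp (- ev * t) * h 1 x y)"
    by (elim exE conjE) (rule that; assumption)
  note long = long_ball[rule_format]
  define q where "q = c4 * (diameter D / rinv \<Phi> 1)\<^sup>2"
  define E where "E = d2 * Cg * M1 powr \<gamma>"
  define a1 where "a1 = min c1 (d1 * exp (- ev * M1) * wmin)"
  define a3 where "a3 = max c3 (E * (1 + Wmax * exp q))"
  have E: "0 < E" using d Cg M by (simp add: E_def)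
  have a: "0 < a1" "a1 \<le> c1" "a1 \<le> d1 * exp (- ev * M1) * wmin" "0 < a3" "c3 \<le> a3"
    using c d vol by (auto simp: a1_def a3_def)
  have a3E: "E \<le> a3" "E * Wmax * exp q \<le> a3" "E * Wmax \<le> a3"
  proof -
    have q0: "0 \<le> q" using c by (simp add: q_def)
    have le: "E * (1 + Wmax * exp q) \<le> a3" by (simp add: a3_def)
    have 0: "0 \<le> E * (Wmax * exp q)" using E vol by simp
    have 1: "E * Wmax \<le> E * Wmax * exp q"
      using q0 E vol mult_left_mono[of 1 "exp q" "E * Wmax"] by simp
    show "E \<le> a3" using le 0 by (simp add: distrib_left)
    show "E * Wmax * exp q \<le> a3" using le E by (simp add: distrib_left mult.assoc)
    with 1 show "E * Wmax \<le> a3" by simp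
  qed
  show thesis
  proof (rule that[of a1 c2 a3 c4])
    fix x y u assume xy: "x \<in> D" "y \<in> D"
    let ?g = "frozen M h x y" and ?V = "vol m x (rinv \<Phi> u)" and ?\<rho> = "dist x y"
    have g0: "0 \<le> ?g u" for u using frozen_boundary_function(2)[OF h xy] M by simp
    have g1: "h 1 x y = ?g 1" using M by (simp add: frozen_def)
    have late: "p u x y \<le> ennreal (E * ?g u)" if u: "1 \<le> u" "u \<le> M1 \<or> M1 < u" for u
    proof -
      have gE: "?g 1 \<le> Cg * M1 powr \<gamma> * ?g u"
      proof -
        define v where "v = min u M1"
        have v: "1 \<le> v" "v \<le> M1" using u M by (auto simp: v_def)
        have "?g v = ?g u" using u M by (auto simp: v_def frozen_def min_def)
        moreover have "?g 1 \<le> Cg * (v powr \<gamma> * ?g v)" using dbl[OF xy, of 1 v] v by simp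
        moreover have "Cg * (v powr \<gamma> * ?g v) \<le> Cg * (M1 powr \<gamma> * ?g v)"
          using v \<gamma> g0 Cg by (intro mult_left_mono mult_right_mono powr_mono2) auto
        ultimately show ?thesis by (simp add: mult.assoc)
      qed
      have "d2 * exp (- ev * u) * h 1 x y \<le> d2 * 1 * (Cg * M1 powr \<gamma> * ?g u)"
        unfolding g1 using gE d u g0 Cg by (intro mult_mono) auto
      also have "\<dots> = E * ?g u" by (simp add: E_def)
      finally show ?thesis using long[OF u(1) xy] by (meson ennreal_leI order_trans)
    qed
    show "p u x y \<le> ennreal (a3 * ?g u)" if "M1 < u"
    proof -
      have "E * ?g u \<le> a3 * ?g u" using a3E g0 by (intro mult_right_mono) auto
      then show ?thesis using late[of u] that M by (meson ennreal_leI le_less_trans less_imp_le order_trans)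
    qed
    assume u: "0 < u" "u \<le> M1"
    have V: "0 < ?V" "?V \<le> Wmax" using vol(3)[OF xy(1) u] by auto
    have \<eta>: "0 < rinv \<Phi> u" using u by (intro rinv_pos)
    have late_lower: "ennreal (a1 * ?g u / ?V) \<le> p u x y" if u1: "1 \<le> u"
    proof -
      have "a1 * ?g u / ?V \<le> (d1 * exp (- ev * M1) * wmin) * ?g 1 / wmin"
        using a vol vol(4)[OF xy(1) u1 u(2)] g0 antimonoD[OF frozen_boundary_function(1)[OF h xy], of M 1 u] u1 M
        by (intro frac_le mult_mono) auto
      also have "\<dots> = d1 * exp (- ev * M1) * h 1 x y" using vol by (simp add: g1)
      also have "\<dots> \<le> d1 * exp (- ev * u) * h 1 x y"
        using d u g0[of 1] by (intro mult_right_mono mult_left_mono) (auto simp: g1)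
      finally show ?thesis using long[OF u1 xy] by (meson ennreal_leI order_trans)
    qed
    have gh: "h u x y = ?g u" if "u \<le> 1" using that u M by (simp add: frozen_def)
    have lower: "ennreal (a1 * ?g u * b) \<le> p u x y"
      if b: "0 \<le> b" "b \<le> 1 / ?V" "ennreal b \<le> hk_profile m \<Phi> \<Psi> C0 c2 u x y" for b
    proof (cases "u \<le> 1")
      case True
      have "ennreal (a1 * ?g u * b) \<le> ennreal (c1 * ?g u * b)"
        using a g0 b by (intro ennreal_leI mult_right_mono) auto
      also have "\<dots> = ennreal (c1 * ?g u) * ennreal b" using c g0 b by (intro ennreal_mult) auto
      also have "\<dots> \<le> ennreal (c1 * ?g u) * hk_profile m \<Phi> \<Psi> C0 c2 u x y" by (rule mult_left_mono[OF b(3)]) simp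
      also have "\<dots> \<le> p u x y" using short[of u x y] True u xy gh by simp
      finally show ?thesis .
    next
      case False
      have "a1 * ?g u * b \<le> a1 * ?g u * (1 / ?V)" using a g0 b by (intro mult_left_mono) auto
      then have "ennreal (a1 * ?g u * b) \<le> ennreal (a1 * ?g u / ?V)" by (intro ennreal_leI) simp
      then show ?thesis using late_lower False by (meson less_imp_le not_le order_trans)
    qed
    show "p u x y \<le> ennreal (a3 * (?g u / ?V)) \<and>
      ennreal (a1 * (?g u / ?V) * exp (- c2 * (?\<rho> / rinv \<Phi> u)\<^sup>2)) \<le> p u x y"
    proof
      show "p u x y \<le> ennreal (a3 * (?g u / ?V))"
      proof (cases "u \<le> 1")
        case True
        have "p u x y \<le> ennreal (c3 * ?g u) * hk_profile m \<Phi> \<Psi> C0 c4 u x y"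
          using short[of u x y] True u xy gh by simp
        also have "\<dots> \<le> ennreal (c3 * ?g u) * ennreal (1 / ?V)" by (intro mult_left_mono hk_profile_upper V) simp
        also have "\<dots> = ennreal (c3 * (?g u / ?V))" using c g0 V by (simp add: ennreal_mult'[symmetric])
        also have "\<dots> \<le> ennreal (a3 * (?g u / ?V))"
          using a g0 V by (intro ennreal_leI mult_right_mono divide_nonneg_pos) auto
        finally show ?thesis .
      next
        case False
        have "E * ?g u \<le> E * (?g u * (Wmax / ?V))"
          using V E g0[of u] mult_left_mono[of 1 "Wmax / ?V" "?g u"] by (intro mult_left_mono) auto
        also have "\<dots> = E * Wmax * (?g u / ?V)" by simp
        also have "\<dots> \<le> a3 * (?g u / ?V)" using a3E g0 V by (intro mult_right_mono divide_nonneg_pos) auto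
        finally show ?thesis using late[of u] False u by (meson ennreal_leI less_imp_le not_le order_trans)
      qed
      have "1 / ?V * exp (- c2 * (?\<rho> / rinv \<Phi> u)\<^sup>2) \<le> 1 / ?V * 1" using V c by (intro mult_left_mono) auto
      then have "ennreal (a1 * ?g u * (1 / ?V * exp (- c2 * (?\<rho> / rinv \<Phi> u)\<^sup>2))) \<le> p u x y"
        using V c by (intro lower hk_profile_lower) auto
      then show "ennreal (a1 * (?g u / ?V) * exp (- c2 * (?\<rho> / rinv \<Phi> u)\<^sup>2)) \<le> p u x y" by simp
    qed
    assume \<rho>: "0 < ?\<rho>"
    have \<rho>_diam: "?\<rho> \<le> diameter D" by (rule diameter_bounded_bound[OF bdd xy])
    let ?z = "vol m x ?\<rho> * \<Psi> ?\<rho>"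
    have z: "0 < \<Psi> ?\<rho>" using \<Psi>[of ?\<rho>] scale_pos[OF \<rho>] by simp
    have V\<rho>: "0 < vol m x ?\<rho>"
    proof -
      have "\<Phi> ?\<rho> \<le> \<Phi> (diameter D)"
        using scale_less_iff[of "diameter D" ?\<rho>] \<rho> \<rho>_diam by (simp add: not_less[symmetric])
      then have "0 < vol m x (rinv \<Phi> (\<Phi> ?\<rho>))" using vol(3)[OF xy(1) scale_pos[OF \<rho>]] diam by simp
      then show ?thesis by (simp add: rinv_scale)
    qed
    have C00: "0 \<le> C0" using C0 by auto
    show "p u x y \<le> ennreal (a3 * (C0 * (u * ?g u) / ?z + ?g u / ?V * exp (- c4 * (?\<rho> / rinv \<Phi> u)\<^sup>2))) \<and>
      ennreal (a1 * ?g u * min (1 / ?V) (C0 * u / ?z)) \<le> p u x y"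
    proof
      let ?e = "exp (- c4 * (?\<rho> / rinv \<Phi> u)\<^sup>2)"
      have nn: "0 \<le> C0 * (u * ?g u) / ?z" "0 \<le> ?g u / ?V * ?e" "0 \<le> ?g u / ?V"
        using C00 u g0 V\<rho> z V by (auto intro!: divide_nonneg_pos mult_nonneg_nonneg)
      show "p u x y \<le> ennreal (a3 * (C0 * (u * ?g u) / ?z + ?g u / ?V * ?e))"
      proof (cases "u \<le> 1")
        case True
        have "p u x y \<le> ennreal (c3 * ?g u) * hk_profile m \<Phi> \<Psi> C0 c4 u x y"
          using short[of u x y] True u xy gh by simp
        also have "\<dots> \<le> ennreal (c3 * ?g u) * ennreal (C0 * u / ?z + 1 / ?V * ?e)"
          using V V\<rho> z C00 u by (intro mult_left_mono hk_profile_off_diagonal) auto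
        also have "\<dots> = ennreal (c3 * ?g u * (C0 * u / ?z + 1 / ?V * ?e))"
          using c g0 by (intro ennreal_mult'[symmetric]) auto
        also have "c3 * ?g u * (C0 * u / ?z + 1 / ?V * ?e) = c3 * (C0 * (u * ?g u) / ?z + ?g u / ?V * ?e)"
          by (simp add: distrib_left mult_ac)
        also have "ennreal \<dots> \<le> ennreal (a3 * (C0 * (u * ?g u) / ?z + ?g u / ?V * ?e))"
          using a nn by (intro ennreal_leI mult_right_mono add_nonneg_nonneg) auto
        finally show ?thesis .
      next
        case False
        have "?\<rho> / rinv \<Phi> u \<le> diameter D / rinv \<Phi> 1"
          using \<rho>_diam \<rho> diameter_ge_0[OF bdd] False rinv_mono[of 1 u] rinv_pos[of 1] by (intro frac_le) auto
        then have "(?\<rho> / rinv \<Phi> u)\<^sup>2 \<le> (diameter D / rinv \<Phi> 1)\<^sup>2" using \<eta> \<rho> by (intro power_mono) auto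
        then have "c4 * (?\<rho> / rinv \<Phi> u)\<^sup>2 \<le> q" unfolding q_def using c by (intro mult_left_mono) auto
        then have e: "1 \<le> exp q * ?e" by (simp add: exp_add[symmetric])
        have "E * ?g u \<le> E * (?g u * (Wmax / ?V))"
          using V E g0[of u] mult_left_mono[of 1 "Wmax / ?V" "?g u"] by (intro mult_left_mono) auto
        also have "\<dots> = E * Wmax * (?g u / ?V) * 1" by simp
        also have "\<dots> \<le> E * Wmax * (?g u / ?V) * (exp q * ?e)"
          using e E vol nn(3) by (intro mult_left_mono mult_nonneg_nonneg) auto
        also have "\<dots> = E * Wmax * exp q * (?g u / ?V * ?e)" by (simp add: mult_ac)
        also have "\<dots> \<le> a3 * (C0 * (u * ?g u) / ?z + ?g u / ?V * ?e)"
          using a3E a nn by (intro mult_mono) auto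
        finally show ?thesis using late[of u] False u by (meson ennreal_leI less_imp_le not_le order_trans)
      qed
      show "ennreal (a1 * ?g u * min (1 / ?V) (C0 * u / ?z)) \<le> p u x y"
        using V V\<rho> z C00 u by (intro lower hk_profile_off_diagonal) auto
    qed
  qed (use c a in auto)
qed

section \<open>Heat kernel of the subordinate process\<close>

theorem theorem4p2:
  fixes m :: "'a::{metric_space, second_countable_topology} measure"
    and \<Phi> \<Psi> \<phi> :: "real \<Rightarrow> real" and \<nu> :: "real measure" and R1 :: ereal
    and D :: "'a set" and h :: "real \<Rightarrow> 'a \<Rightarrow> 'a \<Rightarrow> real"
    and A :: "'w measure" and P :: "'a option \<Rightarrow> 'w measure"
    and Y :: "ennreal \<Rightarrow> 'w \<Rightarrow> 'a option" and S :: "real \<Rightarrow> 'w \<Rightarrow> real"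
    and p :: "real \<Rightarrow> 'a \<Rightarrow> 'a \<Rightarrow> ennreal"
    and C0 T :: real
  assumes "proper_space TYPE('a)"
    and "radon_measure m" and "full_support m" and "volume_growth m"
    and "open D" and "D \<subset> UNIV"
    and "scale_functions \<Phi> \<Psi>"
    and "hunt_process A D P Y"
    and "\<And>z. z \<in> space (state_space D) \<Longrightarrow> driftless_subordinator (P z) S \<phi> \<nu>"
    and "independent_of D P Y S"
    and "transition_density m D A P Y p"
    and "boundary_function \<Phi> D h"
    and "poly_tail R1 (levy_tail \<nu>)"
    and "HK_B m \<Phi> \<Psi> D h C0 p"
    and "ereal (\<Phi> (diameter D)) < R1 / 8"
    and "0 < T"
    and "time_doubling h D {0 <.. 1 / rinv \<phi> (1 / T)}"
  shows "(\<exists>a1>0. \<exists>a2>0. \<forall>t\<in>{0<..T}. \<forall>x\<in>D. \<forall>y\<in>D. psi \<phi> \<Phi> (dist x y) \<le> t \<longrightarrow>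
           (let q = subordinate_kernel P S p t x y;
                g = h (1 / rinv \<phi> (1 / t)) x y / vol m x (rinv (psi \<phi> \<Phi>) t)
            in ennreal (a1 * g) \<le> q \<and> q \<le> ennreal (a2 * g))) \<and>
         (\<exists>a1>0. \<exists>a2>0. \<exists>a3>0. \<exists>a4>0. \<forall>t\<in>{0<..T}. \<forall>x\<in>D. \<forall>y\<in>D. t \<le> psi \<phi> \<Phi> (dist x y) \<longrightarrow>
           (let q = subordinate_kernel P S p t x y;
                r = dist x y;
                w = levy_tail \<nu>;
                g = (\<lambda>c.
                  C0 / (vol m x r * \<Psi> r) *
                    (t * boundary_integral \<phi> w \<Phi> h t x y
                      + h (1 / rinv \<phi> (1 / t)) x y / rinv \<phi> (1 / t))
                  + h (1 / rinv \<phi> (1 / t)) x y / vol m x (rinv (psi \<phi> \<Phi>) t)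
                    * exp (- c * r\<^sup>2 / (rinv (psi \<phi> \<Phi>) t)\<^sup>2)
                  + h (\<Phi> r) x y * (t * w (\<Phi> r) / vol m x r))
            in ennreal (a1 * g a2) \<le> q \<and> q \<le> ennreal (a3 * g a4)))"
proof (cases "D = {}")
  case True
  then show ?thesis by (auto intro!: exI[of _ 1])
next
  case False
  then obtain x0 where x0: "x0 \<in> D" by blast
  note drift = assms(9)[OF in_state_space]
  have bdd: "bounded D" and C0: "C0 \<in> {0, 1}" using assms(14) by (auto simp: HK_B_def)
  have sets_m: "sets m = sets borel" using assms(2) by (simp add: radon_measure_def)
  interpret Sc: scale_function \<Phi>
    using assms(7) by unfold_locales (auto simp: scale_functions_def)
  have \<Psi>: "\<Phi> r \<le> \<Psi> r" if "0 \<le> r" for r using assms(7) that by (simp add: scale_functions_def)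
  define Rm where "Rm = 4 * \<Phi> (diameter D)"
  have \<Phi>_diam: "0 < \<Phi> (diameter D)"
    by (intro Sc.scale_pos diameter_pos[OF assms(4,5) x0 bdd])
  have Rm: "0 < Rm" using \<Phi>_diam by (simp add: Rm_def)
  have Rm_R1: "ereal Rm < R1"
    using assms(15) \<Phi>_diam by (cases R1) (auto simp: Rm_def)
  have \<Phi>_dist: "4 * \<Phi> (dist x y) \<le> Rm" if "x \<in> D" "y \<in> D" for x y
    using diameter_bounded_bound[OF bdd that] Sc.scale_less_iff[of "diameter D" "dist x y"] diameter_ge_0[OF bdd]
    by (simp add: Rm_def not_less[symmetric])
  have "\<exists>c1>0. \<exists>c2>0. \<exists>\<beta>1>0. \<exists>\<beta>2\<ge>\<beta>1. \<forall>r R. 0 < r \<longrightarrow> r \<le> R \<longrightarrow> ereal R < R1 \<longrightarrow>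
        c1 * (R / r) powr \<beta>1 \<le> levy_tail \<nu> r / levy_tail \<nu> R \<and> levy_tail \<nu> r / levy_tail \<nu> R \<le> c2 * (R / r) powr \<beta>2"
    using assms(13) unfolding poly_tail_def by (elim conjE)
  then obtain c1 c2 \<beta>1 \<beta>2 where poly: "0 < c1" "0 < c2" "0 < \<beta>1" "\<beta>1 \<le> \<beta>2" and
    poly_tail: "\<forall>r R. 0 < r \<longrightarrow> r \<le> R \<longrightarrow> ereal R < R1 \<longrightarrow>
        c1 * (R / r) powr \<beta>1 \<le> levy_tail \<nu> r / levy_tail \<nu> R \<and> levy_tail \<nu> r / levy_tail \<nu> R \<le> c2 * (R / r) powr \<beta>2"
    by (elim exE conjE) (rule that; assumption)
  interpret PL: poly_levy \<nu> \<phi> Rm c1 c2 \<beta>1 \<beta>2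
  proof
    show "levy_measure \<nu>" using drift[OF x0] by (simp add: driftless_subordinator_def)
    show "\<phi> u = (LINT s:{0<..}|\<nu>. 1 - exp (- u * s))" if "0 \<le> u" for u
      using drift[OF x0] that unfolding driftless_subordinator_def by blast
    show "c1 * (R / r) powr \<beta>1 \<le> levy_tail \<nu> r / levy_tail \<nu> R \<and> levy_tail \<nu> r / levy_tail \<nu> R \<le> c2 * (R / r) powr \<beta>2"
      if "0 < r" "r \<le> R" "R \<le> Rm" for r R
    proof -
      have "ereal R < R1" using that(3) Rm_R1 by (meson ereal_less_eq(3) order.strict_trans1)
      then show ?thesis using poly_tail that by blast
    qed
  qed (use Rm poly in auto)
  obtain k1 k2 e1 e2 where k: "0 < k1" "0 < k2" "0 < e1" "0 < e2"
    and rl: "\<And>u v. 0 < u \<Longrightarrow> u \<le> v \<Longrightarrow> e1 * (v / u) powr k1 * rinv \<Phi> u \<le> rinv \<Phi> v"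
    and ru: "\<And>u v. 0 < u \<Longrightarrow> u \<le> v \<Longrightarrow> rinv \<Phi> v \<le> e2 * (v / u) powr k2 * rinv \<Phi> u"
    by (fact Sc.rinv_scaling)
  obtain \<kappa> where \<kappa>: "0 \<le> \<kappa>" and volumes:
    "\<And>M. 1 \<le> M \<Longrightarrow> \<exists>C\<ge>1. \<exists>a>0. \<exists>b>0. \<forall>x\<in>D.
      (\<forall>u. 0 < u \<longrightarrow> u \<le> M \<longrightarrow> 0 < vol m x (rinv \<Phi> u) \<and> vol m x (rinv \<Phi> u) \<le> b) \<and>
      (\<forall>u v. 0 < u \<longrightarrow> u \<le> v \<longrightarrow> v \<le> M \<longrightarrow> vol m x (rinv \<Phi> u) \<le> C * vol m x (rinv \<Phi> v) \<and>
        vol m x (rinv \<Phi> v) \<le> C * (v / u) powr \<kappa> * vol m x (rinv \<Phi> u)) \<and>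
      (\<forall>u. 1 \<le> u \<longrightarrow> u \<le> M \<longrightarrow> a \<le> vol m x (rinv \<Phi> u))"
    by (fact Sc.scaled_volume[OF assms(4) sets_m bdd])
  define sT where "sT = PL.time_scale T"
  have sT: "0 < sT" unfolding sT_def by (rule PL.time_scale_pos[OF assms(16)])
  define M0 where "M0 = max (max 1 Rm) sT"
  have M0: "1 \<le> M0" "Rm \<le> M0" "sT \<le> M0" by (auto simp: M0_def)
  \<comment> \<open>Both time ranges on which \<open>h\<close> is doubling start at \<open>0\<close>, so one of them contains the other.\<close>
  have "time_doubling h D {0<..M0}"
  proof (cases "max 1 Rm \<le> sT")
    case True
    then show ?thesis using assms(17) by (simp add: M0_def sT_def PL.time_scale_def max_absorb2)
  next
    case False
    have "time_doubling h D {t. 0 < t \<and> (bounded D \<longrightarrow> t < 4 * \<Phi> (diameter D) + 1)}"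
      using assms(12) by (simp add: boundary_function_def)
    moreover have "{0<..M0} \<subseteq> {t. 0 < t \<and> (bounded D \<longrightarrow> t < 4 * \<Phi> (diameter D) + 1)}"
      using False \<Phi>_diam by (auto simp: M0_def Rm_def)
    ultimately show ?thesis by (rule time_doubling_subset)
  qed
  then obtain Ch \<gamma> where \<gamma>: "0 \<le> \<gamma>" and dbl: "\<forall>s\<in>{0<..M0}. \<forall>t\<in>{0<..M0}. \<forall>x\<in>D. \<forall>y\<in>D. s \<le> t \<longrightarrow>
        s powr \<gamma> * h s x y \<le> Ch * t powr \<gamma> * h t x y"
    unfolding time_doubling_def by (elim exE conjE) (rule that; assumption)
  define Cg where "Cg = max 1 Ch"
  have Cg: "1 \<le> Cg" by (simp add: Cg_def)
  define G where "G = frozen M0 h"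
  have h01: "0 \<le> h s x y" if "0 < s" "x \<in> D" "y \<in> D" for s x y
    using assms(12) that unfolding boundary_function_def by blast
  have G_doubling: "u powr \<gamma> * G x y u \<le> Cg * (v powr \<gamma> * G x y v)"
    if "x \<in> D" "y \<in> D" "0 < u" "u \<le> v" for x y u v
    unfolding G_def Cg_def
  proof (rule frozen_doubling)
    show "s powr \<gamma> * h s x y \<le> Ch * t powr \<gamma> * h t x y" if "0 < s" "s \<le> t" "t \<le> M0" for s t
    proof -
      have "s \<in> {0<..M0}" "t \<in> {0<..M0}" using that by auto
      then show ?thesis using dbl that(2) \<open>x \<in> D\<close> \<open>y \<in> D\<close> by blast
    qed
    show "0 \<le> h s x y" if "0 < s" for s using h01 that \<open>x \<in> D\<close> \<open>y \<in> D\<close> by blast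
  qed (use that \<gamma> M0 in auto)
  obtain \<epsilon> K \<delta> C c where law_constants: "0 < \<epsilon>" "\<epsilon> \<le> 1" "2 \<le> K" "0 < \<delta>" "\<delta> \<le> 1" "0 < C" "0 < c" and
    law: "\<And>(N :: 'w measure) S t. driftless_subordinator N S \<phi> \<nu> \<Longrightarrow> 0 < t \<Longrightarrow> t \<le> T \<Longrightarrow>
      PL.law_bounds (\<gamma> + \<kappa>) \<epsilon> K \<delta> C c t (distr N borel (S t))"
    by (fact PL.subordinator_law_bounds[OF add_nonneg_nonneg[OF \<gamma> \<kappa>] assms(16), where ?'w = 'w])
  \<comment> \<open>Short-time bounds are needed up to \<open>K s\<close>, beyond the range where \<open>h\<close> is doubling; there \<open>h\<close> is
    replaced by its frozen value.\<close>
  define M1 where "M1 = max M0 (K * sT)"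
  have M1: "1 \<le> M1" "M0 \<le> M1" "K * sT \<le> M1" using M0 by (auto simp: M1_def)
  obtain CW wmin Wmax where CW: "1 \<le> CW" and wW: "0 < wmin" "0 < Wmax" and vols: "\<forall>x\<in>D.
      (\<forall>u. 0 < u \<longrightarrow> u \<le> M1 \<longrightarrow> 0 < vol m x (rinv \<Phi> u) \<and> vol m x (rinv \<Phi> u) \<le> Wmax) \<and>
      (\<forall>u v. 0 < u \<longrightarrow> u \<le> v \<longrightarrow> v \<le> M1 \<longrightarrow> vol m x (rinv \<Phi> u) \<le> CW * vol m x (rinv \<Phi> v) \<and>
        vol m x (rinv \<Phi> v) \<le> CW * (v / u) powr \<kappa> * vol m x (rinv \<Phi> u)) \<and>
      (\<forall>u. 1 \<le> u \<longrightarrow> u \<le> M1 \<longrightarrow> wmin \<le> vol m x (rinv \<Phi> u))"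
    using volumes[OF M1(1)] by (elim exE conjE) (rule that; assumption)
  have v1: "0 < vol m x (rinv \<Phi> u) \<and> vol m x (rinv \<Phi> u) \<le> Wmax" if "x \<in> D" "0 < u" "u \<le> M1" for x u
    using vols that by blast
  have v2: "wmin \<le> vol m x (rinv \<Phi> u)" if "x \<in> D" "1 \<le> u" "u \<le> M1" for x u
    using vols that by blast
  have v3: "\<Phi> (diameter D) \<le> M1" using M0 M1 \<Phi>_diam by (simp add: Rm_def)
  obtain a1 a2 a3 a4 where a: "0 < a1" "0 < a2" "0 < a3" "0 < a4" and
    p_bounds: "\<And>x y u. x \<in> D \<Longrightarrow> y \<in> D \<Longrightarrow> 0 < u \<Longrightarrow> u \<le> M1 \<Longrightarrow>
      p u x y \<le> ennreal (a3 * (frozen M0 h x y u / vol m x (rinv \<Phi> u))) \<and>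
      ennreal (a1 * (frozen M0 h x y u / vol m x (rinv \<Phi> u)) * exp (- a2 * (dist x y / rinv \<Phi> u)\<^sup>2)) \<le> p u x y"
    "\<And>x y u. x \<in> D \<Longrightarrow> y \<in> D \<Longrightarrow> 0 < u \<Longrightarrow> u \<le> M1 \<Longrightarrow> 0 < dist x y \<Longrightarrow>
      p u x y \<le> ennreal (a3 * (C0 * (u * frozen M0 h x y u) / (vol m x (dist x y) * \<Psi> (dist x y))
        + frozen M0 h x y u / vol m x (rinv \<Phi> u) * exp (- a4 * (dist x y / rinv \<Phi> u)\<^sup>2))) \<and>
      ennreal (a1 * frozen M0 h x y u * min (1 / vol m x (rinv \<Phi> u)) (C0 * u / (vol m x (dist x y) * \<Psi> (dist x y)))) \<le> p u x y"
    "\<And>x y u. x \<in> D \<Longrightarrow> y \<in> D \<Longrightarrow> M1 < u \<Longrightarrow> p u x y \<le> ennreal (a3 * frozen M0 h x y u)"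
  proof (rule Sc.heat_kernel_bounds[OF assms(14,12) _ M0(1) M1(2) \<gamma> Cg _ wW _ _ v3], goal_cases)
    case (5 a1 a2 a3 a4)
    show thesis by (rule that) (fact 5)+
  next
    case 1 show ?case by (rule \<Psi>) (fact 1)+
  next
    case 2 show ?case by (rule G_doubling[unfolded G_def]) (fact 2)+
  next
    case 3 show ?case by (rule v1) (fact 3)+
  next
    case 4 show ?case by (rule v2) (fact 4)+
  qed
  obtain Kb where Kb: "0 < Kb"
    "\<And>x. 1 \<le> x \<Longrightarrow> x powr ((\<gamma> + \<kappa> + (\<beta>2 + 1)) / (2 * k1)) * exp (- (a4 * e1\<^sup>2) * x) \<le> Kb"
    using a k by (rule_tac bounded_powr_times_exp[of "a4 * e1\<^sup>2"]) auto
  interpret SC: subordination_constants \<nu> \<phi> Rm c1 c2 \<beta>1 \<beta>2 \<Phi> k1 k2 e1 e2 \<gamma> Cg \<kappa> CW Wmax M1 "\<gamma> + \<kappa>" \<epsilon> K \<delta> C c a1 a2 a3 a4 C0 Kb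
    by unfold_locales (use k rl ru \<gamma> \<kappa> Cg CW wW law_constants a C0 Kb in auto)
  have kernel: "subordinate_kernel_at \<nu> \<phi> Rm c1 c2 \<beta>1 \<beta>2 \<Phi> k1 k2 e1 e2 \<gamma> Cg \<kappa> CW Wmax M1 (\<gamma> + \<kappa>) \<epsilon> K \<delta> C c a1 a2 a3 a4 C0 Kb
      t (distr (P (Some x)) borel (S t)) (G x y) (\<lambda>u. vol m x (rinv \<Phi> u)) (dist x y) (\<Psi> (dist x y)) (\<lambda>u. p u x y)"
    if t: "t \<in> {0<..T}" and xy: "x \<in> D" "y \<in> D" for t x y
  proof (unfold_locales, unfold SC.kernel_at_def, intro conjI)
    show "0 < t" using t by simp
    have "K * PL.time_scale t \<le> K * sT"
      using t law_constants PL.time_scale_mono[of t T] by (auto simp: sT_def intro!: mult_left_mono)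
    then show "K * PL.time_scale t \<le> M1" using M1 by linarith
    show "PL.law_bounds (\<gamma> + \<kappa>) \<epsilon> K \<delta> C c t (distr (P (Some x)) borel (S t))"
      using law[OF drift[OF xy(1)]] t by simp
    show "antimono (G x y)" "\<forall>u. 0 \<le> G x y u"
      unfolding G_def using frozen_boundary_function[OF assms(12) xy] M0 by auto
    show "\<forall>u v. 0 < u \<longrightarrow> u \<le> v \<longrightarrow> u powr \<gamma> * G x y u \<le> Cg * (v powr \<gamma> * G x y v)"
      using G_doubling[OF xy] by blast
    show "\<forall>u. 0 < u \<longrightarrow> u \<le> M1 \<longrightarrow> 0 < vol m x (rinv \<Phi> u) \<and> vol m x (rinv \<Phi> u) \<le> Wmax"
      using vols xy by blast
    show "\<forall>u v. 0 < u \<longrightarrow> u \<le> v \<longrightarrow> v \<le> M1 \<longrightarrow> vol m x (rinv \<Phi> u) \<le> CW * vol m x (rinv \<Phi> v) \<and>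
        vol m x (rinv \<Phi> v) \<le> CW * (v / u) powr \<kappa> * vol m x (rinv \<Phi> u)"
      using vols xy by blast
    show "4 * \<Phi> (dist x y) \<le> Rm" using \<Phi>_dist[OF xy] .
    then show "4 * \<Phi> (dist x y) \<le> M1" using M0 M1 by linarith
    show "\<Phi> (dist x y) \<le> \<Psi> (dist x y)" by (intro \<Psi>) simp
    show "\<forall>u. 0 < u \<longrightarrow> u \<le> M1 \<longrightarrow> p u x y \<le> ennreal (a3 * (G x y u / vol m x (rinv \<Phi> u))) \<and>
      ennreal (a1 * (G x y u / vol m x (rinv \<Phi> u)) * exp (- a2 * (dist x y / rinv \<Phi> u)\<^sup>2)) \<le> p u x y"
      unfolding G_def using p_bounds(1)[OF xy] by blast
    show "\<forall>u. 0 < u \<longrightarrow> u \<le> M1 \<longrightarrow> 0 < dist x y \<longrightarrow>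
      p u x y \<le> ennreal (a3 * (C0 * (u * G x y u) / (vol m x (rinv \<Phi> (\<Phi> (dist x y))) * \<Psi> (dist x y))
        + G x y u / vol m x (rinv \<Phi> u) * exp (- a4 * (dist x y / rinv \<Phi> u)\<^sup>2))) \<and>
      ennreal (a1 * G x y u * min (1 / vol m x (rinv \<Phi> u)) (C0 * u / (vol m x (rinv \<Phi> (\<Phi> (dist x y))) * \<Psi> (dist x y)))) \<le> p u x y"
      unfolding G_def Sc.rinv_scale[OF zero_le_dist] using p_bounds(2)[OF xy] by blast
    show "\<forall>u>M1. p u x y \<le> ennreal (a3 * G x y u)"
      unfolding G_def using p_bounds(3)[OF xy] by blast
  qed simp
  have h_scale: "h (1 / rinv \<phi> (1 / t)) x y = G x y (PL.time_scale t)" if "t \<in> {0<..T}" for t x y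
  proof -
    have "PL.time_scale t \<le> M0" using that PL.time_scale_mono[of t T] M0 by (simp add: sT_def)
    then show ?thesis using PL.time_scale_pos[of t] that by (simp add: G_def frozen_eq PL.time_scale_def[symmetric])
  qed
  have near: "ennreal (c * SC.lower_factor * exp (- SC.lower_exponent * SC.ratio_above\<^sup>2) *
        (h (1 / rinv \<phi> (1 / t)) x y / vol m x (rinv (psi \<phi> \<Phi>) t))) \<le> subordinate_kernel P S p t x y \<and>
      subordinate_kernel P S p t x y \<le> ennreal (a3 * (SC.near_factor + CW + Wmax) * C *
        (h (1 / rinv \<phi> (1 / t)) x y / vol m x (rinv (psi \<phi> \<Phi>) t)))"
    if t: "t \<in> {0<..T}" and xy: "x \<in> D" "y \<in> D" and le: "psi \<phi> \<Phi> (dist x y) \<le> t" for t x y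
  proof -
    interpret X: subordinate_kernel_at \<nu> \<phi> Rm c1 c2 \<beta>1 \<beta>2 \<Phi> k1 k2 e1 e2 \<gamma> Cg \<kappa> CW Wmax M1 "\<gamma> + \<kappa>" \<epsilon> K \<delta> C c a1 a2 a3 a4 C0 Kb
      t "distr (P (Some x)) borel (S t)" "G x y" "\<lambda>u. vol m x (rinv \<Phi> u)" "dist x y" "\<Psi> (dist x y)" "\<lambda>u. p u x y"
      by (rule kernel[OF t xy])
    have "\<Phi> (dist x y) \<le> PL.time_scale t" using SC.psi_le_iff[of t "dist x y"] t le by simp
    then show ?thesis
      using X.near_diagonal_lower X.near_diagonal_upper SC.rinv_psi[of t] t
      by (simp add: h_scale subordinate_kernel_def)
  qed
  have far: "ennreal (SC.off_lower * F SC.lower_exponent) \<le> subordinate_kernel P S p t x y \<and>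
      subordinate_kernel P S p t x y \<le> ennreal (SC.off_upper * F SC.upper_exponent)"
    if t: "t \<in> {0<..T}" and xy: "x \<in> D" "y \<in> D" and le: "t \<le> psi \<phi> \<Phi> (dist x y)"
      and F: "F = (\<lambda>c. C0 / (vol m x (dist x y) * \<Psi> (dist x y)) *
                    (t * boundary_integral \<phi> (levy_tail \<nu>) \<Phi> h t x y
                      + h (1 / rinv \<phi> (1 / t)) x y / rinv \<phi> (1 / t))
                  + h (1 / rinv \<phi> (1 / t)) x y / vol m x (rinv (psi \<phi> \<Phi>) t)
                    * exp (- c * (dist x y)\<^sup>2 / (rinv (psi \<phi> \<Phi>) t)\<^sup>2)
                  + h (\<Phi> (dist x y)) x y * (t * levy_tail \<nu> (\<Phi> (dist x y)) / vol m x (dist x y)))" for t x y F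
  proof -
    interpret K: subordinate_kernel_at \<nu> \<phi> Rm c1 c2 \<beta>1 \<beta>2 \<Phi> k1 k2 e1 e2 \<gamma> Cg \<kappa> CW Wmax M1 "\<gamma> + \<kappa>" \<epsilon> K \<delta> C c a1 a2 a3 a4 C0 Kb
      t "distr (P (Some x)) borel (S t)" "G x y" "\<lambda>u. vol m x (rinv \<Phi> u)" "dist x y" "\<Psi> (dist x y)" "\<lambda>u. p u x y"
      by (rule kernel[OF t xy])
    have t0: "0 < t" using t by simp
    have r_M0: "4 * \<Phi> (dist x y) \<le> M0" using \<Phi>_dist[OF xy] M0 by linarith
    note B = SC.boundary_integral_frozen[OF assms(12) xy t0 _ r_M0]
    interpret X: off_diagonal_kernel_at \<nu> \<phi> Rm c1 c2 \<beta>1 \<beta>2 \<Phi> k1 k2 e1 e2 \<gamma> Cg \<kappa> CW Wmax M1 "\<gamma> + \<kappa>" \<epsilon> K \<delta> C c a1 a2 a3 a4 C0 Kb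
      t "distr (P (Some x)) borel (S t)" "G x y" "\<lambda>u. vol m x (rinv \<Phi> u)" "dist x y" "\<Psi> (dist x y)" "\<lambda>u. p u x y"
      "boundary_integral \<phi> (levy_tail \<nu>) \<Phi> h t x y"
    proof
      show "PL.time_scale t \<le> \<Phi> (dist x y)" using SC.le_psiD[OF t0 _ le] by simp
      show "0 \<le> boundary_integral \<phi> (levy_tail \<nu>) \<Phi> h t x y" using B(1) M0 by simp
      show "ennreal (boundary_integral \<phi> (levy_tail \<nu>) \<Phi> h t x y) =
        (\<integral>\<^sup>+v. ennreal (G x y v * levy_tail \<nu> v) * indicator {2 * PL.time_scale t..4 * \<Phi> (dist x y)} v \<partial>lborel)"
        unfolding G_def using B(2) M0 by simp
    qed
    have hr: "h (\<Phi> (dist x y)) x y = G x y (\<Phi> (dist x y))"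
      using X.r_pos r_M0 by (simp add: G_def frozen_eq)
    have s: "h (1 / rinv \<phi> (1 / t)) x y / rinv \<phi> (1 / t) = PL.time_scale t * G x y (PL.time_scale t)"
      by (simp add: h_scale[OF t]) (simp add: PL.time_scale_def)
    have "F b = X.kernel_jump + X.bulk b + X.single_jump" for b
      unfolding F s
      unfolding X.kernel_jump_def X.bulk_def X.single_jump_def X.J_def hr h_scale[OF t] SC.rinv_psi[OF t0]
        Sc.rinv_scale[OF zero_le_dist] by (simp add: power_divide)
    then show ?thesis using X.off_diagonal_lower X.off_diagonal_upper by (simp add: subordinate_kernel_def)
  qed
  have pos: "0 < c * SC.lower_factor * exp (- SC.lower_exponent * SC.ratio_above\<^sup>2)"
      "0 < a3 * (SC.near_factor + CW + Wmax) * C"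
    using law_constants SC.lower_factor_pos a SC.near_factor_ge CW wW by auto
  show ?thesis
  proof (rule conjI, goal_cases)
    case 1
    show ?case
      unfolding Let_def
      by (rule exI, rule conjI[OF pos(1)], rule exI, rule conjI[OF pos(2)], intro ballI impI, rule near)
  next
    case 2
    show ?case
      unfolding Let_def
      by (rule exI, rule conjI[OF SC.off_lower_pos], rule exI, rule conjI[OF SC.lower_exponent_pos],
          rule exI, rule conjI[OF SC.off_upper_pos], rule exI, rule conjI[OF SC.upper_exponent_pos],
          intro ballI impI, rule far[OF _ _ _ _ refl])
  qed
qed

end
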